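(* Let $n\ge1$, $d_1,\dots,d_n\ge1$ be integers, $D=d_1\cdots d_n$, and let $\mathcal{M}\subseteq\mathbb{P}^{D-1}_p$ be the joint independence model on $d_1\times\cdots\times d_n$ contingency tables given by a partition $\{S_1,\dots,S_q\}$ of $\{1,\dots,n\}$ (equivalently, of the random variables $X_1,\dots,X_n$). For $k=1,\dots,q$ let $M_{S_k}$ be the matrix obtained from the flattening $P_{S_k}$ by appending the column of marginal sums of the $u$'s for the states of $\{X_i:i\in S_k\}$. Then the ideal \[ I=\sum_{k=1}^q I_2(M_{S_k})\subset\mathbb{C}[p_{i_1\cdots i_n},u_{i_1\cdots i_n}] \] is prime and is the likelihood ideal of $\mathcal{M}$. Furthermore, the generators of $I$ (the $2\times2$ minors of the matrices $M_{S_1},\dots,M_{S_q}$) form a Gröbner basis of $I$ under the lexicographic term order for the $p$'s followed by the lexicographic term order for the $u$'s, where the variables are indexed as entries of a $D_1\times\cdots\times D_q$ table, $D_k=\prod_{i\in S_k}d_i$, by treating each group $\{X_i:i\in S_k\}$ as a single random variable with $D_k$ outcomes.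
   Context: Indices $(i_1,\dots,i_n)$ range over $[d_1]\times\cdots\times[d_n]$, where $[d]=\{1,\dots,d\}$; $X_i$ is a discrete random variable with values in $[d_i]$. $\mathbb{P}^{D-1}_p$ and $\mathbb{P}^{D-1}_u$ are complex projective spaces with homogeneous coordinates $p_{i_1\cdots i_n}$ and $u_{i_1\cdots i_n}$. $I_2(N)$ is the ideal generated by the $2\times2$ minors of $N$. Joint independence model: the undirected graphical model of a graph on vertices $X_1,\dots,X_n$ all of whose connected components are complete graphs; the vertex sets of the components form the partition $\{S_1,\dots,S_q\}$. Concretely, with $V_i=\mathbb{C}^{d_i}$, $\mathcal{M}\subseteq\mathbb{P}(V_1\otimes\cdots\otimes V_n)=\mathbb{P}^{D-1}_p$ is the image of the Segre embedding of $\prod_{k=1}^q\mathbb{P}\bigl(\bigotimes_{i\in S_k}V_i\bigr)$, i.e. the set of $p$ of the form $p_{i_1\cdots i_n}=\prod_{k=1}^q a^{(k)}_{(i_j)_{j\in S_k}}$. Regrouping: for each $k$, identify $\prod_{i\in S_k}[d_i]$ with $[D_k]$ by listing it in lexicographic order. This identifies multi-indices $(i_1,\dots,i_n)$ with tuples $(j_1,\dots,j_q)\in[D_1]\times\cdots\times[D_q]$, and identifies $\mathcal{M}$ with the set of rank one $D_1\times\cdots\times D_q$ tensors (the complete independence model on $q$ variables). Matrices: $P_{S_k}$ is the $D_k\times(D/D_k)$ matrix with rows indexed by the states $t\in\prod_{i\in S_k}[d_i]$ and columns by the states of the remaining variables (both in the order above), with entries the corresponding $p_{i_1\cdots i_n}$.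 $M_{S_k}$ is $P_{S_k}$ with an extra last column whose entry in row $t$ is the marginal sum of all $u_{i_1\cdots i_n}$ with $(i_j)_{j\in S_k}=t$. Term order: the lexicographic order in which all $p$ variables are larger than all $u$ variables and, within the $p$'s and within the $u$'s, variables are ordered lexicographically by their tuple $(j_1,\dots,j_q)$, smaller tuple meaning larger variable. Likelihood correspondence and likelihood ideal: write $s$ for a multi-index, and $p_+=\sum_s p_s$, $u_+=\sum_s u_s$. The likelihood function is $\ell_u(p)=\prod_s p_s^{u_s}/(\sum_s p_s)^{\sum_s u_s}$, and $\operatorname{dlog}\ell_u(p)=\sum_s\left(\frac{u_s}{p_s}-\frac{u_+}{p_+}\right)dp_s$. Let $\mathcal{H}\subset\mathbb{P}^{D-1}_p$ be the union of all coordinate hyperplanes $V(p_s)$ and $V(\sum_s p_s)$. For a closed irreducible $\mathcal{M}\subseteq\mathbb{P}^{D-1}_p$ with smooth locus $\mathcal{M}_{\mathrm{reg}}$, \[ \mathcal{L}_{\mathcal{M}}=\overline{\{(p,u)\in(\mathcal{M}_{\mathrm{reg}}\setminus\mathcal{H})\times\mathbb{P}^{D-1}_u : \operatorname{dlog}\ell_u|_{\mathcal{M}}(p)=0\}}\subseteq\mathbb{P}^{D-1}_p\times\mathbb{P}^{D-1}_u \] (Zariski closure), where the condition means that the one-form vanishes on the tangent space of $\mathcal{M}$ at $p$ (equivalently, of its affine cone at a representative of $p$). The likelihood ideal of $\mathcal{M}$ is the (bihomogeneous) vanishing ideal of $\mathcal{L}_{\mathcal{M}}$ in $\mathbb{C}[p_{i_1\cdots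 i_n},u_{i_1\cdots i_n}]$. *)

theory Defs
  imports
    Complex_Main
    "HOL-Library.Poly_Mapping"
    "HOL-Library.Function_Algebras"
    "HOL-Library.Disjoint_Sets"
    "HOL-Algebra.Ideal"
    "Jordan_Normal_Form.Matrix"
begin

section \<open>Polynomials over the complex numbers in a set of variables\<close>

type_synonym 'v mpoly = "('v \<Rightarrow>\<^sub>0 nat) \<Rightarrow>\<^sub>0 complex"

definition indets :: "'v mpoly \<Rightarrow> 'v set" where
  "indets f = (\<Union>m\<in>Poly_Mapping.keys f. Poly_Mapping.keys m)"

definition mpoly_ring :: "'v set \<Rightarrow> 'v mpoly ring" where
  "mpoly_ring V =
    \<lparr>carrier = {f. indets f \<subseteq> V},
     monoid.mult = (*), one = 1, zero = 0, add = (+)\<rparr>"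

definition Var :: "'v \<Rightarrow> 'v mpoly" where
  "Var v = Poly_Mapping.single (Poly_Mapping.single v 1) 1"

definition eval_mpoly :: "('v \<Rightarrow> complex) \<Rightarrow> 'v mpoly \<Rightarrow> complex" where
  "eval_mpoly x f =
    (\<Sum>m\<in>Poly_Mapping.keys f.
       Poly_Mapping.lookup f m * (\<Prod>v\<in>Poly_Mapping.keys m. x v ^ Poly_Mapping.lookup m v))"

definition partial_deriv :: "'v \<Rightarrow> 'v mpoly \<Rightarrow> 'v mpoly" where
  "partial_deriv v f =
    (\<Sum>m\<in>Poly_Mapping.keys f. Poly_Mapping.single (m - Poly_Mapping.single v 1)
                     (of_nat (Poly_Mapping.lookup m v) * Poly_Mapping.lookup f m))"

section \<open>Leading terms and Groebner bases\<close>

text \<open>A term order is a strict order relation, \<open>(m, m') \<in> ord\<close> meaning that \<open>m\<close> is smaller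
  than \<open>m'\<close>.  In \<open>lex_term_order vs\<close> the list \<open>vs\<close> enumerates the variables from the largest
  to the smallest one.\<close>

definition lex_term_order :: "'v list \<Rightarrow> ('v \<Rightarrow>\<^sub>0 nat) rel" where
  "lex_term_order vs = inv_image (lexord less_than) (\<lambda>m. map (Poly_Mapping.lookup m) vs)"

definition lead_monomial :: "('v \<Rightarrow>\<^sub>0 nat) rel \<Rightarrow> 'v mpoly \<Rightarrow> 'v \<Rightarrow>\<^sub>0 nat" where
  "lead_monomial ord f =
    (THE m. m \<in> Poly_Mapping.keys f \<and> (\<forall>m'\<in>Poly_Mapping.keys f - {m}. (m', m) \<in> ord))"

definition lead_term :: "('v \<Rightarrow>\<^sub>0 nat) rel \<Rightarrow> 'v mpoly \<Rightarrow> 'v mpoly" where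
  "lead_term ord f =
    Poly_Mapping.single (lead_monomial ord f) (Poly_Mapping.lookup f (lead_monomial ord f))"

definition groebner_basis ::
  "'v set \<Rightarrow> ('v \<Rightarrow>\<^sub>0 nat) rel \<Rightarrow> 'v mpoly set \<Rightarrow> 'v mpoly set \<Rightarrow> bool" where
  "groebner_basis V ord G I \<longleftrightarrow> finite G \<and> G \<subseteq> I \<and>
     Idl\<^bsub>mpoly_ring V\<^esub> (lead_term ord ` (G - {0})) =
     Idl\<^bsub>mpoly_ring V\<^esub> (lead_term ord ` (I - {0}))"

section \<open>Projective space, tangent spaces and smooth points\<close>

text \<open>For a finite index set \<open>C\<close>, a point of the projective space with homogeneous coordinates
  indexed by \<open>C\<close> is given by its representatives, the nonzero vectors supported on \<open>C\<close>.  A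
  subset of projective space is the set of all representatives of its points.\<close>

definition proj_points :: "'i set \<Rightarrow> ('i \<Rightarrow> complex) set" where
  "proj_points C = {x. (\<forall>i. i \<notin> C \<longrightarrow> x i = 0) \<and> x \<noteq> 0}"

definition homogeneous :: "'i set \<Rightarrow> 'i mpoly \<Rightarrow> bool" where
  "homogeneous C f \<longleftrightarrow>
    (\<exists>a. \<forall>m\<in>Poly_Mapping.keys f. (\<Sum>i\<in>C. Poly_Mapping.lookup m i) = a)"

definition vanishing_forms :: "'i set \<Rightarrow> ('i \<Rightarrow> complex) set \<Rightarrow> 'i mpoly set" where
  "vanishing_forms C X =
    {f \<in> carrier (mpoly_ring C). homogeneous C f \<and> (\<forall>x\<in>X. eval_mpoly x f = 0)}"

text \<open>The tangent space at a representative \<open>p\<close> of the affine cone over \<open>X\<close>.\<close>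

definition cone_tangent_space ::
  "'i set \<Rightarrow> ('i \<Rightarrow> complex) set \<Rightarrow> ('i \<Rightarrow> complex) \<Rightarrow> ('i \<Rightarrow> complex) set" where
  "cone_tangent_space C X p =
    {v. (\<forall>i. i \<notin> C \<longrightarrow> v i = 0) \<and>
        (\<forall>f\<in>vanishing_forms C X. (\<Sum>i\<in>C. eval_mpoly p (partial_deriv i f) * v i) = 0)}"

interpretation cfun: vector_space "\<lambda>(c::complex) (v::'i \<Rightarrow> complex) i. c * v i"
  by unfold_locales (auto simp: fun_eq_iff algebra_simps)

text \<open>The nonsingular points of an irreducible variety are those at which the dimension of the
  tangent space takes its minimal value, which is then the dimension of the variety (Shafarevich,
  Basic Algebraic Geometry 1, Chapter II, Section 1.4).  Passing to the affine cone raises all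
  these dimensions by one.\<close>

definition smooth_locus :: "'i set \<Rightarrow> ('i \<Rightarrow> complex) set \<Rightarrow> ('i \<Rightarrow> complex) set" where
  "smooth_locus C X =
    {p \<in> X. \<forall>p'\<in>X. cfun.dim (cone_tangent_space C X p) \<le> cfun.dim (cone_tangent_space C X p')}"

section \<open>The likelihood correspondence and the likelihood ideal\<close>

datatype 'i pu_var = Pvar 'i | Uvar 'i

definition pu_vars :: "'i set \<Rightarrow> 'i pu_var set" where
  "pu_vars C = Pvar ` C \<union> Uvar ` C"

abbreviation pu_ring :: "'i set \<Rightarrow> 'i pu_var mpoly ring" where
  "pu_ring C \<equiv> mpoly_ring (pu_vars C)"

definition bihomogeneous :: "'i set \<Rightarrow> 'i pu_var mpoly \<Rightarrow> bool" where
  "bihomogeneous C f \<longleftrightarrow>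
    (\<exists>a b. \<forall>m\<in>Poly_Mapping.keys f.
       (\<Sum>i\<in>C. Poly_Mapping.lookup m (Pvar i)) = a \<and>
       (\<Sum>i\<in>C. Poly_Mapping.lookup m (Uvar i)) = b)"

definition vanishing_biforms ::
  "'i set \<Rightarrow> (('i \<Rightarrow> complex) \<times> ('i \<Rightarrow> complex)) set \<Rightarrow> 'i pu_var mpoly set" where
  "vanishing_biforms C X =
    {f \<in> carrier (pu_ring C). bihomogeneous C f \<and>
       (\<forall>(p, u)\<in>X. eval_mpoly (case_pu_var p u) f = 0)}"

definition zariski_closure ::
  "'i set \<Rightarrow> (('i \<Rightarrow> complex) \<times> ('i \<Rightarrow> complex)) set
     \<Rightarrow> (('i \<Rightarrow> complex) \<times> ('i \<Rightarrow> complex)) set" where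
  "zariski_closure C X =
    {(p, u) \<in> proj_points C \<times> proj_points C.
       \<forall>f\<in>vanishing_biforms C X. eval_mpoly (case_pu_var p u) f = 0}"

definition vanishing_ideal ::
  "'i set \<Rightarrow> (('i \<Rightarrow> complex) \<times> ('i \<Rightarrow> complex)) set \<Rightarrow> 'i pu_var mpoly set" where
  "vanishing_ideal C X = Idl\<^bsub>pu_ring C\<^esub> (vanishing_biforms C X)"

definition arrangement_H :: "'i set \<Rightarrow> ('i \<Rightarrow> complex) set" where
  "arrangement_H C = {p \<in> proj_points C. (\<exists>i\<in>C. p i = 0) \<or> (\<Sum>i\<in>C. p i) = 0}"

definition dlog_likelihood ::
  "'i set \<Rightarrow> ('i \<Rightarrow> complex) \<Rightarrow> ('i \<Rightarrow> complex) \<Rightarrow> ('i \<Rightarrow> complex) \<Rightarrow> complex" where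
  "dlog_likelihood C u p v = (\<Sum>i\<in>C. (u i / p i - (\<Sum>j\<in>C. u j) / (\<Sum>j\<in>C. p j)) * v i)"

definition likelihood_correspondence ::
  "'i set \<Rightarrow> ('i \<Rightarrow> complex) set \<Rightarrow> (('i \<Rightarrow> complex) \<times> ('i \<Rightarrow> complex)) set" where
  "likelihood_correspondence C M = zariski_closure C
    {(p, u) \<in> (smooth_locus C M - arrangement_H C) \<times> proj_points C.
       \<forall>v\<in>cone_tangent_space C M p. dlog_likelihood C u p v = 0}"

definition likelihood_ideal :: "'i set \<Rightarrow> ('i \<Rightarrow> complex) set \<Rightarrow> 'i pu_var mpoly set" where
  "likelihood_ideal C M = vanishing_ideal C (likelihood_correspondence C M)"

section \<open>Contingency tables and joint independence models\<close>

text \<open>Random variables and outcomes are numbered from 0.  The list \<open>ds\<close> holds the numbers of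
  outcomes \<open>d\<^sub>i\<close>, a multi-index \<open>s\<close> is a list of outcomes, and \<open>nths s S\<close> is its part
  \<open>(i\<^sub>j)\<close> with \<open>j \<in> S\<close>.  The function \<open>product_lists\<close> enumerates in lexicographic order.\<close>

definition states :: "nat list \<Rightarrow> nat list list" where
  "states ds = product_lists (map (\<lambda>d. [0..<d]) ds)"

abbreviation cells :: "nat list \<Rightarrow> nat list set" where
  "cells ds \<equiv> set (states ds)"

definition joint_independence_model :: "nat list \<Rightarrow> nat set list \<Rightarrow> (nat list \<Rightarrow> complex) set" where
  "joint_independence_model ds Ss =
    {p \<in> proj_points (cells ds). \<exists>a :: nat \<Rightarrow> nat list \<Rightarrow> complex.
       \<forall>s\<in>cells ds. p s = (\<Prod>k<length Ss. a k (nths s (Ss ! k)))}"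

text \<open>The sizes \<open>D\<^sub>k\<close> of the regrouped table, the tuple \<open>(j\<^sub>1, \<dots>, j\<^sub>q)\<close> of a multi-index, and
  the multi-index of a tuple.\<close>

definition group_sizes :: "nat list \<Rightarrow> nat set list \<Rightarrow> nat list" where
  "group_sizes ds Ss = map (\<lambda>S. prod_list (nths ds S)) Ss"

definition position :: "'a list \<Rightarrow> 'a \<Rightarrow> nat" where
  "position xs x = length (takeWhile (\<lambda>y. y \<noteq> x) xs)"

definition regroup :: "nat list \<Rightarrow> nat set list \<Rightarrow> nat list \<Rightarrow> nat list" where
  "regroup ds Ss s = map (\<lambda>S. position (states (nths ds S)) (nths s S)) Ss"

definition ungroup :: "nat list \<Rightarrow> nat set list \<Rightarrow> nat list \<Rightarrow> nat list" where
  "ungroup ds Ss = the_inv_into (cells ds) (regroup ds Ss)"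

text \<open>Row \<open>r\<close> of the flattening belongs to the state of the \<open>k\<close>-th group with \<open>j\<^sub>k = r\<close>; its
  columns are the tuples \<open>w\<close> of the remaining \<open>j\<^sub>l\<close> in lexicographic order.  The list
  \<open>take k w @ r # drop k w\<close> is the complete tuple.\<close>

definition flattening :: "nat list \<Rightarrow> nat set list \<Rightarrow> nat \<Rightarrow> nat list pu_var mpoly mat" where
  "flattening ds Ss k =
    (let ws = states (nths (group_sizes ds Ss) (- {k}))
     in mat (group_sizes ds Ss ! k) (length ws)
          (\<lambda>(r, c). Var (Pvar (ungroup ds Ss (take k (ws ! c) @ r # drop k (ws ! c))))))"

definition marginal_column :: "nat list \<Rightarrow> nat set list \<Rightarrow> nat \<Rightarrow> nat list pu_var mpoly vec" where
  "marginal_column ds Ss k =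
    vec (group_sizes ds Ss ! k)
      (\<lambda>r. \<Sum>s | s \<in> cells ds \<and> nths s (Ss ! k) = states (nths ds (Ss ! k)) ! r. Var (Uvar s))"

definition likelihood_matrix :: "nat list \<Rightarrow> nat set list \<Rightarrow> nat \<Rightarrow> nat list pu_var mpoly mat" where
  "likelihood_matrix ds Ss k =
    mat_of_cols (group_sizes ds Ss ! k) (cols (flattening ds Ss k) @ [marginal_column ds Ss k])"

definition minors2 :: "'a::comm_ring_1 mat \<Rightarrow> 'a set" where
  "minors2 N = {N $$ (r, c) * N $$ (r', c') - N $$ (r, c') * N $$ (r', c) | r r' c c'.
     r < r' \<and> r' < dim_row N \<and> c < c' \<and> c' < dim_col N}"

definition I2 :: "'v set \<Rightarrow> 'v mpoly mat \<Rightarrow> 'v mpoly set" where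
  "I2 V N = Idl\<^bsub>mpoly_ring V\<^esub> (minors2 N)"

definition sum_of_minor_ideals :: "nat list \<Rightarrow> nat set list \<Rightarrow> nat list pu_var mpoly set" where
  "sum_of_minor_ideals ds Ss =
    {(\<Sum>k<length Ss. f k) | f.
       \<forall>k<length Ss. f k \<in> I2 (pu_vars (cells ds)) (likelihood_matrix ds Ss k)}"

definition minor_generators :: "nat list \<Rightarrow> nat set list \<Rightarrow> nat list pu_var mpoly set" where
  "minor_generators ds Ss = (\<Union>k<length Ss. minors2 (likelihood_matrix ds Ss k))"

text \<open>All \<open>p\<close> variables come before all \<open>u\<close> variables; in each group the variables are listed by
  increasing tuple, that is, from the largest to the smallest variable.\<close>

definition ordered_pu_vars :: "nat list \<Rightarrow> nat set list \<Rightarrow> nat list pu_var list" where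
  "ordered_pu_vars ds Ss =
    (let ss = map (ungroup ds Ss) (states (group_sizes ds Ss))
     in map Pvar ss @ map Uvar ss)"

end

theory Submission
  imports Defs "HOL-Computational_Algebra.Polynomial"
begin

text \<open>After regrouping, the model consists of the tables \<open>p = \<nu> \<cdot> \<Otimes> \<alpha>\<^sub>k\<close> with \<open>\<Sum>\<^sub>r \<alpha>\<^sub>k r = 1\<close>, and the
  critical points over \<open>p\<close> are the tables \<open>u\<close> whose marginals are \<open>\<lambda> \<alpha>\<^sub>k\<close>.  Solving the marginal
  conditions for the axis cells (at most one nonzero coordinate) parametrizes all these pairs by
  polynomials in \<open>\<nu>, \<lambda>\<close>, the \<open>\<alpha>\<^sub>k r\<close> with \<open>r \<ge> 1\<close> and the remaining \<open>u\<close>, so their vanishing ideal \<open>J\<close>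
  is prime, and it contains the minors.  Give the parameters weights that make the remaining \<open>u\<close>
  negligible against the axis cells.  Then every variable has a single monomial in the parameters as
  its lowest term, and these lowest terms separate the monomials not divisible by any leading
  monomial of a minor.  Hence no nonzero element of \<open>J\<close> consists of such standard monomials, and
  division by the minors gives both that they generate \<open>J\<close> and that they form a Groebner basis.
  Finally, \<open>J\<close> is the ideal of the likelihood correspondence because the points of the model without
  vanishing coordinates are smooth, with the tangent space cut out by the differentials of the
  minors.\<close>

text \<open>No S-pairs are reduced. It is enough that the standard monomials are independent modulo
  \<open>param_ideal\<close>, and the difficulty is that different monomials can have the same
  lowest term in the parameters: the two terms of a p minor always do. Standardness must exclude
  every such collision. The exponents of the parameters in the lowest term of \<open>m\<close> are
  the numbers \<open>digit m \<pi>\<close>, which are sums of the exponents of \<open>m\<close> over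
  the sets \<open>param_vars \<pi>\<close>. Each leading monomial is a product of two variables, so
  not being divisible by it means that one of the two is absent. If this excludes all pairs from A -
  B and B - A, the sum over the intersection of A and B is the minimum of the two sums. Applied to
  suitable sets of variables, this minimum rule computes the p exponents from the digits, and the u
  exponents can then be read off. The weights are powers of a base exceeding all digits, so
  exponents along a single univariate curve already distinguish the digit vectors.\<close>

abbreviation lkp :: "('a \<Rightarrow>\<^sub>0 'b::zero) \<Rightarrow> 'a \<Rightarrow> 'b" where "lkp \<equiv> Poly_Mapping.lookup"
abbreviation supp :: "('a \<Rightarrow>\<^sub>0 'b::zero) \<Rightarrow> 'a set" where "supp \<equiv> Poly_Mapping.keys"

section \<open>Evaluation of polynomials\<close>

definition eval_monom :: "('v \<Rightarrow> 'a::comm_ring_1) \<Rightarrow> ('v \<Rightarrow>\<^sub>0 nat) \<Rightarrow> 'a" where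
  "eval_monom x m = (\<Prod>v\<in>supp m. x v ^ lkp m v)"

lemma eval_monom_superset:
  assumes "finite A" "supp m \<subseteq> A"
  shows "eval_monom x m = (\<Prod>v\<in>A. x v ^ lkp m v)"
  unfolding eval_monom_def
  by (rule prod.mono_neutral_left) (use assms in \<open>auto simp: in_keys_iff\<close>)

lemma eval_monom_add: "eval_monom x (m + m') = eval_monom x m * eval_monom x m'"
proof -
  let ?A = "supp m \<union> supp m'"
  have "eval_monom x (m + m') = (\<Prod>v\<in>?A. x v ^ lkp (m + m') v)"
    by (rule eval_monom_superset) (use Poly_Mapping.keys_add[of m m'] in auto)
  moreover have "eval_monom x m = (\<Prod>v\<in>?A. x v ^ lkp m v)"
    by (rule eval_monom_superset) auto
  moreover have "eval_monom x m' = (\<Prod>v\<in>?A. x v ^ lkp m' v)"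
    by (rule eval_monom_superset) auto
  ultimately show ?thesis
    by (simp add: lookup_add power_add prod.distrib)
qed

lemma eval_monom_zero [simp]: "eval_monom x 0 = 1"
  by (simp add: eval_monom_def)

lemma eval_monom_single [simp]: "eval_monom x (Poly_Mapping.single v n) = x v ^ n"
  by (simp add: eval_monom_def)

lemma eval_mpoly_alt: "eval_mpoly x f = (\<Sum>m\<in>supp f. lkp f m * eval_monom x m)"
  by (simp add: eval_mpoly_def eval_monom_def)

lemma eval_mpoly_superset:
  assumes "finite A" "supp f \<subseteq> A"
  shows "eval_mpoly x f = (\<Sum>m\<in>A. lkp f m * eval_monom x m)"
  unfolding eval_mpoly_alt
  by (rule sum.mono_neutral_left) (use assms in \<open>auto simp: in_keys_iff\<close>)

lemma eval_mpoly_zero [simp]: "eval_mpoly x 0 = 0"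
  by (simp add: eval_mpoly_def)

lemma eval_mpoly_add [simp]: "eval_mpoly x (f + g) = eval_mpoly x f + eval_mpoly x g"
proof -
  let ?A = "supp f \<union> supp g"
  have "eval_mpoly x (f + g) = (\<Sum>m\<in>?A. lkp (f + g) m * eval_monom x m)"
    by (rule eval_mpoly_superset) (use Poly_Mapping.keys_add[of f g] in auto)
  moreover have "eval_mpoly x f = (\<Sum>m\<in>?A. lkp f m * eval_monom x m)"
    by (rule eval_mpoly_superset) auto
  moreover have "eval_mpoly x g = (\<Sum>m\<in>?A. lkp g m * eval_monom x m)"
    by (rule eval_mpoly_superset) auto
  ultimately show ?thesis
    by (simp add: lookup_add algebra_simps sum.distrib)
qed

lemma eval_mpoly_sum [simp]: "eval_mpoly x (\<Sum>i\<in>I. f i) = (\<Sum>i\<in>I. eval_mpoly x (f i))"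
  by (induction I rule: infinite_finite_induct) auto

lemma eval_mpoly_single [simp]: "eval_mpoly x (Poly_Mapping.single m c) = c * eval_monom x m"
  by (simp add: eval_mpoly_alt)

lemma eval_mpoly_Var [simp]: "eval_mpoly x (Var v) = x v"
  by (simp add: Var_def)

lemma mpoly_sum_monomials: "(\<Sum>m\<in>supp f. Poly_Mapping.single m (lkp f m)) = f"
  by (rule poly_mapping_eqI)
     (simp add: lookup_sum lookup_single when_def in_keys_iff)

lemma eval_mpoly_mult [simp]: "eval_mpoly x (f * g) = eval_mpoly x f * eval_mpoly x g"
proof -
  have "f * g = (\<Sum>m\<in>supp f. Poly_Mapping.single m (lkp f m)) * (\<Sum>n\<in>supp g. Poly_Mapping.single n (lkp g n))"
    by (simp add: mpoly_sum_monomials)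
  also have "\<dots> = (\<Sum>m\<in>supp f. \<Sum>n\<in>supp g. Poly_Mapping.single (m + n) (lkp f m * lkp g n))"
    by (simp add: sum_product mult_single)
  finally show ?thesis
    by (simp add: eval_monom_add eval_mpoly_alt[of x f] eval_mpoly_alt[of x g] sum_product algebra_simps)
qed

lemma eval_mpoly_uminus [simp]: "eval_mpoly x (- f) = - eval_mpoly x f"
  using eval_mpoly_add[of x f "- f"] by (simp add: eq_neg_iff_add_eq_0 add.commute)

lemma eval_mpoly_diff [simp]: "eval_mpoly x (f - g) = eval_mpoly x f - eval_mpoly x g"
  using eval_mpoly_add[of x f "- g"] by simp

lemma eval_mpoly_one [simp]: "eval_mpoly x 1 = 1"
  by (simp add: eval_mpoly_alt)

lemma eval_mpoly_prod [simp]: "eval_mpoly x (\<Prod>i\<in>I. f i) = (\<Prod>i\<in>I. eval_mpoly x (f i))"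
  by (induction I rule: infinite_finite_induct) auto

text \<open>Substituting univariate polynomials for the variables makes the arguments along curves
  algebraic: no zero divisors for primality, lowest coefficients for independence, derivatives for
  tangent vectors.\<close>

definition eval_curve :: "('v \<Rightarrow> complex poly) \<Rightarrow> 'v mpoly \<Rightarrow> complex poly" where
  "eval_curve x f = (\<Sum>m\<in>supp f. smult (lkp f m) (eval_monom x m))"

lemma poly_eval_monom: "poly (eval_monom x m) z = eval_monom (\<lambda>v. poly (x v) z) m"
  by (simp add: eval_monom_def poly_prod)

lemma poly_eval_curve: "poly (eval_curve x f) z = eval_mpoly (\<lambda>v. poly (x v) z) f"
  by (simp add: eval_curve_def eval_mpoly_alt poly_sum poly_eval_monom)

lemma eval_curve_eqI:
  assumes "\<And>z. eval_mpoly (\<lambda>v. poly (x v) z) f = poly F z"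
  shows "eval_curve x f = F"
  using assms by (auto simp: poly_eq_poly_eq_iff[symmetric] poly_eval_curve)

lemma eval_mpoly_cong:
  assumes "indets f \<subseteq> V" "\<And>v. v \<in> V \<Longrightarrow> x v = y v"
  shows "eval_mpoly x f = eval_mpoly y f"
  unfolding eval_mpoly_def
  by (intro sum.cong arg_cong2[where f = "(*)"] prod.cong)
     (use assms in \<open>auto simp: indets_def\<close>)

section \<open>The polynomial ring\<close>

lemma indets_zero [simp]: "indets 0 = {}" by (simp add: indets_def)
lemma indets_one [simp]: "indets 1 = {}" by (simp add: indets_def)
lemma indets_single: "indets (Poly_Mapping.single m c) \<subseteq> supp m" by (simp add: indets_def)
lemma indets_Var [simp]: "indets (Var v) = {v}" by (simp add: indets_def Var_def)
lemma indets_uminus [simp]: "indets (- f) = indets f"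
proof -
  have "supp (- f) = supp f" by (auto simp: in_keys_iff)
  then show ?thesis by (simp add: indets_def)
qed

lemma indets_add: "indets (f + g) \<subseteq> indets f \<union> indets g"
  using Poly_Mapping.keys_add[of f g] by (auto simp: indets_def)

lemma indets_diff: "indets (f - g) \<subseteq> indets f \<union> indets g"
  using indets_add[of f "- g"] by simp

lemma indets_mult: "indets (f * g) \<subseteq> indets f \<union> indets g"
proof
  fix v assume "v \<in> indets (f * g)"
  then obtain m where "m \<in> supp (f * g)" "v \<in> supp m" by (auto simp: indets_def)
  then obtain a b where "a \<in> supp f" "b \<in> supp g" "v \<in> supp (a + b)"
    using keys_mult[of f g] by blast
  then show "v \<in> indets f \<union> indets g"
    using Poly_Mapping.keys_add[of a b] by (auto simp: indets_def)
qed

lemma carrier_mpoly_ring: "carrier (mpoly_ring V) = {f. indets f \<subseteq> V}"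
  by (simp add: mpoly_ring_def)

lemma mpoly_ring_simps [simp]:
  "monoid.mult (mpoly_ring V) = (*)" "one (mpoly_ring V) = 1"
  "zero (mpoly_ring V) = 0" "add (mpoly_ring V) = (+)"
  by (simp_all add: mpoly_ring_def)

lemma mpoly_carrier_closed:
  "f \<in> carrier (mpoly_ring V) \<Longrightarrow> g \<in> carrier (mpoly_ring V) \<Longrightarrow> f + g \<in> carrier (mpoly_ring V)"
  "f \<in> carrier (mpoly_ring V) \<Longrightarrow> g \<in> carrier (mpoly_ring V) \<Longrightarrow> f - g \<in> carrier (mpoly_ring V)"
  "f \<in> carrier (mpoly_ring V) \<Longrightarrow> g \<in> carrier (mpoly_ring V) \<Longrightarrow> f * g \<in> carrier (mpoly_ring V)"
  "f \<in> carrier (mpoly_ring V) \<Longrightarrow> - f \<in> carrier (mpoly_ring V)"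
  "v \<in> V \<Longrightarrow> Var v \<in> carrier (mpoly_ring V)"
  "0 \<in> carrier (mpoly_ring V)" "1 \<in> carrier (mpoly_ring V)"
  "supp m \<subseteq> V \<Longrightarrow> Poly_Mapping.single m c \<in> carrier (mpoly_ring V)"
  unfolding carrier_mpoly_ring
  using indets_add[of f g] indets_diff[of f g] indets_mult[of f g] indets_single[of m c] by auto

lemma mpoly_carrier_sum:
  "(\<And>i. i \<in> I \<Longrightarrow> f i \<in> carrier (mpoly_ring V)) \<Longrightarrow> (\<Sum>i\<in>I. f i) \<in> carrier (mpoly_ring V)"
  by (induction I rule: infinite_finite_induct) (auto simp: mpoly_carrier_closed)

lemma mpoly_carrier_prod:
  "(\<And>i. i \<in> I \<Longrightarrow> f i \<in> carrier (mpoly_ring V)) \<Longrightarrow> (\<Prod>i\<in>I. f i) \<in> carrier (mpoly_ring V)"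
  by (induction I rule: infinite_finite_induct) (auto simp: mpoly_carrier_closed)

lemma supp_carrier:
  "f \<in> carrier (mpoly_ring V) \<Longrightarrow> m \<in> supp f \<Longrightarrow> supp m \<subseteq> V"
  by (auto simp: carrier_mpoly_ring indets_def)

lemma cring_mpoly_ring: "cring (mpoly_ring V)"
proof (rule cringI)
  show "abelian_group (mpoly_ring V)"
  proof (rule abelian_groupI)
    fix x assume "x \<in> carrier (mpoly_ring V)"
    then show "\<exists>y\<in>carrier (mpoly_ring V). y \<oplus>\<^bsub>mpoly_ring V\<^esub> x = \<zero>\<^bsub>mpoly_ring V\<^esub>"
      by (intro bexI[of _ "- x"]) (auto intro: mpoly_carrier_closed)
  qed (auto intro: mpoly_carrier_closed simp: algebra_simps)
  show "Group.comm_monoid (mpoly_ring V)"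
    by (rule comm_monoidI) (auto intro: mpoly_carrier_closed simp: algebra_simps)
qed (simp add: algebra_simps)

lemma mpoly_idealI:
  assumes sub: "I \<subseteq> carrier (mpoly_ring V)" and "0 \<in> I"
    and add: "\<And>f g. f \<in> I \<Longrightarrow> g \<in> I \<Longrightarrow> f + g \<in> I"
    and mult: "\<And>f g. f \<in> I \<Longrightarrow> g \<in> carrier (mpoly_ring V) \<Longrightarrow> g * f \<in> I"
  shows "ideal I (mpoly_ring V)"
proof -
  interpret R: cring "mpoly_ring V" by (rule cring_mpoly_ring)
  have minus: "\<ominus>\<^bsub>mpoly_ring V\<^esub> f = - f" if "f \<in> carrier (mpoly_ring V)" for f
    using that by (intro R.minus_equality) (auto intro: mpoly_carrier_closed)
  show ?thesis
  proof (rule idealI)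
    show "subgroup I (add_monoid (mpoly_ring V))"
    proof (rule R.add.subgroupI)
      fix f assume "f \<in> I"
      then show "\<ominus>\<^bsub>mpoly_ring V\<^esub> f \<in> I"
        using minus[of f] sub mult[of f "- 1"]
          mpoly_carrier_closed(4)[OF mpoly_carrier_closed(7)[of V]] by auto
    qed (use assms in auto)
  qed (use assms R.ring_axioms in \<open>auto simp: mult.commute\<close>)
qed

lemma ideal_mpolyD:
  assumes "ideal I (mpoly_ring V)"
  shows "I \<subseteq> carrier (mpoly_ring V)" "0 \<in> I"
    "\<And>f g. f \<in> I \<Longrightarrow> g \<in> I \<Longrightarrow> f + g \<in> I"
    "\<And>f g. f \<in> I \<Longrightarrow> g \<in> carrier (mpoly_ring V) \<Longrightarrow> g * f \<in> I"
    "\<And>f g. f \<in> I \<Longrightarrow> g \<in> I \<Longrightarrow> f - g \<in> I"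
proof -
  interpret ideal I "mpoly_ring V" by fact
  show sub: "I \<subseteq> carrier (mpoly_ring V)" and "0 \<in> I"
    and add: "\<And>f g. f \<in> I \<Longrightarrow> g \<in> I \<Longrightarrow> f + g \<in> I"
    and mult: "\<And>f g. f \<in> I \<Longrightarrow> g \<in> carrier (mpoly_ring V) \<Longrightarrow> g * f \<in> I"
    using a_subset additive_subgroup.zero_closed[OF is_additive_subgroup]
      additive_subgroup.a_closed[OF is_additive_subgroup] I_l_closed by auto
  show "f - g \<in> I" if "f \<in> I" "g \<in> I" for f g
    using add[OF that(1) mult[OF that(2), of "- 1"]] mpoly_carrier_closed(4)[OF mpoly_carrier_closed(7)[of V]]
    by auto
qed

lemma ideal_mpoly_sum:
  assumes "ideal I (mpoly_ring V)" "\<And>i. i \<in> A \<Longrightarrow> f i \<in> I"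
  shows "(\<Sum>i\<in>A. f i) \<in> I"
  using assms(2)
  by (induction A rule: infinite_finite_induct) (auto simp: ideal_mpolyD[OF assms(1)])

lemma Idl_mpoly:
  assumes "S \<subseteq> carrier (mpoly_ring V)"
  shows "ideal (Idl\<^bsub>mpoly_ring V\<^esub> S) (mpoly_ring V)" "S \<subseteq> Idl\<^bsub>mpoly_ring V\<^esub> S"
proof -
  interpret R: cring "mpoly_ring V" by (rule cring_mpoly_ring)
  show "ideal (Idl\<^bsub>mpoly_ring V\<^esub> S) (mpoly_ring V)" "S \<subseteq> Idl\<^bsub>mpoly_ring V\<^esub> S"
    using R.genideal_ideal R.genideal_self assms by auto
qed

lemma Idl_mpoly_minimal:
  assumes "ideal I (mpoly_ring V)" "S \<subseteq> I"
  shows "Idl\<^bsub>mpoly_ring V\<^esub> S \<subseteq> I"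
proof -
  interpret R: cring "mpoly_ring V" by (rule cring_mpoly_ring)
  show ?thesis by (rule R.genideal_minimal) (use assms in auto)
qed

text \<open>The sums form an ideal that contains every \<open>A k\<close>. This passes from the sum
  of the ideals of minors to the ideal generated by all minors at once, the form in which the
  Groebner basis argument works.\<close>

lemma Idl_UN_eq_sums:
  fixes q :: nat
  assumes A: "\<And>k. k < q \<Longrightarrow> A k \<subseteq> carrier (mpoly_ring V)"
  shows "Idl\<^bsub>mpoly_ring V\<^esub> (\<Union>k<q. A k)
    = {(\<Sum>k<q. f k) | f. \<forall>k<q. f k \<in> Idl\<^bsub>mpoly_ring V\<^esub> (A k)}" (is "_ = ?S")
proof
  have UA: "(\<Union>k<q. A k) \<subseteq> carrier (mpoly_ring V)" using A by auto
  note I = Idl_mpoly[OF UA]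
  note J = Idl_mpoly[OF A]
  note JD = ideal_mpolyD[OF J(1)]
  have "ideal ?S (mpoly_ring V)"
  proof (rule mpoly_idealI)
    show "?S \<subseteq> carrier (mpoly_ring V)"
      using JD(1) by (auto intro!: mpoly_carrier_sum)
    show "0 \<in> ?S"
      by (rule CollectI, rule exI[of _ "\<lambda>_. 0"]) (use JD(2) in auto)
  next
    fix f g assume "f \<in> ?S" "g \<in> ?S"
    then obtain f' g' where "f = (\<Sum>k<q. f' k)" "g = (\<Sum>k<q. g' k)"
      "\<And>k. k < q \<Longrightarrow> f' k \<in> Idl\<^bsub>mpoly_ring V\<^esub> (A k)" "\<And>k. k < q \<Longrightarrow> g' k \<in> Idl\<^bsub>mpoly_ring V\<^esub> (A k)"
      by blast
    then show "f + g \<in> ?S"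
      by (intro CollectI exI[of _ "\<lambda>k. f' k + g' k"]) (simp add: sum.distrib JD(3))
  next
    fix f g assume "f \<in> ?S" and g: "g \<in> carrier (mpoly_ring V)"
    then obtain f' where "f = (\<Sum>k<q. f' k)" "\<And>k. k < q \<Longrightarrow> f' k \<in> Idl\<^bsub>mpoly_ring V\<^esub> (A k)"
      by blast
    then show "g * f \<in> ?S"
      using g by (intro CollectI exI[of _ "\<lambda>k. g * f' k"]) (simp add: sum_distrib_left JD(4))
  qed
  moreover have "(\<Union>k<q. A k) \<subseteq> ?S"
  proof
    fix f assume "f \<in> (\<Union>k<q. A k)"
    then obtain l where l: "l < q" "f \<in> A l" by auto
    show "f \<in> ?S"
      by (rule CollectI, rule exI[of _ "\<lambda>k. if k = l then f else 0"])
        (use l J(2)[OF l(1)] JD(2) in auto)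
  qed
  ultimately show "Idl\<^bsub>mpoly_ring V\<^esub> (\<Union>k<q. A k) \<subseteq> ?S" by (rule Idl_mpoly_minimal)
  show "?S \<subseteq> Idl\<^bsub>mpoly_ring V\<^esub> (\<Union>k<q. A k)"
  proof clarify
    fix f assume f: "\<forall>k<q. f k \<in> Idl\<^bsub>mpoly_ring V\<^esub> (A k)"
    have "Idl\<^bsub>mpoly_ring V\<^esub> (A k) \<subseteq> Idl\<^bsub>mpoly_ring V\<^esub> (\<Union>k<q. A k)" if "k < q" for k
      by (rule Idl_mpoly_minimal[OF I(1)]) (use I(2) that in blast)
    then show "(\<Sum>k<q. f k) \<in> Idl\<^bsub>mpoly_ring V\<^esub> (\<Union>k<q. A k)"
      using f by (intro ideal_mpoly_sum[OF I(1)]) blast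
  qed
qed

section \<open>Groebner bases from standard monomials\<close>

lemma lex_term_order_iff:
  "(m, m') \<in> lex_term_order vs \<longleftrightarrow> (map (lkp m) vs, map (lkp m') vs) \<in> lexord less_than"
  by (simp add: lex_term_order_def inv_image_def)

text \<open>All compared lists have the length of \<open>vs\<close>, and on lists of equal length
  \<open>lexord\<close> agrees with the well-founded \<open>lex\<close>.\<close>

lemma wf_lex_term_order: "wf (lex_term_order vs)"
proof -
  have "lex_term_order vs = inv_image (lex less_than) (\<lambda>m. map (lkp m) vs)"
    by (auto simp: lex_term_order_def inv_image_def lexord_lex)
  then show ?thesis by (simp add: wf_lex)
qed

lemma lex_term_order_trans:
  "(a, b) \<in> lex_term_order vs \<Longrightarrow> (b, c) \<in> lex_term_order vs \<Longrightarrow> (a, c) \<in> lex_term_order vs"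
  unfolding lex_term_order_iff by (rule lexord_trans) (auto intro: trans_less_than)

lemma lex_term_order_asym:
  "(a, b) \<in> lex_term_order vs \<Longrightarrow> (b, a) \<notin> lex_term_order vs"
  using wf_lex_term_order wf_not_sym by metis

lemma lex_term_order_irrefl: "(a, a) \<notin> lex_term_order vs"
  using lex_term_order_asym by metis

lemma lex_term_order_total:
  assumes "supp m \<subseteq> set vs" "supp m' \<subseteq> set vs" "m \<noteq> m'"
  shows "(m, m') \<in> lex_term_order vs \<or> (m', m) \<in> lex_term_order vs"
proof -
  have "map (lkp m) vs \<noteq> map (lkp m') vs"
  proof
    assume eq: "map (lkp m) vs = map (lkp m') vs"
    have "lkp m v = lkp m' v" for v
    proof (cases "v \<in> set vs")
      case False
      then show ?thesis using assms by (metis in_keys_iff subsetD)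
    qed (use eq in auto)
    then show False using assms(3) poly_mapping_eqI by blast
  qed
  then show ?thesis
    unfolding lex_term_order_iff using lexord_linear[of less_than] by (metis less_than_iff linorder_neqE_nat)
qed

lemma lex_term_order_add:
  assumes "(m, m') \<in> lex_term_order vs"
  shows "(n + m, n + m') \<in> lex_term_order vs"
  using assms unfolding lex_term_order_iff
  by (induction vs) (auto simp: lookup_add)

lemma lex_term_orderI:
  assumes "vs = xs @ v # ys" "\<And>x. x \<in> set xs \<Longrightarrow> lkp m x = lkp m' x" "lkp m v < lkp m' v"
  shows "(m, m') \<in> lex_term_order vs"
proof -
  have "map (lkp m) xs = map (lkp m') xs" using assms(2) by auto
  then show ?thesis
    unfolding lex_term_order_iff assms(1) map_append list.map
    by (simp only:) (rule lexord_append_leftI, simp add: assms(3))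
qed

lemma lead_monomialI:
  assumes "m \<in> supp f" "\<And>m'. m' \<in> supp f \<Longrightarrow> m' \<noteq> m \<Longrightarrow> (m', m) \<in> lex_term_order vs"
  shows "lead_monomial (lex_term_order vs) f = m"
  unfolding lead_monomial_def
proof (rule the_equality)
  fix m' assume m': "m' \<in> supp f \<and> (\<forall>n\<in>supp f - {m'}. (n, m') \<in> lex_term_order vs)"
  show "m' = m"
  proof (rule ccontr)
    assume "m' \<noteq> m"
    then show False using m' assms lex_term_order_asym[of m m' vs] by auto
  qed
qed (use assms in auto)

lemma lead_monomial:
  assumes "f \<in> carrier (mpoly_ring (set vs))" "f \<noteq> 0"
  defines "m \<equiv> lead_monomial (lex_term_order vs) f"
  shows "m \<in> supp f" "\<And>m'. m' \<in> supp f \<Longrightarrow> m' \<noteq> m \<Longrightarrow> (m', m) \<in> lex_term_order vs"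
proof -
  have "\<exists>m\<in>A. \<forall>m'\<in>A - {m}. (m', m) \<in> lex_term_order vs"
    if "finite A" "A \<noteq> {}" "A \<subseteq> supp f" for A
    using that
  proof (induction A rule: finite_ne_induct)
    case (insert x A)
    then obtain m where m: "m \<in> A" "\<forall>m'\<in>A - {m}. (m', m) \<in> lex_term_order vs" by auto
    have "supp m \<subseteq> set vs" "supp x \<subseteq> set vs"
      using m(1) insert.prems assms(1) supp_carrier by blast+
    then consider "(m, x) \<in> lex_term_order vs" | "(x, m) \<in> lex_term_order vs"
      using lex_term_order_total[of m vs x] m(1) insert.hyps by metis
    then show ?case
    proof cases
      case 1
      then have "\<forall>m'\<in>insert x A - {x}. (m', x) \<in> lex_term_order vs"
        using m lex_term_order_trans by (metis Diff_iff insert_iff)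
      then show ?thesis by blast
    next
      case 2
      then show ?thesis using m by blast
    qed
  qed simp
  from this[of "supp f"] obtain n where n: "n \<in> supp f"
      "\<And>m'. m' \<in> supp f \<Longrightarrow> m' \<noteq> n \<Longrightarrow> (m', n) \<in> lex_term_order vs"
    using assms(2) by (auto simp: Poly_Mapping.keys_eq_empty)
  then have "m = n" unfolding m_def by (intro lead_monomialI)
  with n show "m \<in> supp f" "\<And>m'. m' \<in> supp f \<Longrightarrow> m' \<noteq> m \<Longrightarrow> (m', m) \<in> lex_term_order vs"
    by auto
qed

section \<open>Division by a set of polynomials\<close>

lemma lookup_const_mult: "lkp (Poly_Mapping.single 0 c * f) m = (c::complex) * lkp f m"
  by (simp flip: mult_map_scale_conv_mult add: Poly_Mapping.map.rep_eq when_def)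

lemma single_mult_eq_sum:
  "Poly_Mapping.single n c * f = (\<Sum>k\<in>supp f. Poly_Mapping.single (n + k) (c * lkp f k :: complex))"
  by (subst mpoly_sum_monomials[of f, symmetric])
     (simp only: sum_distrib_left mult_single)

lemma sum_mult_nonzero: "(\<Sum>i\<in>I. c i * d i) \<noteq> (0 :: 'a :: semiring_0) \<Longrightarrow> \<exists>i\<in>I. d i \<noteq> 0"
  by (rule ccontr) simp

text \<open>Division with remainder, by well-founded recursion on a single monomial; polynomials are
  handled later by linearity. The last clause makes a standard monomial its own remainder, so that
  its coefficient can be traced through the division.\<close>

lemma standard_remainder:
  fixes vs :: "'v list" and G I :: "'v mpoly set"
  defines "V \<equiv> set vs" and "ord \<equiv> lex_term_order vs"
  defines "std \<equiv> \<lambda>m. \<forall>g\<in>G - {0}. \<forall>n. m \<noteq> n + lead_monomial ord g"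
  assumes I: "ideal I (mpoly_ring V)" and G: "G \<subseteq> I" and m: "supp m \<subseteq> V"
  shows "\<exists>r\<in>carrier (mpoly_ring V). Poly_Mapping.single m 1 - r \<in> I \<and>
    (\<forall>m'\<in>supp r. std m' \<and> (m' = m \<or> (m', m) \<in> ord)) \<and> (std m \<longrightarrow> r = Poly_Mapping.single m 1)"
  using m
proof (induction m rule: wf_induct_rule[OF wf_lex_term_order[of vs]])
  case (1 m)
  note IH = 1(1)[folded ord_def] and m = 1(2)
  note ID = ideal_mpolyD[OF I]
  show ?case
  proof (cases "std m")
    case True
    then show ?thesis
      using m ID by (intro bexI[of _ "Poly_Mapping.single m 1"]) (auto intro: mpoly_carrier_closed)
  next
    case False
    then obtain g n where g: "g \<in> G" "g \<noteq> 0" and mn: "m = n + lead_monomial ord g"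
      unfolding std_def by auto
    have gc: "g \<in> carrier (mpoly_ring V)" using g G ID by auto
    define l where "l = lead_monomial ord g"
    have l: "l \<in> supp g" "\<And>k. k \<in> supp g \<Longrightarrow> k \<noteq> l \<Longrightarrow> (k, l) \<in> ord"
      using lead_monomial[OF gc[unfolded V_def] g(2)] unfolding l_def ord_def by auto
    define c where "c = inverse (lkp g l)"
    have c: "c * lkp g l = 1" using l(1) by (simp add: c_def in_keys_iff)
    have nV: "supp n \<subseteq> V"
      using m unfolding mn by (auto simp: lookup_add in_keys_iff subset_iff)
    define K where "K = supp g - {l}"
    have K: "supp (n + k) \<subseteq> V \<and> (n + k, m) \<in> ord" if "k \<in> K" for k
    proof -
      have "supp k \<subseteq> V" using supp_carrier[OF gc] that K_def by auto
      moreover have "(n + k, m) \<in> ord"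
        unfolding mn ord_def by (rule lex_term_order_add) (use l(2)[of k] that K_def l_def ord_def in auto)
      ultimately show ?thesis using nV Poly_Mapping.keys_add[of n k] by auto
    qed
    have "\<forall>k\<in>K. \<exists>r. r \<in> carrier (mpoly_ring V) \<and> Poly_Mapping.single (n + k) 1 - r \<in> I \<and>
      (\<forall>m'\<in>supp r. std m' \<and> (m' = n + k \<or> (m', n + k) \<in> ord))"
      using IH K by meson
    then obtain R where R: "\<And>k. k \<in> K \<Longrightarrow> R k \<in> carrier (mpoly_ring V)"
      "\<And>k. k \<in> K \<Longrightarrow> Poly_Mapping.single (n + k) 1 - R k \<in> I"
      "\<And>k m'. k \<in> K \<Longrightarrow> m' \<in> supp (R k) \<Longrightarrow> std m' \<and> (m' = n + k \<or> (m', n + k) \<in> ord)"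
      by metis
    define C where "C = (\<lambda>k. Poly_Mapping.single (0 :: 'v \<Rightarrow>\<^sub>0 nat) (c * lkp g k))"
    have Cc: "C k \<in> carrier (mpoly_ring V)" for k by (auto simp: C_def intro: mpoly_carrier_closed)
    \<comment> \<open>Modulo \<open>I\<close> the monomial \<open>m\<close> equals minus the lower
      terms of the normalized multiple of \<open>g\<close>, and \<open>R k\<close> is the reduced
      form of each of them.\<close>
    define r where "r = - (\<Sum>k\<in>K. C k * R k)"
    have "Poly_Mapping.single n c * g = (\<Sum>k\<in>supp g. Poly_Mapping.single (n + k) (c * lkp g k))"
      by (rule single_mult_eq_sum)
    also have "\<dots> = Poly_Mapping.single m 1 + (\<Sum>k\<in>K. Poly_Mapping.single (n + k) (c * lkp g k))"
      unfolding K_def using l(1) c by (subst sum.remove[of _ l]) (auto simp: mn l_def)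
    also have "(\<Sum>k\<in>K. Poly_Mapping.single (n + k) (c * lkp g k)) = (\<Sum>k\<in>K. C k * Poly_Mapping.single (n + k) 1)"
      by (simp add: C_def mult_single)
    finally have "Poly_Mapping.single m 1 - r
        = Poly_Mapping.single n c * g - (\<Sum>k\<in>K. C k * (Poly_Mapping.single (n + k) 1 - R k))"
      by (simp add: r_def algebra_simps sum_subtractf)
    moreover have "Poly_Mapping.single n c * g - (\<Sum>k\<in>K. C k * (Poly_Mapping.single (n + k) 1 - R k)) \<in> I"
    proof (rule ID(5))
      show "Poly_Mapping.single n c * g \<in> I"
        using g(1) G nV by (intro ID(4)) (auto intro: mpoly_carrier_closed)
      show "(\<Sum>k\<in>K. C k * (Poly_Mapping.single (n + k) 1 - R k)) \<in> I"
        by (rule ideal_mpoly_sum[OF I], rule ID(4)) (use R(2) Cc in auto)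
    qed
    moreover have "r \<in> carrier (mpoly_ring V)"
      unfolding r_def using R(1) Cc by (intro mpoly_carrier_closed(4) mpoly_carrier_sum mpoly_carrier_closed(3)) auto
    moreover have "std m' \<and> (m', m) \<in> ord" if "m' \<in> supp r" for m'
    proof -
      have "lkp r m' = - (\<Sum>k\<in>K. c * lkp g k * lkp (R k) m')"
        by (simp add: r_def lookup_sum C_def lookup_const_mult)
      then have "\<exists>k\<in>K. lkp (R k) m' \<noteq> 0"
        using that by (intro sum_mult_nonzero[of "\<lambda>k. c * lkp g k"]) (auto simp: in_keys_iff)
      then obtain k where k: "k \<in> K" "m' \<in> supp (R k)" by (auto simp: in_keys_iff)
      then show ?thesis using R(3)[OF k] K[OF k(1)] lex_term_order_trans unfolding ord_def by blast
    qed
    ultimately show ?thesis using False by (intro bexI[of _ r]) auto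
  qed
qed

text \<open>The remainder of an element of \<open>J\<close> is again in \<open>J\<close> and
  consists of standard monomials, so it is zero by \<open>std\<close>. Hence the division shows
  membership in the ideal generated by \<open>G\<close>.\<close>

theorem groebner_basis_by_standard_monomials:
  fixes vs :: "'v list" and G J :: "'v mpoly set"
  defines "V \<equiv> set vs" and "ord \<equiv> lex_term_order vs"
  assumes J: "ideal J (mpoly_ring V)" and "finite G" and GJ: "G \<subseteq> J"
    and std: "\<And>f. f \<in> J \<Longrightarrow>
      (\<And>m g n. m \<in> supp f \<Longrightarrow> g \<in> G \<Longrightarrow> g \<noteq> 0 \<Longrightarrow> m \<noteq> n + lead_monomial ord g) \<Longrightarrow> f = 0"
  shows "Idl\<^bsub>mpoly_ring V\<^esub> G = J" and "groebner_basis V ord G J"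
proof -
  let ?I = "Idl\<^bsub>mpoly_ring V\<^esub> G"
  note JD = ideal_mpolyD[OF J]
  have Gc: "G \<subseteq> carrier (mpoly_ring V)" using GJ JD by auto
  note I = Idl_mpoly[OF Gc]
  note ID = ideal_mpolyD[OF I(1)]
  have IJ: "?I \<subseteq> J" by (rule Idl_mpoly_minimal[OF J GJ])
  define st where "st = (\<lambda>m. \<forall>g\<in>G - {0}. \<forall>n. m \<noteq> n + lead_monomial ord g)"
  have "\<forall>m. supp m \<subseteq> V \<longrightarrow> (\<exists>r. r \<in> carrier (mpoly_ring V) \<and> Poly_Mapping.single m 1 - r \<in> ?I \<and>
    (\<forall>m'\<in>supp r. st m' \<and> (m' = m \<or> (m', m) \<in> ord)) \<and> (st m \<longrightarrow> r = Poly_Mapping.single m 1))"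
    using standard_remainder[of ?I vs G] I unfolding V_def ord_def st_def by blast
  then obtain R where R: "\<And>m. supp m \<subseteq> V \<Longrightarrow> R m \<in> carrier (mpoly_ring V)"
      "\<And>m. supp m \<subseteq> V \<Longrightarrow> Poly_Mapping.single m 1 - R m \<in> ?I"
      "\<And>m m'. supp m \<subseteq> V \<Longrightarrow> m' \<in> supp (R m) \<Longrightarrow> st m' \<and> (m' = m \<or> (m', m) \<in> ord)"
      "\<And>m. supp m \<subseteq> V \<Longrightarrow> st m \<Longrightarrow> R m = Poly_Mapping.single m 1"
    by metis
  define rem where "rem = (\<lambda>f. \<Sum>m\<in>supp f. Poly_Mapping.single (0 :: 'v \<Rightarrow>\<^sub>0 nat) (lkp f m) * R m)"
  have lookup_rem: "lkp (rem f) m' = (\<Sum>m\<in>supp f. lkp f m * lkp (R m) m')" for f m'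
    by (simp add: rem_def lookup_sum lookup_const_mult)
  have diff_rem: "f - rem f \<in> ?I" if "f \<in> carrier (mpoly_ring V)" for f
  proof -
    have "(\<Sum>m\<in>supp f. Poly_Mapping.single 0 (lkp f m) * Poly_Mapping.single m 1) = f"
      by (simp add: mult_single mpoly_sum_monomials)
    then have "f - rem f = (\<Sum>m\<in>supp f. Poly_Mapping.single 0 (lkp f m) * (Poly_Mapping.single m 1 - R m))"
      unfolding rem_def right_diff_distrib sum_subtractf by simp
    also have "\<dots> \<in> ?I"
      using R(2) supp_carrier[OF that]
      by (intro ideal_mpoly_sum[OF I(1)] ID(4)) (auto intro: mpoly_carrier_closed)
    finally show ?thesis .
  qed
  have rem_0: "rem f = 0" if "f \<in> J" for f
  proof -
    have fc: "f \<in> carrier (mpoly_ring V)" using that JD by auto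
    have "f - (f - rem f) \<in> J" using diff_rem[OF fc] IJ that JD(5) by blast
    moreover have "st m'" if "m' \<in> supp (rem f)" for m'
    proof -
      from that have "\<exists>m\<in>supp f. lkp (R m) m' \<noteq> 0"
        unfolding in_keys_iff lookup_rem by (rule sum_mult_nonzero)
      then show ?thesis using R(3) supp_carrier[OF fc] by (metis in_keys_iff)
    qed
    ultimately show ?thesis by (intro std) (auto simp: st_def)
  qed
  have "J \<subseteq> ?I"
  proof
    fix f assume f: "f \<in> J"
    then show "f \<in> ?I" using diff_rem[of f] rem_0[OF f] JD(1) by auto
  qed
  with IJ show "?I = J" by auto
  \<comment> \<open>A standard leading monomial would keep its coefficient in \<open>rem f\<close>,
    since the remainders of the smaller monomials of \<open>f\<close> only contain still smaller
    monomials. But \<open>rem f\<close> is zero.\<close>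
  have lead: "\<exists>g\<in>G - {0}. \<exists>n. lead_monomial ord f = n + lead_monomial ord g" if f: "f \<in> J" "f \<noteq> 0" for f
  proof (rule ccontr)
    define M where "M = lead_monomial ord f"
    assume "\<not> ?thesis"
    then have M: "st M" by (auto simp: st_def M_def)
    have fc: "f \<in> carrier (mpoly_ring V)" using f JD by auto
    have lm: "M \<in> supp f" "\<And>m. m \<in> supp f \<Longrightarrow> m \<noteq> M \<Longrightarrow> (m, M) \<in> ord"
      using lead_monomial[OF fc[unfolded V_def] f(2)] unfolding M_def ord_def by auto
    have "lkp (R m) M = 0" if "m \<in> supp f - {M}" for m
    proof (rule ccontr)
      assume "lkp (R m) M \<noteq> 0"
      then have "M = m \<or> (M, m) \<in> ord" using R(3)[of m M] that supp_carrier[OF fc] by (auto simp: in_keys_iff)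
      then show False using lm(2)[of m] that lex_term_order_asym unfolding ord_def by blast
    qed
    then have "lkp (rem f) M = lkp f M * lkp (R M) M"
      unfolding lookup_rem using lm(1) by (subst sum.remove[of _ M]) auto
    also have "\<dots> = lkp f M" using R(4)[OF _ M] supp_carrier[OF fc lm(1)] by simp
    finally show False using rem_0[OF f(1)] lm(1) by (simp add: in_keys_iff)
  qed
  have lt_c: "lead_term ord f \<in> carrier (mpoly_ring V)" if "f \<in> carrier (mpoly_ring V)" "f \<noteq> 0" for f
    unfolding lead_term_def
    by (rule mpoly_carrier_closed(8))
       (use that lead_monomial(1)[of f vs] supp_carrier[OF that(1)] V_def ord_def in auto)
  show "groebner_basis V ord G J"
    unfolding groebner_basis_def
  proof (intro conjI equalityI)
    show "finite G" "G \<subseteq> J" by fact+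
    have subG: "lead_term ord ` (G - {0}) \<subseteq> carrier (mpoly_ring V)" using lt_c Gc by auto
    have subJ: "lead_term ord ` (J - {0}) \<subseteq> carrier (mpoly_ring V)" using lt_c JD(1) by auto
    note LG = Idl_mpoly[OF subG] and LJ = Idl_mpoly[OF subJ]
    show "Idl\<^bsub>mpoly_ring V\<^esub> (lead_term ord ` (G - {0})) \<subseteq> Idl\<^bsub>mpoly_ring V\<^esub> (lead_term ord ` (J - {0}))"
      by (rule Idl_mpoly_minimal[OF LJ(1)]) (use LJ(2) GJ in auto)
    show "Idl\<^bsub>mpoly_ring V\<^esub> (lead_term ord ` (J - {0})) \<subseteq> Idl\<^bsub>mpoly_ring V\<^esub> (lead_term ord ` (G - {0}))"
    proof (rule Idl_mpoly_minimal[OF LG(1)], rule image_subsetI)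
      fix f assume "f \<in> J - {0}"
      then have f: "f \<in> J" "f \<noteq> 0" by auto
      then obtain g n where g: "g \<in> G" "g \<noteq> 0" and n: "lead_monomial ord f = n + lead_monomial ord g"
        using lead by blast
      have fc: "f \<in> carrier (mpoly_ring V)" and gc: "g \<in> carrier (mpoly_ring V)" using f g JD Gc by auto
      let ?f = "lead_monomial ord f" and ?g = "lead_monomial ord g"
      have "?f \<in> supp f" "?g \<in> supp g"
        using lead_monomial(1)[OF fc[unfolded V_def] f(2)] lead_monomial(1)[OF gc[unfolded V_def] g(2)]
        unfolding ord_def by auto
      then have nz: "lkp g ?g \<noteq> 0" and "supp ?f \<subseteq> V" using supp_carrier[OF fc] by (auto simp: in_keys_iff)
      then have nV: "supp n \<subseteq> V" unfolding n by (auto simp: lookup_add in_keys_iff subset_iff)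
      have "lead_term ord f = Poly_Mapping.single n (lkp f ?f / lkp g ?g) * lead_term ord g"
        using nz by (simp add: lead_term_def mult_single n)
      also have "\<dots> \<in> Idl\<^bsub>mpoly_ring V\<^esub> (lead_term ord ` (G - {0}))"
        using g nV LG(2) by (intro ideal_mpolyD(4)[OF LG(1)]) (auto intro: mpoly_carrier_closed)
      finally show "lead_term ord f \<in> Idl\<^bsub>mpoly_ring V\<^esub> (lead_term ord ` (G - {0}))" .
    qed
  qed
qed

section \<open>Sums of natural numbers\<close>

lemma base_expansion_unique:
  fixes d d' :: "nat \<Rightarrow> nat"
  assumes "\<And>i. i < n \<Longrightarrow> d i < b" "\<And>i. i < n \<Longrightarrow> d' i < b"
    and "(\<Sum>i<n. d i * b ^ i) = (\<Sum>i<n. d' i * b ^ i)"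
  shows "\<forall>i<n. d i = d' i"
  using assms
proof (induction n arbitrary: d d')
  case (Suc n)
  have step: "(\<Sum>i<Suc n. c i * b ^ i) = c 0 + b * (\<Sum>i<n. c (Suc i) * b ^ i)" for c :: "nat \<Rightarrow> nat"
    by (simp add: sum.lessThan_Suc_shift sum_distrib_left algebra_simps del: sum.lessThan_Suc)
  have eq: "d 0 + b * (\<Sum>i<n. d (Suc i) * b ^ i) = d' 0 + b * (\<Sum>i<n. d' (Suc i) * b ^ i)"
    using Suc.prems(3) by (simp only: step)
  have b: "d 0 < b" "d' 0 < b" using Suc.prems(1,2) by auto
  have "d 0 = (d 0 + b * (\<Sum>i<n. d (Suc i) * b ^ i)) mod b" using b(1) by simp
  also have "\<dots> = d' 0" unfolding eq using b(2) by simp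
  finally have 0: "d 0 = d' 0" .
  then have "(\<Sum>i<n. d (Suc i) * b ^ i) = (\<Sum>i<n. d' (Suc i) * b ^ i)"
    using eq b(1) by (simp only: add_left_cancel mult_cancel1) linarith
  then have "\<forall>i<n. d (Suc i) = d' (Suc i)"
    by (intro Suc.IH) (use Suc.prems(1,2) in auto)
  then show ?case using 0 less_Suc_eq_0_disj by auto
qed simp

lemma base_expansion_unique_indexed:
  fixes d d' :: "'p \<Rightarrow> nat" and idx :: "'p \<Rightarrow> nat"
  assumes "finite P" "inj_on idx P"
    and "\<And>p. p \<in> P \<Longrightarrow> d p < b" "\<And>p. p \<in> P \<Longrightarrow> d' p < b"
    and eq: "(\<Sum>p\<in>P. d p * b ^ idx p) = (\<Sum>p\<in>P. d' p * b ^ idx p)" and p: "p \<in> P"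
  shows "d p = d' p"
proof -
  define n where "n = Suc (Max (idx ` P))"
  have n: "idx ` P \<subseteq> {..<n}" using assms(1) by (auto simp: n_def less_Suc_eq_le)
  \<comment> \<open>Positions not hit by \<open>idx\<close> receive the digit 0, which turns the sum
    over \<open>P\<close> into an ordinary base \<open>b\<close> expansion of length
    \<open>n\<close>.\<close>
  define c where "c = (\<lambda>f i. if i \<in> idx ` P then f (the_inv_into P idx i) else (0::nat))"
  have c: "c f (idx p) = f p" if "p \<in> P" for f p
    using that assms(2) by (simp add: c_def the_inv_into_f_f)
  have c_less: "c f i < b" if f: "\<And>p. p \<in> P \<Longrightarrow> f p < b" for f i
  proof (cases "i \<in> idx ` P")
    case True
    then obtain p' where "p' \<in> P" "i = idx p'" by blast
    then show ?thesis using f[of p'] c[of p' f] by simp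
  next
    case False
    then show ?thesis using f[OF p] by (simp add: c_def)
  qed
  have sum_c: "(\<Sum>i<n. c f i * b ^ i) = (\<Sum>p\<in>P. f p * b ^ idx p)" for f
  proof -
    have "(\<Sum>i<n. c f i * b ^ i) = (\<Sum>i\<in>idx ` P. c f i * b ^ i)"
      by (rule sum.mono_neutral_right) (use n in \<open>auto simp: c_def\<close>)
    also have "\<dots> = (\<Sum>p\<in>P. f p * b ^ idx p)"
      by (simp add: sum.reindex[OF assms(2)] c)
    finally show ?thesis .
  qed
  have "\<forall>i<n. c d i = c d' i"
  proof (rule base_expansion_unique[where b = b])
    show "(\<Sum>i<n. c d i * b ^ i) = (\<Sum>i<n. c d' i * b ^ i)"
      unfolding sum_c by (rule eq)
    show "c d i < b" "c d' i < b" for i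
      by (rule c_less[OF assms(3)] c_less[OF assms(4)], assumption)+
  qed
  moreover have "idx p < n" using n p by auto
  ultimately have "c d (idx p) = c d' (idx p)" by blast
  then show ?thesis by (simp only: c[OF p])
qed

text \<open>One of the two differences carries no weight, so the intersection has the full weight of
  \<open>A\<close> or of \<open>B\<close>. This is the rule that converts nondivisibility by
  products of two variables into formulas for sums of exponents.\<close>

lemma sum_Int_eq_min:
  fixes w :: "'v \<Rightarrow> nat"
  assumes "finite A" "finite B"
    and w: "\<And>x y. x \<in> A - B \<Longrightarrow> y \<in> B - A \<Longrightarrow> w x = 0 \<or> w y = 0"
  shows "sum w (A \<inter> B) = min (sum w A) (sum w B)"
proof (cases "\<exists>x\<in>A - B. w x \<noteq> 0")
  case True
  then obtain x where x: "x \<in> A - B" "w x \<noteq> 0" by blast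
  have "sum w (A \<inter> B) = sum w B"
  proof (rule sum.mono_neutral_left[OF assms(2)])
    show "\<forall>y\<in>B - A \<inter> B. w y = 0"
    proof
      fix y assume "y \<in> B - A \<inter> B"
      then show "w y = 0" using w[OF x(1), of y] x(2) by auto
    qed
  qed simp
  moreover have "sum w (A \<inter> B) \<le> sum w A"
    by (rule sum_mono2[OF assms(1)]) auto
  ultimately show ?thesis by linarith
next
  case False
  have "sum w (A \<inter> B) = sum w A"
  proof (rule sum.mono_neutral_left[OF assms(1)])
    show "\<forall>x\<in>A - A \<inter> B. w x = 0" using False by auto
  qed simp
  moreover have "sum w (A \<inter> B) \<le> sum w B"
    by (rule sum_mono2[OF assms(2)]) auto
  ultimately show ?thesis by linarith
qed

section \<open>Tables\<close>

text \<open>Cells stay abstract. In the application they are the multi-indices of the original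
  table, and \<open>co\<close> yields the regrouped tuple, so that no variable has to be
  renamed.\<close>

locale table =
  fixes C :: "'c set" and q :: nat and D :: "nat \<Rightarrow> nat" and co :: "'c \<Rightarrow> nat \<Rightarrow> nat"
  assumes finite_C: "finite C"
    and co_less: "\<And>s k. s \<in> C \<Longrightarrow> k < q \<Longrightarrow> co s k < D k"
    and co_inj: "\<And>s s'. s \<in> C \<Longrightarrow> s' \<in> C \<Longrightarrow> (\<And>k. k < q \<Longrightarrow> co s k = co s' k) \<Longrightarrow> s = s'"
    and co_surj: "\<And>t. (\<And>k. k < q \<Longrightarrow> t k < D k) \<Longrightarrow> \<exists>s\<in>C. \<forall>k<q. co s k = t k"
    and D_pos: "\<And>k. k < q \<Longrightarrow> 0 < D k"
begin

definition cell :: "(nat \<Rightarrow> nat) \<Rightarrow> 'c" where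
  "cell t = (SOME s. s \<in> C \<and> (\<forall>k<q. co s k = t k))"

lemma cell:
  assumes "\<And>k. k < q \<Longrightarrow> t k < D k"
  shows "cell t \<in> C" "\<And>k. k < q \<Longrightarrow> co (cell t) k = t k"
proof -
  obtain s where "s \<in> C \<and> (\<forall>k<q. co s k = t k)" using co_surj[OF assms] by blast
  then have "cell t \<in> C \<and> (\<forall>k<q. co (cell t) k = t k)"
    unfolding cell_def by (rule someI)
  then show "cell t \<in> C" "\<And>k. k < q \<Longrightarrow> co (cell t) k = t k" by auto
qed

definition upd :: "'c \<Rightarrow> nat \<Rightarrow> nat \<Rightarrow> 'c" where
  "upd s k r = cell ((co s)(k := r))"

lemma upd:
  assumes "s \<in> C" "r < D k"
  shows "upd s k r \<in> C" "\<And>l. l < q \<Longrightarrow> co (upd s k r) l = (if l = k then r else co s l)"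
proof -
  have *: "((co s)(k := r)) l < D l" if "l < q" for l
    using assms(2) co_less[OF assms(1) that] by simp
  show "upd s k r \<in> C" unfolding upd_def by (rule cell(1)[OF *])
  fix l assume "l < q"
  have "co (cell ((co s)(k := r))) l = ((co s)(k := r)) l" by (rule cell(2)[OF * \<open>l < q\<close>])
  then show "co (upd s k r) l = (if l = k then r else co s l)"
    unfolding upd_def by (simp only: fun_upd_apply)
qed

definition origin :: 'c where "origin = cell (\<lambda>_. 0)"

definition axis :: "nat \<Rightarrow> nat \<Rightarrow> 'c" where "axis k r = upd origin k r"

lemma origin: "origin \<in> C" "\<And>k. k < q \<Longrightarrow> co origin k = 0"
proof -
  have *: "(\<lambda>_. 0) k < D k" if "k < q" for k using D_pos[OF that] .
  show "origin \<in> C" unfolding origin_def by (rule cell(1)[OF *])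
  show "co origin k = 0" if "k < q" for k unfolding origin_def using cell(2)[OF * that] .
qed

lemma axis:
  assumes "r < D k"
  shows "axis k r \<in> C" "\<And>l. l < q \<Longrightarrow> co (axis k r) l = (if l = k then r else 0)"
proof -
  show "axis k r \<in> C" unfolding axis_def by (rule upd(1)[OF origin(1) assms])
  show "co (axis k r) l = (if l = k then r else 0)" if "l < q" for l
    unfolding axis_def upd(2)[OF origin(1) assms that] by (simp only: origin(2)[OF that])
qed

text \<open>This indexes the axis cells other than the origin and also the free parameters
  \<open>al k r\<close>. The value 0 is left out because its probability is determined by the
  others.\<close>

definition axes :: "(nat \<times> nat) set" where
  "axes = (SIGMA k:{..<q}. {1..<D k})"

lemma finite_axes: "finite axes" by (simp add: axes_def)

text \<open>These are the cells with at least two nonzero coordinates. Their u entries are the free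
  parameters of the u part.\<close>

definition interior_cells :: "'c set" where
  "interior_cells = C - insert origin ((\<lambda>(k, r). axis k r) ` axes)"

lemma axis_inj: "(k, r) \<in> axes \<Longrightarrow> (k', r') \<in> axes \<Longrightarrow> axis k r = axis k' r' \<Longrightarrow> k = k' \<and> r = r'"
  using axis(2)[of r k k] axis(2)[of r' k' k] by (auto simp: axes_def split: if_splits)

lemma axis_neq_origin: "(k, r) \<in> axes \<Longrightarrow> axis k r \<noteq> origin"
  using axis(2)[of r k k] origin(2)[of k] by (auto simp: axes_def)

lemma C_decomp: "C = insert origin ((\<lambda>(k, r). axis k r) ` axes \<union> interior_cells)"
  using origin axis(1) by (auto simp: interior_cells_def axes_def)

text \<open>Lexicographic comparison with coordinate \<open>k\<close> deleted, that is, the order of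
  the columns of the \<open>k\<close>-th flattening.\<close>

definition rest_less :: "nat \<Rightarrow> 'c \<Rightarrow> 'c \<Rightarrow> bool" where
  "rest_less k s s' \<longleftrightarrow> (\<exists>l<q. l \<noteq> k \<and> co s l < co s' l \<and> (\<forall>j<l. j \<noteq> k \<longrightarrow> co s j = co s' j))"

text \<open>For \<open>k = q\<close> this is the lexicographic order of the cells, where a smaller
  cell means a larger variable. The shorter prefixes serve the induction in
  \<open>chain_weight_unique\<close>.\<close>

definition prefix_less :: "nat \<Rightarrow> 'c \<Rightarrow> 'c \<Rightarrow> bool" where
  "prefix_less k s s' \<longleftrightarrow> (\<exists>l<k. co s l < co s' l \<and> (\<forall>j<l. co s j = co s' j))"

definition prefix_eq :: "nat \<Rightarrow> 'c \<Rightarrow> 'c \<Rightarrow> bool" where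
  "prefix_eq k s s' \<longleftrightarrow> (\<forall>j<k. co s j = co s' j)"

lemma prefix_eq_Suc: "prefix_eq (Suc k) s s' \<longleftrightarrow> prefix_eq k s s' \<and> co s k = co s' k"
  unfolding prefix_eq_def by (auto simp: less_Suc_eq)

lemma prefix_eq_sym: "prefix_eq k s s' \<Longrightarrow> prefix_eq k s' s"
  by (simp add: prefix_eq_def)

lemma prefix_less_Suc:
  "prefix_less (Suc k) s s' \<longleftrightarrow> prefix_less k s s' \<or> prefix_eq k s s' \<and> co s k < co s' k"
  unfolding prefix_less_def prefix_eq_def Ex_less_Suc by (rule iffI; elim disjE; simp)

lemma prefix_eq_not_less: "prefix_eq k s s' \<Longrightarrow> \<not> prefix_less k s s'"
  by (auto simp: prefix_less_def prefix_eq_def)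

lemma prefix_trichotomy: "prefix_less k s s' \<or> prefix_eq k s s' \<or> prefix_less k s' s"
proof (induction k)
  case (Suc k)
  then show ?case
    using linorder_less_linear[of "co s k" "co s' k"] prefix_eq_sym[of k s s']
    unfolding prefix_less_Suc prefix_eq_Suc by blast
qed (simp add: prefix_eq_def)

lemma prefix_less_eq_trans: "prefix_less k x s \<or> prefix_eq k x s \<Longrightarrow> prefix_less k s y \<Longrightarrow> prefix_less k x y"
proof -
  assume "prefix_less k x s \<or> prefix_eq k x s" and "prefix_less k s y"
  then show "prefix_less k x y"
  proof (elim disjE)
    assume "prefix_less k x s" "prefix_less k s y"
    then obtain l l' where l: "l < k" "co x l < co s l" "\<forall>j<l. co x j = co s j"
      and l': "l' < k" "co s l' < co y l'" "\<forall>j<l'. co s j = co y j"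
      unfolding prefix_less_def by auto
    consider "l < l'" | "l = l'" | "l' < l" by linarith
    then show ?thesis
    proof cases
      case 1
      then show ?thesis unfolding prefix_less_def using l l' by (intro exI[of _ l]) auto
    next
      case 2
      then show ?thesis unfolding prefix_less_def using l l' by (intro exI[of _ l]) auto
    next
      case 3
      then show ?thesis unfolding prefix_less_def using l l' by (intro exI[of _ l']) auto
    qed
  next
    assume eq: "prefix_eq k x s" and "prefix_less k s y"
    then obtain l where l: "l < k" "co s l < co y l" "\<forall>j<l. co s j = co y j"
      unfolding prefix_less_def by blast
    then show ?thesis
      unfolding prefix_less_def using eq[unfolded prefix_eq_def] by (intro exI[of _ l]) simp
  qed
qed

lemma prefix_less_prefix_eq_trans: "prefix_less k x s \<Longrightarrow> prefix_eq k s y \<Longrightarrow> prefix_less k x y"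
proof -
  assume "prefix_less k x s" and eq: "prefix_eq k s y"
  then obtain l where l: "l < k" "co x l < co s l" "\<forall>j<l. co x j = co s j"
    unfolding prefix_less_def by blast
  then show ?thesis
    unfolding prefix_less_def using eq[unfolded prefix_eq_def] by (intro exI[of _ l]) simp
qed

text \<open>Exponents of a p monomial avoiding the leading terms of all p minors: within its
  support, a later column of a flattening never goes with a larger row.\<close>

definition chain_weight :: "('c \<Rightarrow> nat) \<Rightarrow> bool" where
  "chain_weight w \<longleftrightarrow> (\<forall>s\<in>C. \<forall>s'\<in>C. \<forall>k<q.
     0 < w s \<longrightarrow> 0 < w s' \<longrightarrow> rest_less k s s' \<longrightarrow> co s' k \<le> co s k)"

text \<open>A cell \<open>x\<close> of the initial segment with \<open>co x k < T\<close> and a cell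
  \<open>y\<close> outside it with \<open>T \<le> co y k\<close> first differ before position
  \<open>k\<close>. So \<open>rest_less k x y\<close> holds although \<open>y\<close> has the larger
  row, and the two cannot both carry weight.\<close>

lemma chain_weight_initial:
  assumes w: "chain_weight w" and k: "k < q"
    and Q: "\<And>x y. x \<in> C \<Longrightarrow> y \<in> C \<Longrightarrow> Q x \<Longrightarrow> \<not> Q y \<Longrightarrow> prefix_less k x y"
  shows "sum w {s \<in> C. Q s \<and> T \<le> co s k} = min (sum w {s \<in> C. Q s}) (sum w {s \<in> C. T \<le> co s k})"
proof -
  have "sum w ({s \<in> C. Q s} \<inter> {s \<in> C. T \<le> co s k}) = min (sum w {s \<in> C. Q s}) (sum w {s \<in> C. T \<le> co s k})"
  proof (rule sum_Int_eq_min)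
    fix x y assume xy: "x \<in> {s \<in> C. Q s} - {s \<in> C. T \<le> co s k}" "y \<in> {s \<in> C. T \<le> co s k} - {s \<in> C. Q s}"
    then have xC: "x \<in> C" "y \<in> C" "Q x" "\<not> Q y" and lt: "co x k < co y k" by auto
    have "prefix_less k x y" by (rule Q[OF xC])
    then obtain l where "l < k" "co x l < co y l" "\<forall>j<l. co x j = co y j"
      unfolding prefix_less_def by auto
    then have "rest_less k x y" unfolding rest_less_def using k by (intro exI[of _ l]) simp
    then have "0 < w x \<Longrightarrow> 0 < w y \<Longrightarrow> co y k \<le> co x k"
      using w xC(1,2) k unfolding chain_weight_def by blast
    then show "w x = 0 \<or> w y = 0" using lt by linarith
  qed (simp_all add: finite_C)
  moreover have "{s \<in> C. Q s} \<inter> {s \<in> C. T \<le> co s k} = {s \<in> C. Q s \<and> T \<le> co s k}" by blast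
  ultimately show ?thesis by (simp only:)
qed

text \<open>The weights of the lexicographic initial segments are recovered one coordinate at a time:
  along a chain the coordinates after the first difference decrease, so each initial segment
  carries the largest of the available coordinates.\<close>

lemma chain_weight_unique:
  assumes w: "chain_weight w" and w': "chain_weight w'"
    and tails: "\<And>k T. k < q \<Longrightarrow> sum w {s \<in> C. T \<le> co s k} = sum w' {s \<in> C. T \<le> co s k}"
    and total: "sum w C = sum w' C" and s: "s \<in> C"
  shows "w s = w' s"
proof -
  have fin: "finite {x \<in> C. P x}" for P using finite_C by auto
  \<comment> \<open>For \<open>k = q\<close> the second sum is the single weight \<open>w s\<close>.
    The first sum is carried along because the minimum rule applies to initial segments
    only.\<close>
  have "k \<le> q \<Longrightarrow> s \<in> C \<Longrightarrow>
      sum w {x \<in> C. prefix_less k x s} = sum w' {x \<in> C. prefix_less k x s} \<and>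
      sum w {x \<in> C. prefix_eq k x s} = sum w' {x \<in> C. prefix_eq k x s}" for k s
  proof (induction k arbitrary: s)
    case 0
    then show ?case using total by (simp add: prefix_less_def prefix_eq_def)
  next
    case (Suc k)
    then have k: "k < q" and s: "s \<in> C" by auto
    have IH: "sum w {x \<in> C. prefix_less k x s} = sum w' {x \<in> C. prefix_less k x s}"
      "sum w {x \<in> C. prefix_eq k x s} = sum w' {x \<in> C. prefix_eq k x s}"
      using Suc by auto
    have split: "sum v {x \<in> C. (prefix_less k x s \<or> prefix_eq k x s) \<and> P x}
        = sum v {x \<in> C. prefix_less k x s \<and> P x} + sum v {x \<in> C. prefix_eq k x s \<and> P x}"
      for v :: "'c \<Rightarrow> nat" and P
    proof -
      have "{x \<in> C. (prefix_less k x s \<or> prefix_eq k x s) \<and> P x}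
         = {x \<in> C. prefix_less k x s \<and> P x} \<union> {x \<in> C. prefix_eq k x s \<and> P x}" by auto
      moreover have "{x \<in> C. prefix_less k x s \<and> P x} \<inter> {x \<in> C. prefix_eq k x s \<and> P x} = {}"
        using prefix_eq_not_less by blast
      ultimately show ?thesis using fin by (simp only: sum.union_disjoint)
    qed
    have le: "sum v {x \<in> C. (prefix_less k x s \<or> prefix_eq k x s) \<and> T \<le> co x k}
        = min (sum v {x \<in> C. prefix_less k x s \<or> prefix_eq k x s}) (sum v {s \<in> C. T \<le> co s k})"
      if "chain_weight v" for v T
    proof (rule chain_weight_initial[OF that k])
      fix x y assume "prefix_less k x s \<or> prefix_eq k x s" "\<not> (prefix_less k y s \<or> prefix_eq k y s)"
      then show "prefix_less k x y"
        using prefix_trichotomy[of k y s] prefix_less_eq_trans[of k x s y] by blast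
    qed
    have lt: "sum v {x \<in> C. prefix_less k x s \<and> T \<le> co x k}
        = min (sum v {x \<in> C. prefix_less k x s}) (sum v {s \<in> C. T \<le> co s k})"
      if "chain_weight v" for v T
    proof (rule chain_weight_initial[OF that k])
      fix x y assume "prefix_less k x s" "\<not> prefix_less k y s"
      then have "prefix_eq k s y \<or> prefix_less k s y"
        using prefix_trichotomy[of k y s] prefix_eq_sym[of k y s] by blast
      then show "prefix_less k x y"
        using \<open>prefix_less k x s\<close> prefix_less_eq_trans[of k x s y] prefix_less_prefix_eq_trans[of k x s y]
        by blast
    qed
    \<comment> \<open>The cells sharing the prefix of \<open>s\<close> are the difference of two
      initial segments, and the minimum rule determines the part above \<open>T\<close> of
      each.\<close>
    have eqT: "sum w {x \<in> C. prefix_eq k x s \<and> T \<le> co x k} = sum w' {x \<in> C. prefix_eq k x s \<and> T \<le> co x k}" for T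
    proof -
      have "sum w {x \<in> C. prefix_less k x s \<or> prefix_eq k x s} = sum w' {x \<in> C. prefix_less k x s \<or> prefix_eq k x s}"
        using split[of w "\<lambda>x. True"] split[of w' "\<lambda>x. True"] IH by (simp only: simp_thms)
      then have "sum w {x \<in> C. (prefix_less k x s \<or> prefix_eq k x s) \<and> T \<le> co x k}
          = sum w' {x \<in> C. (prefix_less k x s \<or> prefix_eq k x s) \<and> T \<le> co x k}"
        by (simp only: le[OF w] le[OF w'] tails[OF k])
      moreover have "sum w {x \<in> C. prefix_less k x s \<and> T \<le> co x k} = sum w' {x \<in> C. prefix_less k x s \<and> T \<le> co x k}"
        by (simp only: lt[OF w] lt[OF w'] tails[OF k] IH)
      ultimately show ?thesis by (simp only: split add_left_cancel)
    qed
    have lt_Suc: "sum v {x \<in> C. prefix_less (Suc k) x s} + sum v {x \<in> C. prefix_eq k x s \<and> co s k \<le> co x k}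
       = sum v {x \<in> C. prefix_less k x s} + sum v {x \<in> C. prefix_eq k x s}" for v :: "'c \<Rightarrow> nat"
    proof -
      have "sum v {x \<in> C. prefix_less (Suc k) x s} + sum v {x \<in> C. prefix_eq k x s \<and> co s k \<le> co x k}
        = sum v ({x \<in> C. prefix_less (Suc k) x s} \<union> {x \<in> C. prefix_eq k x s \<and> co s k \<le> co x k})"
        using fin by (intro sum.union_disjoint[symmetric])
          (use prefix_eq_not_less in \<open>auto simp: prefix_less_Suc\<close>)
      also have "{x \<in> C. prefix_less (Suc k) x s} \<union> {x \<in> C. prefix_eq k x s \<and> co s k \<le> co x k}
        = {x \<in> C. prefix_less k x s} \<union> {x \<in> C. prefix_eq k x s}"
        by (auto simp: prefix_less_Suc)
      also have "sum v \<dots> = sum v {x \<in> C. prefix_less k x s} + sum v {x \<in> C. prefix_eq k x s}"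
        using fin by (intro sum.union_disjoint) (use prefix_eq_not_less in auto)
      finally show ?thesis .
    qed
    have eq_Suc: "sum v {x \<in> C. prefix_eq (Suc k) x s} + sum v {x \<in> C. prefix_eq k x s \<and> Suc (co s k) \<le> co x k}
       = sum v {x \<in> C. prefix_eq k x s \<and> co s k \<le> co x k}" for v :: "'c \<Rightarrow> nat"
    proof -
      have "sum v {x \<in> C. prefix_eq (Suc k) x s} + sum v {x \<in> C. prefix_eq k x s \<and> Suc (co s k) \<le> co x k}
        = sum v ({x \<in> C. prefix_eq (Suc k) x s} \<union> {x \<in> C. prefix_eq k x s \<and> Suc (co s k) \<le> co x k})"
        using fin by (intro sum.union_disjoint[symmetric]) (auto simp: prefix_eq_Suc)
      also have "{x \<in> C. prefix_eq (Suc k) x s} \<union> {x \<in> C. prefix_eq k x s \<and> Suc (co s k) \<le> co x k}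
        = {x \<in> C. prefix_eq k x s \<and> co s k \<le> co x k}"
        by (auto simp: prefix_eq_Suc)
      finally show ?thesis .
    qed
    show ?case
      using lt_Suc[of w] lt_Suc[of w'] eq_Suc[of w] eq_Suc[of w'] eqT[of "co s k"] eqT[of "Suc (co s k)"] IH
      by linarith
  qed
  from this[of q s] have "sum w {x \<in> C. prefix_eq q x s} = sum w' {x \<in> C. prefix_eq q x s}" using s by auto
  moreover have "{x \<in> C. prefix_eq q x s} = {s}"
    using s co_inj[OF _ s] by (auto simp: prefix_eq_def)
  ultimately show ?thesis by simp
qed

end

section \<open>Prime ideals of parametrized sets\<close>

definition vanishing_polys :: "'v set \<Rightarrow> ('v \<Rightarrow> complex) set \<Rightarrow> 'v mpoly set" where
  "vanishing_polys V Y = {f \<in> carrier (mpoly_ring V). \<forall>x\<in>Y. eval_mpoly x f = 0}"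

lemma ideal_vanishing_polys: "ideal (vanishing_polys V Y) (mpoly_ring V)"
  by (rule mpoly_idealI) (auto simp: vanishing_polys_def mpoly_carrier_closed)

text \<open>A product vanishing along a polynomial curve vanishes in one of its factors along that
  curve, so a set in which any two points are joined by such a curve is irreducible.\<close>

lemma primeideal_vanishing_polys:
  assumes "Y \<noteq> {}"
    and curve: "\<And>x y. x \<in> Y \<Longrightarrow> y \<in> Y \<Longrightarrow>
      \<exists>c. (\<forall>z. (\<lambda>v. poly (c v) z) \<in> Y) \<and> (\<lambda>v. poly (c v) 0) = x \<and> (\<lambda>v. poly (c v) 1) = y"
  shows "primeideal (vanishing_polys V Y) (mpoly_ring V)"
proof (rule primeidealI[OF ideal_vanishing_polys cring_mpoly_ring])
  have "1 \<notin> vanishing_polys V Y" using assms(1) by (auto simp: vanishing_polys_def)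
  then show "carrier (mpoly_ring V) \<noteq> vanishing_polys V Y"
    using mpoly_carrier_closed(7)[of V] by blast
next
  fix f g assume f: "f \<in> carrier (mpoly_ring V)" and g: "g \<in> carrier (mpoly_ring V)"
    and "f \<otimes>\<^bsub>mpoly_ring V\<^esub> g \<in> vanishing_polys V Y"
  then have fg: "eval_mpoly x f * eval_mpoly x g = 0" if "x \<in> Y" for x
    using that by (simp add: vanishing_polys_def)
  show "f \<in> vanishing_polys V Y \<or> g \<in> vanishing_polys V Y"
  proof (rule ccontr)
    assume "\<not> ?thesis"
    then obtain x y where x: "x \<in> Y" "eval_mpoly x f \<noteq> 0" and y: "y \<in> Y" "eval_mpoly y g \<noteq> 0"
      using f g by (auto simp: vanishing_polys_def)
    from curve[OF x(1) y(1)] obtain c where c: "\<And>z. (\<lambda>v. poly (c v) z) \<in> Y"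
      "(\<lambda>v. poly (c v) 0) = x" "(\<lambda>v. poly (c v) 1) = y" by blast
    have "poly (eval_curve c f * eval_curve c g) z = 0" for z
      using fg[OF c(1)[of z]] by (simp add: poly_eval_curve)
    then have "eval_curve c f * eval_curve c g = 0" using poly_all_0_iff_0 by blast
    moreover have "eval_curve c f \<noteq> 0"
      using x(2) c(2) poly_eval_curve[of c f 0] by (metis poly_0)
    moreover have "eval_curve c g \<noteq> 0"
      using y(2) c(3) poly_eval_curve[of c g 1] by (metis poly_0)
    ultimately show False by simp
  qed
qed

section \<open>A parametrization of the likelihood correspondence\<close>

context table
begin

text \<open>The outcome 0 takes the complementary probability, which leaves the parameters
  \<open>al k r\<close> with \<open>r \<ge> 1\<close> unconstrained.\<close>

definition prob :: "(nat \<Rightarrow> nat \<Rightarrow> 'a::comm_ring_1) \<Rightarrow> nat \<Rightarrow> nat \<Rightarrow> 'a" where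
  "prob al k r = (if r = 0 then 1 - (\<Sum>j=1..<D k. al k j) else al k r)"

text \<open>The marginal equations are solved for the axis cells, and the equation for the total is
  solved for the origin. \<open>THE\<close> picks the only nonzero coordinate of an axis cell;
  values outside \<open>C\<close> are immaterial. The coefficient ring is left open, since both
  complex numbers and univariate polynomials are inserted.\<close>

definition param_u :: "'a::comm_ring_1 \<Rightarrow> (nat \<Rightarrow> nat \<Rightarrow> 'a) \<Rightarrow> ('c \<Rightarrow> 'a) \<Rightarrow> 'c \<Rightarrow> 'a" where
  "param_u lam al U s =
    (if s \<in> interior_cells then U s
     else if s = origin then
       lam - (\<Sum>(k, r)\<in>axes. lam * al k r - (\<Sum>x | x \<in> interior_cells \<and> co x k = r. U x))
         - (\<Sum>x\<in>interior_cells. U x)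
     else (let k = (THE k. k < q \<and> co s k \<noteq> 0)
       in lam * al k (co s k) - (\<Sum>x | x \<in> interior_cells \<and> co x k = co s k. U x)))"

definition param :: "'a::comm_ring_1 \<Rightarrow> 'a \<Rightarrow> (nat \<Rightarrow> nat \<Rightarrow> 'a) \<Rightarrow> ('c \<Rightarrow> 'a) \<Rightarrow> 'c pu_var \<Rightarrow> 'a" where
  "param nu lam al U v =
    (case v of Pvar s \<Rightarrow> nu * (\<Prod>k<q. prob al k (co s k)) | Uvar s \<Rightarrow> param_u lam al U s)"

lemma interior_cells_subset: "interior_cells \<subseteq> C" by (auto simp: interior_cells_def)

lemma finite_interior_cells: "finite interior_cells"
  using finite_subset[OF interior_cells_subset finite_C] .

lemma axis_not_interior: "(k, r) \<in> axes \<Longrightarrow> axis k r \<notin> interior_cells"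
  by (force simp: interior_cells_def)

lemma origin_not_interior: "origin \<notin> interior_cells" by (simp add: interior_cells_def)

lemma cell_cases:
  assumes "s \<in> C"
  obtains "s = origin" | k r where "(k, r) \<in> axes" "s = axis k r" | "s \<in> interior_cells"
  using assms unfolding interior_cells_def by fast

section \<open>Slices and marginal sums of the parametrized tables\<close>

lemma sum_cells:
  fixes f :: "'c \<Rightarrow> 'a::comm_monoid_add"
  shows "sum f C = f origin + (\<Sum>(k, r)\<in>axes. f (axis k r)) + sum f interior_cells"
proof -
  let ?A = "(\<lambda>(k, r). axis k r) ` axes"
  have inj: "inj_on (\<lambda>(k, r). axis k r) axes"
    by (rule inj_onI) (use axis_inj in auto)
  have o: "origin \<notin> ?A \<union> interior_cells"
    using axis_neq_origin origin_not_interior by fastforce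
  have d: "?A \<inter> interior_cells = {}" using axis_not_interior by fastforce
  have "sum f C = f origin + sum f (?A \<union> interior_cells)"
    by (subst C_decomp, rule sum.insert) (use o finite_axes finite_interior_cells in auto)
  also have "sum f (?A \<union> interior_cells) = sum f ?A + sum f interior_cells"
    by (rule sum.union_disjoint) (use d finite_axes finite_interior_cells in auto)
  also have "sum f ?A = (\<Sum>(k, r)\<in>axes. f (axis k r))"
    unfolding sum.reindex[OF inj] by (rule sum.cong) auto
  finally show ?thesis by (simp add: add.assoc)
qed

lemma slice_eq:
  assumes "(k, r) \<in> axes"
  shows "{s \<in> C. co s k = r} = insert (axis k r) {x \<in> interior_cells. co x k = r}"
proof
  have k: "k < q" "0 < r" "r < D k" using assms by (auto simp: axes_def)
  show "{s \<in> C. co s k = r} \<subseteq> insert (axis k r) {x \<in> interior_cells. co x k = r}"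
  proof
    fix s assume s: "s \<in> {s \<in> C. co s k = r}"
    then have "s = origin \<or> s \<in> (\<lambda>(k, r). axis k r) ` axes \<or> s \<in> interior_cells"
      by (auto simp: interior_cells_def)
    moreover have "s \<noteq> origin" using s origin(2)[OF k(1)] k(2) by auto
    moreover have "s = axis k r" if "s \<in> (\<lambda>(k, r). axis k r) ` axes"
    proof -
      from that obtain k' r' where "(k', r') \<in> axes" "s = axis k' r'" by auto
      then show ?thesis using s axis(2)[of r' k' k] k by (auto simp: axes_def split: if_splits)
    qed
    ultimately show "s \<in> insert (axis k r) {x \<in> interior_cells. co x k = r}" using s by auto
  qed
  show "insert (axis k r) {x \<in> interior_cells. co x k = r} \<subseteq> {s \<in> C. co s k = r}"
    using axis[OF k(3)] k(1) interior_cells_subset by auto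
qed

lemma sum_slice:
  fixes f :: "'c \<Rightarrow> 'a::comm_monoid_add"
  assumes "(k, r) \<in> axes"
  shows "(\<Sum>s | s \<in> C \<and> co s k = r. f s) = f (axis k r) + (\<Sum>x | x \<in> interior_cells \<and> co x k = r. f x)"
  unfolding slice_eq[OF assms]
  by (rule sum.insert) (use finite_interior_cells axis_not_interior[OF assms] in auto)

lemma sum_slices:
  fixes f :: "'c \<Rightarrow> 'a::comm_monoid_add"
  assumes "k < q"
  shows "(\<Sum>r<D k. \<Sum>s | s \<in> C \<and> co s k = r. f s) = sum f C"
  by (rule sum.group) (use finite_C co_less assms in auto)

lemma sum_slice_zero:
  fixes f :: "'c \<Rightarrow> 'a::ab_group_add"
  assumes "k < q"
  shows "(\<Sum>s | s \<in> C \<and> co s k = 0. f s) = sum f C - (\<Sum>r=1..<D k. \<Sum>s | s \<in> C \<and> co s k = r. f s)"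
proof -
  have "{..<D k} = insert 0 {1..<D k}" using D_pos[OF assms] by auto
  then have "(\<Sum>r<D k. \<Sum>s | s \<in> C \<and> co s k = r. f s) =
    (\<Sum>s | s \<in> C \<and> co s k = 0. f s) + (\<Sum>r=1..<D k. \<Sum>s | s \<in> C \<and> co s k = r. f s)"
    by simp
  then show ?thesis using sum_slices[OF assms, of f] by (simp add: algebra_simps)
qed

lemma prob_sum: "k < q \<Longrightarrow> (\<Sum>r<D k. prob al k r) = 1"
proof -
  assume "k < q"
  then have "{..<D k} = insert 0 {1..<D k}" using D_pos by auto
  then have "(\<Sum>r<D k. prob al k r) = prob al k 0 + (\<Sum>r=1..<D k. prob al k r)" by simp
  also have "(\<Sum>r=1..<D k. prob al k r) = (\<Sum>r=1..<D k. al k r)"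
    by (rule sum.cong) (auto simp: prob_def)
  finally show ?thesis by (simp add: prob_def)
qed

lemma param_u_interior: "s \<in> interior_cells \<Longrightarrow> param_u lam al U s = U s"
  by (simp add: param_u_def)

lemma param_u_axis:
  assumes "(k, r) \<in> axes"
  shows "param_u lam al U (axis k r) = lam * al k r - (\<Sum>x | x \<in> interior_cells \<and> co x k = r. U x)"
proof -
  have k: "k < q" "0 < r" "r < D k" using assms by (auto simp: axes_def)
  have "(THE l. l < q \<and> co (axis k r) l \<noteq> 0) = k"
    by (rule the_equality) (use axis(2)[OF k(3)] k in \<open>auto split: if_splits\<close>)
  then show ?thesis
    using axis_not_interior[OF assms] axis_neq_origin[OF assms] axis(2)[OF k(3) k(1)]
    by (simp add: param_u_def)
qed

lemma param_u_origin:
  "param_u lam al U origin = lam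
    - (\<Sum>(k, r)\<in>axes. lam * al k r - (\<Sum>x | x \<in> interior_cells \<and> co x k = r. U x))
    - (\<Sum>x\<in>interior_cells. U x)"
  using origin_not_interior by (simp add: param_u_def)

lemma param_u_total: "sum (param_u lam al U) C = lam"
proof -
  have "(\<Sum>(k, r)\<in>axes. param_u lam al U (axis k r))
    = (\<Sum>(k, r)\<in>axes. lam * al k r - (\<Sum>x | x \<in> interior_cells \<and> co x k = r. U x))"
    by (rule sum.cong) (auto simp: param_u_axis)
  moreover have "(\<Sum>x\<in>interior_cells. param_u lam al U x) = (\<Sum>x\<in>interior_cells. U x)"
    by (rule sum.cong) (auto simp: param_u_interior)
  ultimately show ?thesis unfolding sum_cells param_u_origin by simp
qed

lemma param_u_marginal:
  assumes "k < q" "r < D k"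
  shows "(\<Sum>s | s \<in> C \<and> co s k = r. param_u lam al U s) = lam * prob al k r"
proof -
  have pos: "(\<Sum>s | s \<in> C \<and> co s k = r. param_u lam al U s) = lam * al k r" if "(k, r) \<in> axes" for r
  proof -
    have "(\<Sum>x | x \<in> interior_cells \<and> co x k = r. param_u lam al U x)
      = (\<Sum>x | x \<in> interior_cells \<and> co x k = r. U x)"
      by (rule sum.cong) (auto simp: param_u_interior)
    then show ?thesis by (simp add: sum_slice[OF that] param_u_axis[OF that])
  qed
  show ?thesis
  proof (cases "r = 0")
    case True
    have "(\<Sum>j=1..<D k. \<Sum>s | s \<in> C \<and> co s k = j. param_u lam al U s) = (\<Sum>j=1..<D k. lam * al k j)"
      by (rule sum.cong) (use pos assms in \<open>auto simp: axes_def\<close>)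
    then show ?thesis
      unfolding True by (simp add: sum_slice_zero[OF assms(1)] param_u_total prob_def right_diff_distrib sum_distrib_left)
  next
    case False
    then show ?thesis using pos[of r] assms by (simp add: axes_def prob_def)
  qed
qed

text \<open>Each slice with \<open>r \<ge> 1\<close> contains one axis cell besides interior cells,
  so its marginal fixes the axis entry, and the total then fixes the origin. Thus every table with
  the right marginals is parametrized by its own interior entries.\<close>

lemma param_u_unique:
  fixes u :: "'c \<Rightarrow> 'a::comm_ring_1"
  assumes marg: "\<And>k r. (k, r) \<in> axes \<Longrightarrow> (\<Sum>s | s \<in> C \<and> co s k = r. u s) = lam * al k r"
    and total: "sum u C = lam" and s: "s \<in> C"
  shows "param_u lam al u s = u s"
proof -
  have ax: "param_u lam al u (axis k r) = u (axis k r)" if "(k, r) \<in> axes" for k r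
    using marg[OF that] unfolding sum_slice[OF that] param_u_axis[OF that] by (simp add: algebra_simps)
  have "(\<Sum>(k, r)\<in>axes. param_u lam al u (axis k r)) = (\<Sum>(k, r)\<in>axes. u (axis k r))"
    by (rule sum.cong) (auto simp: ax)
  moreover have "(\<Sum>x\<in>interior_cells. param_u lam al u x) = (\<Sum>x\<in>interior_cells. u x)"
    by (rule sum.cong) (auto simp: param_u_interior)
  moreover have "sum (param_u lam al u) C = sum u C" unfolding total by (rule param_u_total)
  ultimately have "param_u lam al u origin = u origin" unfolding sum_cells by simp
  from s this show ?thesis
    by (cases rule: cell_cases) (auto simp: ax param_u_interior)
qed

lemma poly_prob: "poly (prob al k r) z = prob (\<lambda>k r. poly (al k r) z) k r"
  by (simp add: prob_def poly_sum)

lemma poly_param_u: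
  "poly (param_u lam al U s) z = param_u (poly lam z) (\<lambda>k r. poly (al k r) z) (\<lambda>s. poly (U s) z) s"
  by (simp add: param_u_def poly_sum Let_def case_prod_unfold)

lemma poly_param:
  "poly (param nu lam al U v) z =
    param (poly nu z) (poly lam z) (\<lambda>k r. poly (al k r) z) (\<lambda>s. poly (U s) z) v"
  by (simp add: param_def poly_prod poly_prob poly_param_u split: pu_var.split)

definition param_points :: "('c pu_var \<Rightarrow> complex) set" where
  "param_points = {param nu lam al U | nu lam al U. True}"

definition param_ideal :: "'c pu_var mpoly set" where
  "param_ideal = vanishing_polys (pu_vars C) param_points"

lemma primeideal_param_ideal: "primeideal param_ideal (pu_ring C)"
  unfolding param_ideal_def
proof (rule primeideal_vanishing_polys)
  show "param_points \<noteq> {}" unfolding param_points_def by blast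
next
  fix x y assume "x \<in> param_points" "y \<in> param_points"
  then obtain nu lam al U nu' lam' al' U' where
    x: "x = param nu lam al U" and y: "y = param nu' lam' al' U'" by (auto simp: param_points_def)
  \<comment> \<open>Linear interpolation of the parameters: the parameter space is an affine space,
    and \<open>param\<close> is given by polynomial expressions.\<close>
  define c where "c = param [:nu, nu' - nu:] [:lam, lam' - lam:]
    (\<lambda>k r. [:al k r, al' k r - al k r:]) (\<lambda>s. [:U s, U' s - U s:])"
  show "\<exists>c. (\<forall>z. (\<lambda>v. poly (c v) z) \<in> param_points) \<and> (\<lambda>v. poly (c v) 0) = x \<and> (\<lambda>v. poly (c v) 1) = y"
    by (rule exI[of _ c]) (auto simp: c_def poly_param x y param_points_def)
qed

text \<open>Exchanging the \<open>k\<close>-th coordinates of \<open>s\<close> and \<open>s'\<close>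
  produces the two other corners, so this is a minor of the \<open>k\<close>-th flattening expressed
  without row and column numbers.\<close>

definition p_minor :: "nat \<Rightarrow> 'c \<Rightarrow> 'c \<Rightarrow> 'c pu_var mpoly" where
  "p_minor k s s' = Var (Pvar s) * Var (Pvar s')
     - Var (Pvar (upd s k (co s' k))) * Var (Pvar (upd s' k (co s k)))"

definition u_marginal :: "nat \<Rightarrow> nat \<Rightarrow> 'c pu_var mpoly" where
  "u_marginal k r = (\<Sum>s | s \<in> C \<and> co s k = r. Var (Uvar s))"

definition u_minor :: "nat \<Rightarrow> 'c \<Rightarrow> nat \<Rightarrow> 'c pu_var mpoly" where
  "u_minor k s r = Var (Pvar s) * u_marginal k r - Var (Pvar (upd s k r)) * u_marginal k (co s k)"

lemma prod_cell:
  "k < q \<Longrightarrow> (\<Prod>l<q. g l (co s l)) = g k (co s k) * (\<Prod>l\<in>{..<q} - {k}. g l (co s l))"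
  by (rule prod.remove) auto

lemma prod_upd:
  assumes "k < q" "s \<in> C" "r < D k"
  shows "(\<Prod>l<q. g l (co (upd s k r) l)) = g k r * (\<Prod>l\<in>{..<q} - {k}. g l (co s l))"
proof -
  have "(\<Prod>l\<in>{..<q} - {k}. g l (co (upd s k r) l)) = (\<Prod>l\<in>{..<q} - {k}. g l (co s l))"
    by (rule prod.cong) (use upd(2)[OF assms(2,3)] in auto)
  then show ?thesis using upd(2)[OF assms(2,3,1)] by (simp add: prod_cell[OF assms(1)])
qed

lemma Var_in_pu_ring:
  "s \<in> C \<Longrightarrow> Var (Pvar s) \<in> carrier (pu_ring C)" "s \<in> C \<Longrightarrow> Var (Uvar s) \<in> carrier (pu_ring C)"
  by (auto simp: pu_vars_def intro!: mpoly_carrier_closed)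

lemma p_minor_in_param_ideal:
  assumes "k < q" "s \<in> C" "s' \<in> C"
  shows "p_minor k s s' \<in> param_ideal"
proof -
  have r: "co s k < D k" "co s' k < D k" using assms co_less by auto
  have "p_minor k s s' \<in> carrier (pu_ring C)"
    unfolding p_minor_def
    by (intro mpoly_carrier_closed(2,3) Var_in_pu_ring assms upd(1)[OF assms(2) r(2)] upd(1)[OF assms(3) r(1)])
  moreover have "eval_mpoly (param nu lam al U) (p_minor k s s') = 0" for nu lam al U
    by (simp add: p_minor_def param_def prod_upd[OF assms(1,2) r(2)] prod_upd[OF assms(1,3) r(1)]
        prod_cell[OF assms(1), of _ s] prod_cell[OF assms(1), of _ s'])
  ultimately show ?thesis by (auto simp: param_ideal_def vanishing_polys_def param_points_def)
qed

lemma u_marginal_carrier: "u_marginal k r \<in> carrier (pu_ring C)"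
  unfolding u_marginal_def by (intro mpoly_carrier_sum) (auto intro: Var_in_pu_ring)

lemma u_minor_in_param_ideal:
  assumes "k < q" "s \<in> C" "r < D k"
  shows "u_minor k s r \<in> param_ideal"
proof -
  have s: "co s k < D k" using assms co_less by auto
  have "u_minor k s r \<in> carrier (pu_ring C)"
    unfolding u_minor_def
    by (intro mpoly_carrier_closed(2,3) Var_in_pu_ring assms u_marginal_carrier upd(1)[OF assms(2,3)])
  moreover have "eval_mpoly (param nu lam al U) (u_marginal k j) = lam * prob al k j" if "j < D k" for nu lam al U j
    using param_u_marginal[OF assms(1) that, of lam al U] by (simp add: u_marginal_def param_def)
  then have "eval_mpoly (param nu lam al U) (u_minor k s r) = 0" for nu lam al U
    using s assms(3)
    by (simp add: u_minor_def) (simp add: param_def prod_upd[OF assms] prod_cell[OF assms(1), of _ s])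
  ultimately show ?thesis by (auto simp: param_ideal_def vanishing_polys_def param_points_def)
qed

end

section \<open>Independence of the standard monomials\<close>

text \<open>Here \<open>monom 1 1\<close> is the variable of the curve, so the lowest term of
  \<open>c\<close> has exponent \<open>e\<close> and coefficient 1.\<close>

definition low_monic :: "complex poly \<Rightarrow> nat \<Rightarrow> bool" where
  "low_monic c e \<longleftrightarrow> (\<exists>y. c = monom 1 e * (1 + monom 1 1 * y))"

lemma low_monic_monom: "low_monic (monom 1 e) e"
  unfolding low_monic_def by (rule exI[of _ 0]) simp

lemma low_monic_one: "low_monic 1 0"
  using low_monic_monom[of 0] by simp

lemma low_monic_mult:
  assumes "low_monic c e" "low_monic c' e'"
  shows "low_monic (c * c') (e + e')"
proof -
  obtain y y' where c: "c = monom 1 e * (1 + monom 1 1 * y)" "c' = monom 1 e' * (1 + monom 1 1 * y')"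
    using assms unfolding low_monic_def by blast
  have "monom 1 (e + e') = monom 1 e * (monom 1 e' :: complex poly)" by (simp add: mult_monom)
  then have "c * c' = monom 1 (e + e') * (1 + monom 1 1 * (y + y' + monom 1 1 * y * y'))"
    unfolding c by (simp only: algebra_simps mult_1_left mult_1_right)
  then show ?thesis unfolding low_monic_def by blast
qed

lemma low_monic_prod:
  "finite A \<Longrightarrow> (\<And>i. i \<in> A \<Longrightarrow> low_monic (c i) (e i)) \<Longrightarrow> low_monic (\<Prod>i\<in>A. c i) (\<Sum>i\<in>A. e i)"
  by (induction A rule: finite_induct) (auto simp: low_monic_one low_monic_mult)

lemma low_monic_power: "low_monic c e \<Longrightarrow> low_monic (c ^ n) (n * e)"
  by (induction n) (auto simp: low_monic_one low_monic_mult)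

lemma low_monic_diff:
  assumes "low_monic c e" "monom 1 (Suc e) dvd d"
  shows "low_monic (c - d) e"
proof -
  obtain y where c: "c = monom 1 e * (1 + monom 1 1 * y)"
    using assms(1) unfolding low_monic_def by blast
  obtain z where d: "d = monom 1 (Suc e) * z" using assms(2) by blast
  have "monom 1 (Suc e) = monom 1 e * (monom 1 1 :: complex poly)" by (simp add: mult_monom)
  then have "c - d = monom 1 e * (1 + monom 1 1 * (y - z))"
    unfolding c d by (simp add: algebra_simps)
  then show ?thesis unfolding low_monic_def by blast
qed

lemma low_monic_coeff:
  assumes "low_monic c e"
  shows "coeff c e = 1" "j < e \<Longrightarrow> coeff c j = 0"
proof -
  obtain y where c: "c = monom 1 e * (1 + monom 1 1 * y)"
    using assms(1) unfolding low_monic_def by blast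
  show "coeff c e = 1" "j < e \<Longrightarrow> coeff c j = 0"
    unfolding c by (simp_all add: coeff_monom_mult)
qed

lemma monom_dvd_monom: "i \<le> j \<Longrightarrow> monom 1 i dvd (monom 1 j :: complex poly)"
  by (rule dvdI[of _ _ "monom 1 (j - i)"]) (simp add: mult_monom)

text \<open>Only the monomial with the least value of \<open>e\<close> contributes to the
  coefficient at that exponent, so this coefficient cannot cancel.\<close>

lemma eval_curve_independent:
  assumes low: "\<And>m. m \<in> supp f \<Longrightarrow> low_monic (eval_monom c m) (e m)"
    and inj: "inj_on e (supp f)" and "eval_curve c f = 0"
  shows "f = 0"
proof (rule ccontr)
  assume "f \<noteq> 0"
  then have "Min (e ` supp f) \<in> e ` supp f" by (intro Min_in) auto
  then obtain m where m: "m \<in> supp f" "e m = Min (e ` supp f)" by force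
  have min: "e m \<le> e m'" if "m' \<in> supp f" for m'
    unfolding m(2) using that by (intro Min_le) auto
  have "coeff (eval_monom c m') (e m) = 0" if "m' \<in> supp f - {m}" for m'
  proof (rule low_monic_coeff(2)[OF low])
    have "e m \<noteq> e m'" using inj that m(1) by (auto simp: inj_on_def)
    then show "e m < e m'" using min[of m'] that by auto
  qed (use that in auto)
  then have "coeff (eval_curve c f) (e m) = lkp f m * coeff (eval_monom c m) (e m)"
    unfolding eval_curve_def coeff_sum using m(1) by (simp add: sum.remove[of _ m])
  then show False using assms(3) low_monic_coeff(1)[OF low[OF m(1)]] m(1) by (simp add: in_keys_iff)
qed

datatype 'c param = Nu | Lam | Al nat nat | Inner 'c

context table
begin

section \<open>Lowest terms of the parametrization\<close>

definition params :: "'c param set" where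
  "params = insert Nu (insert Lam (case_prod Al ` axes \<union> Inner ` interior_cells))"

text \<open>To lowest order, a variable of the parametrized point is the product of the parameters
  whose set \<open>param_vars\<close> contains it.\<close>

fun param_vars :: "'c param \<Rightarrow> 'c pu_var set" where
  "param_vars Nu = Pvar ` C"
| "param_vars Lam = Uvar ` (C - interior_cells)"
| "param_vars (Al k r) = insert (Uvar (axis k r)) (Pvar ` {s \<in> C. co s k = r})"
| "param_vars (Inner s) = {Uvar s}"

text \<open>The exponent of the lowest term of the coordinate \<open>v\<close> on the curve where
  each parameter \<pi> is a power of the curve variable with exponent
  \<open>W \<pi>\<close>.\<close>

definition var_weight :: "('c param \<Rightarrow> nat) \<Rightarrow> 'c pu_var \<Rightarrow> nat" where
  "var_weight W v = (\<Sum>\<pi>\<in>params. if v \<in> param_vars \<pi> then W \<pi> else 0)"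

lemma finite_params: "finite params"
  by (simp add: params_def finite_axes finite_interior_cells)

lemma sum_params:
  fixes f :: "'c param \<Rightarrow> nat"
  shows "sum f params = f Nu + f Lam + (\<Sum>(k, r)\<in>axes. f (Al k r)) + (\<Sum>s\<in>interior_cells. f (Inner s))"
proof -
  let ?A = "case_prod Al ` axes :: 'c param set" and ?I = "Inner ` interior_cells"
  have fin: "finite ?A" "finite ?I" using finite_axes finite_interior_cells by auto
  have "sum f params = f Nu + (f Lam + sum f (?A \<union> ?I))"
  proof -
    have "Nu \<notin> insert Lam (?A \<union> ?I)" "Lam \<notin> ?A \<union> ?I" by auto
    then show ?thesis
      unfolding params_def using fin by (simp only: sum.insert finite_insert finite_Un simp_thms)
  qed
  also have "sum f (?A \<union> ?I) = sum f ?A + sum f ?I"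
    by (rule sum.union_disjoint) (use fin in auto)
  also have "sum f ?A = (\<Sum>(k, r)\<in>axes. f (Al k r))"
    by (subst sum.reindex) (auto simp: inj_on_def intro!: sum.cong)
  also have "sum f ?I = (\<Sum>s\<in>interior_cells. f (Inner s))"
    by (subst sum.reindex) (auto simp: inj_on_def)
  finally show ?thesis by simp
qed

lemma var_weight_Pvar:
  assumes "s \<in> C"
  shows "var_weight W (Pvar s) = W Nu + (\<Sum>k<q. if co s k = 0 then 0 else W (Al k (co s k)))"
proof -
  have "(\<Sum>(k, r)\<in>axes. if Pvar s \<in> param_vars (Al k r) then W (Al k r) else 0)
    = (\<Sum>(k, r)\<in>axes. if co s k = r then W (Al k r) else 0)"
    using assms by (intro sum.cong) auto
  also have "\<dots> = (\<Sum>k<q. \<Sum>r=1..<D k. if co s k = r then W (Al k r) else 0)"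
    unfolding axes_def by (subst sum.Sigma) auto
  also have "\<dots> = (\<Sum>k<q. if co s k = 0 then 0 else W (Al k (co s k)))"
    by (rule sum.cong) (use co_less[OF assms] in auto)
  finally show ?thesis
    using assms unfolding var_weight_def sum_params by auto
qed

lemma var_weight_interior:
  assumes "s \<in> interior_cells"
  shows "var_weight W (Uvar s) = W (Inner s)"
proof -
  have "(\<Sum>(k, r)\<in>axes. if Uvar s \<in> param_vars (Al k r) then W (Al k r) else 0) = 0"
    using assms axis_not_interior by (intro sum.neutral) auto
  moreover have "(\<Sum>x\<in>interior_cells. if Uvar s \<in> param_vars (Inner x) then W (Inner x) else 0) = W (Inner s)"
    using assms finite_interior_cells by simp
  ultimately show ?thesis
    using assms unfolding var_weight_def sum_params by auto
qed

lemma var_weight_origin: "var_weight W (Uvar origin) = W Lam"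
proof -
  have "(\<Sum>(k, r)\<in>axes. if Uvar origin \<in> param_vars (Al k r) then W (Al k r) else 0) = 0"
    using axis_neq_origin by (intro sum.neutral) fastforce
  moreover have "(\<Sum>x\<in>interior_cells. if Uvar origin \<in> param_vars (Inner x) then W (Inner x) else 0) = 0"
    using origin_not_interior by (intro sum.neutral) auto
  ultimately show ?thesis
    using origin(1) origin_not_interior unfolding var_weight_def sum_params by auto
qed

lemma var_weight_axis:
  assumes "(k, r) \<in> axes"
  shows "var_weight W (Uvar (axis k r)) = W Lam + W (Al k r)"
proof -
  have "axis k r \<in> C" using assms axis(1) by (auto simp: axes_def)
  have "(\<Sum>(k', r')\<in>axes. if Uvar (axis k r) \<in> param_vars (Al k' r') then W (Al k' r') else 0)
    = (\<Sum>p\<in>axes. if p = (k, r) then W (Al k r) else 0)"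
  proof (rule sum.cong[OF refl], clarify)
    fix k' r' assume "(k', r') \<in> axes"
    then have "axis k r = axis k' r' \<longleftrightarrow> (k', r') = (k, r)" using axis_inj[OF assms] by blast
    moreover have "Uvar (axis k r) \<in> param_vars (Al k' r') \<longleftrightarrow> axis k r = axis k' r'" by auto
    ultimately show "(if Uvar (axis k r) \<in> param_vars (Al k' r') then W (Al k' r') else 0)
        = (if (k', r') = (k, r) then W (Al k r) else 0)" by auto
  qed
  also have "\<dots> = W (Al k r)" using assms finite_axes by simp
  finally have 1: "(\<Sum>(k', r')\<in>axes. if Uvar (axis k r) \<in> param_vars (Al k' r') then W (Al k' r') else 0)
    = W (Al k r)" .
  have 2: "(\<Sum>x\<in>interior_cells. if Uvar (axis k r) \<in> param_vars (Inner x) then W (Inner x) else 0) = 0"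
    using axis_not_interior[OF assms] by (intro sum.neutral) auto
  show ?thesis
    unfolding var_weight_def sum_params 1 2
    using \<open>axis k r \<in> C\<close> axis_not_interior[OF assms] by auto
qed

lemma pu_var_cases:
  assumes "v \<in> pu_vars C"
  obtains s where "s \<in> C" "v = Pvar s" | s where "s \<in> interior_cells" "v = Uvar s"
    | "v = Uvar origin" | k r where "(k, r) \<in> axes" "v = Uvar (axis k r)"
proof -
  from assms consider s where "s \<in> C" "v = Pvar s" | s where "s \<in> C" "v = Uvar s"
    by (auto simp: pu_vars_def)
  then show thesis
  proof cases
    case (1 s)
    then show thesis by (rule that(1))
  next
    case (2 s)
    from 2(1) show thesis
      by (cases rule: cell_cases) (use that(2-4) 2(2) in blast)+
  qed
qed

text \<open>\<open>W1\<close> makes the complementary probabilities start with 1, and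
  \<open>W2\<close> and \<open>W3\<close> move the interior entries above the axis cells and the
  origin, so every correction term has a larger exponent. This matches the term order, in which the
  axis cell is the leading variable of its marginal.\<close>

lemma low_monic_param:
  assumes W1: "\<And>k r. (k, r) \<in> axes \<Longrightarrow> 0 < W (Al k r)"
    and W2: "\<And>k r s. (k, r) \<in> axes \<Longrightarrow> s \<in> interior_cells \<Longrightarrow> W Lam + W (Al k r) < W (Inner s)"
    and W3: "\<And>s. s \<in> interior_cells \<Longrightarrow> W Lam < W (Inner s)"
    and v: "v \<in> pu_vars C"
  shows "low_monic (param (monom 1 (W Nu)) (monom 1 (W Lam)) (\<lambda>k r. monom 1 (W (Al k r)))
    (\<lambda>s. monom 1 (W (Inner s))) v) (var_weight W v)"
  using v
proof (cases v rule: pu_var_cases)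
  case (1 s)
  let ?al = "\<lambda>k r. monom 1 (W (Al k r)) :: complex poly"
  have "low_monic (prob ?al k (co s k)) (if co s k = 0 then 0 else W (Al k (co s k)))" if "k < q" for k
  proof (cases "co s k = 0")
    case True
    have "low_monic (1 - (\<Sum>j=1..<D k. ?al k j)) 0"
      by (rule low_monic_diff[OF low_monic_one], rule dvd_sum, rule monom_dvd_monom)
        (use W1[of k] that in \<open>auto simp: axes_def Suc_le_eq\<close>)
    then show ?thesis using True by (simp add: prob_def)
  next
    case False
    then show ?thesis using low_monic_monom by (simp add: prob_def)
  qed
  then have "low_monic (\<Prod>k<q. prob ?al k (co s k)) (\<Sum>k<q. if co s k = 0 then 0 else W (Al k (co s k)))"
    by (intro low_monic_prod) auto
  then show ?thesis
    unfolding 1(2) var_weight_Pvar[OF 1(1)] param_def pu_var.case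
    by (intro low_monic_mult low_monic_monom)
next
  case (2 s)
  then show ?thesis by (simp add: param_def param_u_interior var_weight_interior low_monic_monom)
next
  case 3
  let ?L = "monom 1 (W Lam) :: complex poly"
  have al: "monom 1 (Suc (W Lam)) dvd ?L * monom 1 (W (Al k r))" if "(k, r) \<in> axes" for k r
    using W1[OF that] by (simp add: mult_monom monom_dvd_monom)
  have U: "monom 1 (Suc (W Lam)) dvd (monom 1 (W (Inner s)) :: complex poly)" if "s \<in> interior_cells" for s
    using W3[OF that] by (intro monom_dvd_monom) auto
  have "low_monic (?L
    - (\<Sum>(k, r)\<in>axes. ?L * monom 1 (W (Al k r)) - (\<Sum>x | x \<in> interior_cells \<and> co x k = r. monom 1 (W (Inner x))))
    - (\<Sum>x\<in>interior_cells. monom 1 (W (Inner x)))) (W Lam)"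
    by (intro low_monic_diff low_monic_monom dvd_sum) (auto intro!: dvd_diff dvd_sum al U)
  then show ?thesis unfolding 3 var_weight_origin by (simp add: param_def param_u_origin)
next
  case (4 k r)
  have "low_monic (monom 1 (W Lam) * monom 1 (W (Al k r)) - (\<Sum>x | x \<in> interior_cells \<and> co x k = r. monom 1 (W (Inner x))))
     (W Lam + W (Al k r))"
    by (intro low_monic_diff low_monic_mult low_monic_monom dvd_sum monom_dvd_monom)
      (use W2[OF 4(1)] in \<open>auto simp: Suc_le_eq\<close>)
  then show ?thesis
    unfolding 4(2) var_weight_axis[OF 4(1)] by (simp add: param_def param_u_axis[OF 4(1)])
qed

text \<open>The exponent of the parameter \<pi> in the lowest term of \<open>m\<close>. It becomes a
  digit in the literal sense once the weights are powers of a common base.\<close>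

definition digit :: "('c pu_var \<Rightarrow>\<^sub>0 nat) \<Rightarrow> 'c param \<Rightarrow> nat" where
  "digit m \<pi> = sum (lkp m) (param_vars \<pi>)"

lemma finite_pu_vars: "finite (pu_vars C)" using finite_C by (simp add: pu_vars_def)

lemma param_vars_subset: "\<pi> \<in> params \<Longrightarrow> param_vars \<pi> \<subseteq> pu_vars C"
  using axis(1) interior_cells_subset by (auto simp: params_def pu_vars_def axes_def)

lemma sum_var_weight:
  "(\<Sum>v\<in>pu_vars C. lkp m v * var_weight W v) = (\<Sum>\<pi>\<in>params. digit m \<pi> * W \<pi>)"
proof -
  have "(\<Sum>v\<in>pu_vars C. lkp m v * var_weight W v)
    = (\<Sum>v\<in>pu_vars C. \<Sum>\<pi>\<in>params. if v \<in> param_vars \<pi> then lkp m v * W \<pi> else 0)"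
    unfolding var_weight_def sum_distrib_left by (intro sum.cong) auto
  also have "\<dots> = (\<Sum>\<pi>\<in>params. \<Sum>v\<in>pu_vars C. if v \<in> param_vars \<pi> then lkp m v * W \<pi> else 0)"
    by (rule sum.swap)
  also have "\<dots> = (\<Sum>\<pi>\<in>params. digit m \<pi> * W \<pi>)"
  proof (rule sum.cong[OF refl])
    fix \<pi> assume "\<pi> \<in> params"
    then have "pu_vars C \<inter> param_vars \<pi> = param_vars \<pi>" using param_vars_subset by blast
    then show "(\<Sum>v\<in>pu_vars C. if v \<in> param_vars \<pi> then lkp m v * W \<pi> else 0) = digit m \<pi> * W \<pi>"
      using sum.inter_restrict[OF finite_pu_vars, of "\<lambda>v. lkp m v * W \<pi>" "param_vars \<pi>"]
      by (simp add: digit_def sum_distrib_right)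
  qed
  finally show ?thesis .
qed

text \<open>The first conjunct comes from the leading monomials of the p minors. The second comes
  from those of the u minors, which pair \<open>Pvar s\<close> with \<open>Uvar (axis k r)\<close>
  for \<open>co s k < r\<close>.\<close>

definition standard :: "('c pu_var \<Rightarrow>\<^sub>0 nat) \<Rightarrow> bool" where
  "standard m \<longleftrightarrow> chain_weight (\<lambda>s. lkp m (Pvar s)) \<and>
    (\<forall>s\<in>C. \<forall>k r. (k, r) \<in> axes \<longrightarrow> 0 < lkp m (Pvar s) \<longrightarrow> 0 < lkp m (Uvar (axis k r)) \<longrightarrow> r \<le> co s k)"

lemma sum_Pvar: "sum (lkp m) (Pvar ` A) = (\<Sum>s\<in>A. lkp m (Pvar s))"
  by (subst sum.reindex) (auto simp: inj_on_def)

lemma sum_Uvar: "sum (lkp m) (Uvar ` A) = (\<Sum>s\<in>A. lkp m (Uvar s))"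
  by (subst sum.reindex) (auto simp: inj_on_def)

text \<open>The digit of \<open>Al k r\<close> mixes the p exponents of a slice with the u exponent
  of an axis cell. In a standard monomial a p variable below level \<open>T\<close> excludes the
  axis u variables at or above \<open>T\<close>, so the minimum rule isolates the p part.\<close>

lemma standard_tail:
  assumes m: "standard m" and k: "k < q" and T: "0 < T"
  shows "(\<Sum>s | s \<in> C \<and> T \<le> co s k. lkp m (Pvar s)) = min (digit m Nu) (\<Sum>r=T..<D k. digit m (Al k r))"
proof -
  define B where "B = (\<Union>r\<in>{T..<D k}. param_vars (Al k r))"
  have fin: "finite (param_vars (Al k r))" for r using finite_C by simp
  have ax: "(k, r) \<in> axes" if "r \<in> {T..<D k}" for r using that k T by (auto simp: axes_def)
  have disj: "param_vars (Al k r) \<inter> param_vars (Al k r') = {}" if "r \<in> {T..<D k}" "r' \<in> {T..<D k}" "r \<noteq> r'" for r r'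
    using axis_inj[OF ax[OF that(1)] ax[OF that(2)]] that(3) by auto
  have sumB: "sum (lkp m) B = (\<Sum>r=T..<D k. digit m (Al k r))"
    unfolding B_def digit_def by (rule sum.UNION_disjoint) (use fin disj in blast)+
  have AB: "Pvar ` C \<inter> B = Pvar ` {s \<in> C. T \<le> co s k}"
    using co_less k by (auto simp: B_def image_iff)
  have "sum (lkp m) (Pvar ` C \<inter> B) = min (sum (lkp m) (Pvar ` C)) (sum (lkp m) B)"
  proof (rule sum_Int_eq_min)
    fix x y assume x: "x \<in> Pvar ` C - B" and y: "y \<in> B - Pvar ` C"
    from x obtain s where s: "s \<in> C" "x = Pvar s" by auto
    have sT: "\<not> T \<le> co s k"
    proof
      assume "T \<le> co s k"
      then have "x \<in> Pvar ` {s \<in> C. T \<le> co s k}" using s by simp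
      then have "x \<in> Pvar ` C \<inter> B" by (simp only: AB)
      then show False using x by simp
    qed
    from y obtain r where r: "r \<in> {T..<D k}" "y = Uvar (axis k r)"
    proof -
      from y obtain r where r: "r \<in> {T..<D k}" "y \<in> param_vars (Al k r)" unfolding B_def by blast
      have "y \<notin> Pvar ` {s \<in> C. co s k = r}" using y by auto
      then show thesis using that[OF r(1)] r(2) by simp
    qed
    have "0 < lkp m (Pvar s) \<longrightarrow> 0 < lkp m (Uvar (axis k r)) \<longrightarrow> r \<le> co s k"
      using m[unfolded standard_def, THEN conjunct2, rule_format, OF s(1) ax[OF r(1)]] by simp
    then show "lkp m x = 0 \<or> lkp m y = 0" using s sT r by auto
  qed (use finite_C fin in \<open>auto simp: B_def\<close>)
  then show ?thesis
    unfolding AB sumB by (simp only: sum_Pvar digit_def param_vars.simps)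
qed

text \<open>The tails of the p exponents follow from \<open>standard_tail\<close>, and single p
  exponents from \<open>chain_weight_unique\<close>. After that the digit of each
  \<open>Al k r\<close> has one unknown, the u exponent of the axis cell, and \<open>Lam\<close>
  leaves that of the origin.\<close>

lemma standard_digits_unique:
  assumes m: "standard m" and m': "standard m'"
    and supp: "supp m \<subseteq> pu_vars C" "supp m' \<subseteq> pu_vars C"
    and digits: "\<And>\<pi>. \<pi> \<in> params \<Longrightarrow> digit m \<pi> = digit m' \<pi>"
  shows "m = m'"
proof -
  have Nu: "digit m Nu = digit m' Nu" and Lam: "digit m Lam = digit m' Lam"
    by (rule digits, simp add: params_def)+
  have Al: "digit m (Al k r) = digit m' (Al k r)" if "(k, r) \<in> axes" for k r
    by (rule digits) (use that in \<open>force simp: params_def\<close>)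
  have total: "(\<Sum>s\<in>C. lkp m (Pvar s)) = (\<Sum>s\<in>C. lkp m' (Pvar s))"
    using Nu unfolding digit_def param_vars.simps sum_Pvar .
  have P: "lkp m (Pvar s) = lkp m' (Pvar s)" if "s \<in> C" for s
  proof (rule chain_weight_unique[OF _ _ _ total that])
    fix k T assume k: "k < q"
    show "(\<Sum>s | s \<in> C \<and> T \<le> co s k. lkp m (Pvar s)) = (\<Sum>s | s \<in> C \<and> T \<le> co s k. lkp m' (Pvar s))"
    \<comment> \<open>No parameter belongs to the outcome 0, but the tail from 0 is just the total p
      degree.\<close>
    proof (cases "T = 0")
      case False
      have "(\<Sum>r=T..<D k. digit m (Al k r)) = (\<Sum>r=T..<D k. digit m' (Al k r))"
        by (rule sum.cong) (use Al k False in \<open>auto simp: axes_def\<close>)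
      then show ?thesis
        using False by (simp only: standard_tail[OF m k] standard_tail[OF m' k] Nu neq0_conv)
    qed (use total in simp)
  qed (use m m' in \<open>auto simp: standard_def\<close>)
  have U_int: "lkp m (Uvar s) = lkp m' (Uvar s)" if "s \<in> interior_cells" for s
    using digits[of "Inner s"] that by (simp add: params_def digit_def)
  have U_axis: "lkp m (Uvar (axis k r)) = lkp m' (Uvar (axis k r))" if "(k, r) \<in> axes" for k r
  proof -
    have "digit m (Al k r) = lkp m (Uvar (axis k r)) + (\<Sum>s | s \<in> C \<and> co s k = r. lkp m (Pvar s))" for m
      unfolding digit_def param_vars.simps sum_Pvar[symmetric]
      by (rule sum.insert) (use finite_C in auto)
    moreover have "(\<Sum>s | s \<in> C \<and> co s k = r. lkp m (Pvar s)) = (\<Sum>s | s \<in> C \<and> co s k = r. lkp m' (Pvar s))"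
      by (rule sum.cong) (auto simp: P)
    ultimately show ?thesis using Al[OF that] by simp
  qed
  have Lam_eq: "digit m Lam = lkp m (Uvar origin) + (\<Sum>(k, r)\<in>axes. lkp m (Uvar (axis k r)))" for m
  proof -
    have "(\<Sum>s\<in>C. lkp m (Uvar s)) = (\<Sum>s\<in>C - interior_cells. lkp m (Uvar s)) + (\<Sum>s\<in>interior_cells. lkp m (Uvar s))"
      by (rule sum.subset_diff[OF interior_cells_subset finite_C])
    then show ?thesis unfolding digit_def param_vars.simps sum_Uvar sum_cells by simp
  qed
  have "(\<Sum>(k, r)\<in>axes. lkp m (Uvar (axis k r))) = (\<Sum>(k, r)\<in>axes. lkp m' (Uvar (axis k r)))"
    by (rule sum.cong) (auto simp: U_axis)
  then have U_origin: "lkp m (Uvar origin) = lkp m' (Uvar origin)"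
    using Lam unfolding Lam_eq by simp
  show ?thesis
  proof (rule poly_mapping_eqI)
    fix v
    show "lkp m v = lkp m' v"
    proof (cases "v \<in> pu_vars C")
      case True
      then show ?thesis using P U_int U_axis U_origin by (cases v rule: pu_var_cases) auto
    next
      case False
      then show ?thesis using supp by (metis in_keys_iff subsetD)
    qed
  qed
qed

lemma param_ideal_standard_zero:
  assumes f: "f \<in> param_ideal" and std: "\<And>m. m \<in> supp f \<Longrightarrow> standard m"
  shows "f = 0"
proof -
  have fc: "f \<in> carrier (pu_ring C)" using f by (simp add: param_ideal_def vanishing_polys_def)
  note suppf = supp_carrier[OF fc]
  \<comment> \<open>All digits of monomials of \<open>f\<close> are at most the sum, hence smaller
    than \<open>b\<close>. The summand 3 is for \<open>W2\<close>, where two powers of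
    \<open>b\<close> must stay below the next higher power.\<close>
  define b where "b = 3 + (\<Sum>m\<in>supp f. \<Sum>v\<in>pu_vars C. lkp m v)"
  define M where "M = Suc (\<Sum>k<q. D k)"
  obtain h :: "'c \<Rightarrow> nat" where h: "inj_on h C"
    using finite_C finite_imp_inj_to_nat_seg by blast
  \<comment> \<open>The pair \<open>(k, r)\<close> is encoded in base \<open>M\<close>, shifted by 2
    to leave room for \<open>Nu\<close> and \<open>Lam\<close>. Interior cells come after everything
    else, so that their weights dominate.\<close>
  define idx where "idx = (\<lambda>\<pi>. case \<pi> of Nu \<Rightarrow> 0 | Lam \<Rightarrow> 1 | Al k r \<Rightarrow> 2 + (k * M + r) | Inner s \<Rightarrow> 2 + q * M + h s)"
  define W where "W = (\<lambda>\<pi>. b ^ idx \<pi>)"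
  have r_less: "r < M" if "(k, r) \<in> axes" for k r
  proof -
    have "D k \<le> (\<Sum>k<q. D k)" using that by (intro member_le_sum) (auto simp: axes_def)
    then show ?thesis using that by (auto simp: axes_def M_def)
  qed
  have Al_less: "k * M + r < q * M" if "(k, r) \<in> axes" for k r
  proof -
    have "k * M + r < k * M + M" using r_less[OF that] by simp
    also have "\<dots> = Suc k * M" by simp
    also have "\<dots> \<le> q * M" using that by (intro mult_right_mono) (auto simp: axes_def)
    finally show ?thesis .
  qed
  have Al_inj: "k = k' \<and> r = r'" if "(k, r) \<in> axes" "(k', r') \<in> axes" "k * M + r = k' * M + r'" for k r k' r'
  proof -
    have "(k * M + r) div M = k" "(k' * M + r') div M = k'"
      using r_less[OF that(1)] r_less[OF that(2)] by simp_all
    then show ?thesis using that(3) by simp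
  qed
  have h_inj: "s = s'" if "h s = h s'" "s \<in> interior_cells" "s' \<in> interior_cells" for s s'
    using h that interior_cells_subset by (auto dest: inj_onD)
  have "inj_on idx params"
  proof (rule inj_onI)
    fix x y assume "x \<in> params" "y \<in> params" "idx x = idx y"
    then show "x = y"
      by (auto simp: params_def idx_def dest: Al_inj Al_less h_inj)
  qed
  have b3: "3 \<le> b" by (simp add: b_def)
  have W2: "W Lam + W (Al k r) < W (Inner s)" if "(k, r) \<in> axes" for k r s
  proof -
    have "W Lam \<le> W (Al k r)" unfolding W_def using b3 by (intro power_increasing) (auto simp: idx_def)
    moreover have "0 < W (Al k r)" using b3 by (simp add: W_def)
    ultimately have "W Lam + W (Al k r) < 3 * W (Al k r)" by linarith
    also have "\<dots> \<le> b * W (Al k r)" using b3 by simp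
    also have "\<dots> = b ^ Suc (idx (Al k r))" by (simp add: W_def)
    also have "\<dots> \<le> W (Inner s)"
      unfolding W_def using b3 Al_less[OF that] by (intro power_increasing) (auto simp: idx_def)
    finally show ?thesis .
  qed
  have W3: "W Lam < W (Inner s)" for s
    unfolding W_def using b3 by (intro power_strict_increasing) (auto simp: idx_def)
  define c where "c = param (monom 1 (W Nu)) (monom 1 (W Lam)) (\<lambda>k r. monom 1 (W (Al k r))) (\<lambda>s. monom 1 (W (Inner s)) :: complex poly)"
  define e where "e = (\<lambda>m. \<Sum>v\<in>pu_vars C. lkp m v * var_weight W v)"
  show ?thesis
  proof (rule eval_curve_independent)
    fix m assume m: "m \<in> supp f"
    have "eval_monom c m = (\<Prod>v\<in>pu_vars C. c v ^ lkp m v)"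
      by (rule eval_monom_superset[OF finite_pu_vars suppf[OF m]])
    moreover have "low_monic \<dots> (e m)"
      unfolding e_def c_def
      by (intro low_monic_prod[OF finite_pu_vars] low_monic_power low_monic_param W2 W3)
        (use b3 in \<open>auto simp: W_def\<close>)
    ultimately show "low_monic (eval_monom c m) (e m)" by simp
  next
    show "inj_on e (supp f)"
    proof (rule inj_onI)
      fix m m' assume m: "m \<in> supp f" and m': "m' \<in> supp f" and eq: "e m = e m'"
      have dig: "digit m \<pi> < b" if "m \<in> supp f" "\<pi> \<in> params" for m \<pi>
      proof -
        have "digit m \<pi> \<le> (\<Sum>v\<in>pu_vars C. lkp m v)"
          unfolding digit_def by (rule sum_mono2) (use finite_pu_vars param_vars_subset[OF that(2)] in auto)
        also have "\<dots> \<le> (\<Sum>m\<in>supp f. \<Sum>v\<in>pu_vars C. lkp m v)"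
          using that(1) by (intro member_le_sum) auto
        finally show ?thesis by (simp add: b_def)
      qed
      have "digit m \<pi> = digit m' \<pi>" if "\<pi> \<in> params" for \<pi>
        by (rule base_expansion_unique_indexed[OF finite_params \<open>inj_on idx params\<close> _ _ _ that, where b = b])
          (use dig m m' eq in \<open>auto simp: e_def sum_var_weight W_def\<close>)
      then show "m = m'"
        using standard_digits_unique std m m' suppf by blast
    qed
  next
    show "eval_curve c f = 0"
    proof (rule eval_curve_eqI)
      fix z
      have "(\<lambda>v. poly (c v) z) \<in> param_points"
        unfolding c_def poly_param param_points_def by blast
      then show "eval_mpoly (\<lambda>v. poly (c v) z) f = poly 0 z"
        using f by (simp add: param_ideal_def vanishing_polys_def)
    qed
  qed
qed

end

section \<open>The minors form a Groebner basis\<close>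

lemma divisible_by_two_vars:
  fixes m :: "'v \<Rightarrow>\<^sub>0 nat"
  assumes "v \<noteq> w" "0 < lkp m v" "0 < lkp m w"
  shows "\<exists>n. m = n + (Poly_Mapping.single v 1 + Poly_Mapping.single w 1)"
proof (intro exI poly_mapping_eqI)
  fix x
  show "lkp m x = lkp ((m - (Poly_Mapping.single v 1 + Poly_Mapping.single w 1))
    + (Poly_Mapping.single v 1 + Poly_Mapping.single w 1)) x"
    using assms by (auto simp: lookup_add lookup_minus lookup_single when_def)
qed

lemma Var_mult: "Var v * Var w = Poly_Mapping.single (Poly_Mapping.single v 1 + Poly_Mapping.single w 1) 1"
  by (simp add: Var_def mult_single)

context table
begin

lemma prefix_less_irrefl: "\<not> prefix_less k s s"
  by (simp add: prefix_less_def)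

lemma prefix_less_asym: "prefix_less k s s' \<Longrightarrow> \<not> prefix_less k s' s"
  using prefix_less_eq_trans prefix_less_irrefl by blast

lemma prefix_lessI:
  "l < k \<Longrightarrow> co s l < co s' l \<Longrightarrow> (\<And>j. j < l \<Longrightarrow> co s j = co s' j) \<Longrightarrow> prefix_less k s s'"
  unfolding prefix_less_def by blast

text \<open>The axis cell is 0 in all coordinates other than \<open>k\<close>, so nothing in its
  slice precedes it. Hence its u variable is the largest one of the marginal sum.\<close>

lemma prefix_less_axis:
  assumes k: "(k, r) \<in> axes" and x: "x \<in> C" "co x k = r" "x \<noteq> axis k r"
  shows "prefix_less q (axis k r) x"
proof -
  have kr: "k < q" "r < D k" using k by (auto simp: axes_def)
  note ax = axis[OF kr(2)]
  have "\<not> prefix_eq q (axis k r) x"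
    using x(3) co_inj[OF ax(1) x(1)] unfolding prefix_eq_def by blast
  moreover have "\<not> prefix_less q x (axis k r)"
  proof
    assume "prefix_less q x (axis k r)"
    then obtain l where "l < q" "co x l < co (axis k r) l" unfolding prefix_less_def by blast
    then show False using ax(2)[of l] x(2) by (auto split: if_splits)
  qed
  ultimately show ?thesis using prefix_trichotomy by blast
qed

end

text \<open>The generators are only bounded from both sides: all are minors, and those with
  increasing rows and columns occur. This keeps matrix indices out of the Groebner basis
  argument.\<close>

locale ordered_table = table C q D co for C :: "'c set" and q D co +
  fixes ss :: "'c list" and G :: "'c pu_var mpoly set"
  assumes set_ss: "set ss = C" and sorted_ss: "sorted_wrt (prefix_less q) ss"
    and G_minor: "\<And>g. g \<in> G \<Longrightarrow> (\<exists>k<q. \<exists>s\<in>C. \<exists>s'\<in>C. g = p_minor k s s') \<or>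
      (\<exists>k<q. \<exists>s\<in>C. \<exists>r<D k. g = u_minor k s r)"
    and p_minor_G: "\<And>k s s'. k < q \<Longrightarrow> s \<in> C \<Longrightarrow> s' \<in> C \<Longrightarrow> co s k < co s' k \<Longrightarrow>
      rest_less k s s' \<Longrightarrow> p_minor k s s' \<in> G"
    and u_minor_G: "\<And>k s r. k < q \<Longrightarrow> s \<in> C \<Longrightarrow> co s k < r \<Longrightarrow> r < D k \<Longrightarrow> u_minor k s r \<in> G"
begin

definition vars :: "'c pu_var list" where "vars = map Pvar ss @ map Uvar ss"

lemma set_vars: "set vars = pu_vars C" by (simp add: vars_def pu_vars_def set_ss)

lemma less_by_Pvar:
  assumes s: "s \<in> C" and eq: "\<And>x. prefix_less q x s \<Longrightarrow> lkp m (Pvar x) = lkp m' (Pvar x)"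
    and less: "lkp m (Pvar s) < lkp m' (Pvar s)"
  shows "(m, m') \<in> lex_term_order vars"
proof -
  obtain xs ys where ss: "ss = xs @ s # ys" using s set_ss by (metis split_list)
  then have "prefix_less q x s" if "x \<in> set xs" for x
    using sorted_ss that by (auto simp: sorted_wrt_append)
  moreover have "vars = map Pvar xs @ Pvar s # map Pvar ys @ map Uvar ss"
    unfolding vars_def by (simp add: ss)
  ultimately show ?thesis
    using eq less by (intro lex_term_orderI[of vars "map Pvar xs" "Pvar s"]) auto
qed

lemma less_by_Uvar:
  assumes s: "s \<in> C" and P: "\<And>x. lkp m (Pvar x) = lkp m' (Pvar x)"
    and eq: "\<And>x. prefix_less q x s \<Longrightarrow> lkp m (Uvar x) = lkp m' (Uvar x)"
    and less: "lkp m (Uvar s) < lkp m' (Uvar s)"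
  shows "(m, m') \<in> lex_term_order vars"
proof -
  obtain xs ys where ss: "ss = xs @ s # ys" using s set_ss by (metis split_list)
  then have "prefix_less q x s" if "x \<in> set xs" for x
    using sorted_ss that by (auto simp: sorted_wrt_append)
  moreover have "vars = (map Pvar ss @ map Uvar xs) @ Uvar s # map Uvar ys"
    unfolding vars_def by (simp add: ss)
  ultimately show ?thesis
    using P eq less by (intro lex_term_orderI[of vars "map Pvar ss @ map Uvar xs" "Uvar s"]) auto
qed

text \<open>The cell \<open>s\<close> precedes the other three corners, so \<open>Pvar s\<close> is
  the largest variable involved, and it occurs in only one of the two products.\<close>

lemma lead_p_minor:
  assumes k: "k < q" and s: "s \<in> C" "s' \<in> C" and less: "co s k < co s' k" and rest: "rest_less k s s'"
  shows "p_minor k s s' \<noteq> 0"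
    and "lead_monomial (lex_term_order vars) (p_minor k s s')
      = Poly_Mapping.single (Pvar s) 1 + Poly_Mapping.single (Pvar s') 1"
proof -
  define t where "t = upd s k (co s' k)"
  define t' where "t' = upd s' k (co s k)"
  have r: "co s k < D k" "co s' k < D k" using k s co_less by auto
  have co_t: "co t l = (if l = k then co s' k else co s l)" if "l < q" for l
    unfolding t_def by (rule upd(2)[OF s(1) r(2) that])
  have co_t': "co t' l = (if l = k then co s k else co s' l)" if "l < q" for l
    unfolding t'_def by (rule upd(2)[OF s(2) r(1) that])
  obtain l where l: "l < q" "l \<noteq> k" "co s l < co s' l" "\<And>j. j < l \<Longrightarrow> j \<noteq> k \<Longrightarrow> co s j = co s' j"
    using rest unfolding rest_less_def by blast
  have st: "prefix_less q s t"
    by (rule prefix_lessI[OF k]) (use co_t k less in auto)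
  have st': "prefix_less q s t'"
    by (rule prefix_lessI[OF l(1)]) (use co_t' l in auto)
  have ss': "prefix_less q s s'"
  proof (cases "k < l")
    case True
    then show ?thesis by (intro prefix_lessI[OF k less] l(4)) auto
  next
    case False
    then show ?thesis by (intro prefix_lessI[OF l(1,3)] l(4)) (use l(2) in auto)
  qed
  define M where "M = Poly_Mapping.single (Pvar s) 1 + Poly_Mapping.single (Pvar s') (1::nat)"
  define M' where "M' = Poly_Mapping.single (Pvar t) 1 + Poly_Mapping.single (Pvar t') (1::nat)"
  have g: "p_minor k s s' = Poly_Mapping.single M 1 - Poly_Mapping.single M' 1"
    by (simp add: p_minor_def Var_mult M_def M'_def t_def t'_def)
  have neq: "s \<noteq> t" "s \<noteq> t'" using st st' prefix_less_irrefl by auto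
  have ord: "(M', M) \<in> lex_term_order vars"
  proof (rule less_by_Pvar[OF s(1)])
    fix x assume x: "prefix_less q x s"
    then have "x \<noteq> s" "x \<noteq> s'" "x \<noteq> t" "x \<noteq> t'"
      using prefix_less_asym[OF x] prefix_less_irrefl st st' ss' by auto
    then show "lkp M' (Pvar x) = lkp M (Pvar x)"
      by (simp add: M_def M'_def lookup_add lookup_single when_def)
  next
    show "lkp M' (Pvar s) < lkp M (Pvar s)"
      using neq by (simp add: M_def M'_def lookup_add lookup_single when_def)
  qed
  then have "M \<noteq> M'" using lex_term_order_irrefl by blast
  then have M: "M \<in> supp (p_minor k s s')"
    by (simp add: g in_keys_iff lookup_minus lookup_single when_def)
  then show "p_minor k s s' \<noteq> 0" by auto
  have "lead_monomial (lex_term_order vars) (p_minor k s s') = M"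
  proof (rule lead_monomialI[OF M])
    fix m assume "m \<in> supp (p_minor k s s')" "m \<noteq> M"
    then have "m = M'" by (auto simp: g in_keys_iff lookup_minus lookup_single when_def split: if_splits)
    then show "(m, M) \<in> lex_term_order vars" using ord by simp
  qed
  then show "lead_monomial (lex_term_order vars) (p_minor k s s')
      = Poly_Mapping.single (Pvar s) 1 + Poly_Mapping.single (Pvar s') 1" by (simp only: M_def)
qed

text \<open>Since \<open>s\<close> precedes \<open>upd s k r\<close>, the terms containing
  \<open>Pvar s\<close> are larger than the others. Among them the u variable decides, and the axis
  cell is the first of its slice.\<close>

lemma lead_u_minor:
  assumes k: "k < q" and s: "s \<in> C" and less: "co s k < r" and r: "r < D k"
  shows "u_minor k s r \<noteq> 0"
    and "lead_monomial (lex_term_order vars) (u_minor k s r)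
      = Poly_Mapping.single (Pvar s) 1 + Poly_Mapping.single (Uvar (axis k r)) 1"
proof -
  have ax: "(k, r) \<in> axes" using k less r by (auto simp: axes_def)
  note axC = axis[OF r]
  define t where "t = upd s k r"
  have st: "prefix_less q s t"
    unfolding t_def by (rule prefix_lessI[OF k]) (use upd(2)[OF s r] k less in auto)
  define mon where "mon = (\<lambda>(p::'c) (x::'c). Poly_Mapping.single (Pvar p) 1 + Poly_Mapping.single (Uvar x) (1::nat))"
  have mon_eq: "mon p x = mon p' x' \<longleftrightarrow> p = p' \<and> x = x'" for p x p' x'
  proof
    assume eq: "mon p x = mon p' x'"
    have "lkp (mon p x) (Pvar p) \<noteq> 0" "lkp (mon p x) (Uvar x) \<noteq> 0"
      by (simp_all add: mon_def lookup_add lookup_single)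
    then show "p = p' \<and> x = x'"
      unfolding eq by (auto simp: mon_def lookup_add lookup_single when_def split: if_splits)
  qed simp
  define M where "M = mon s (axis k r)"
  let ?X = "\<lambda>j. {x \<in> C. co x k = j}"
  have g: "u_minor k s r = (\<Sum>x\<in>?X r. Poly_Mapping.single (mon s x) 1)
      - (\<Sum>x\<in>?X (co s k). Poly_Mapping.single (mon t x) 1)"
    by (simp add: u_minor_def u_marginal_def sum_distrib_left Var_mult mon_def t_def)
  have fin: "finite (?X j)" for j using finite_C by auto
  have neq: "s \<noteq> t" using st prefix_less_irrefl by auto
  have lk: "lkp (u_minor k s r) m = (\<Sum>x\<in>?X r. if mon s x = m then 1 else 0)
      - (\<Sum>x\<in>?X (co s k). if mon t x = m then 1 else 0)" for m
    by (simp add: g lookup_minus lookup_sum lookup_single when_def)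
  have "lkp (u_minor k s r) M = 1"
    unfolding lk M_def mon_eq using neq fin axC k by simp
  then have M: "M \<in> supp (u_minor k s r)" by (simp add: in_keys_iff)
  then show "u_minor k s r \<noteq> 0" by auto
  have "lead_monomial (lex_term_order vars) (u_minor k s r) = M"
  proof (rule lead_monomialI[OF M])
    fix m assume m: "m \<in> supp (u_minor k s r)" "m \<noteq> M"
    have "(\<exists>x\<in>?X r. m = mon s x) \<or> (\<exists>x\<in>?X (co s k). m = mon t x)"
    proof (rule ccontr)
      assume "\<not> ?thesis"
      then have "(\<Sum>x\<in>?X r. if mon s x = m then 1 else 0 :: complex) = 0"
        "(\<Sum>x\<in>?X (co s k). if mon t x = m then 1 else 0 :: complex) = 0"
        by (auto intro!: sum.neutral)
      then have "lkp (u_minor k s r) m = 0" unfolding lk by simp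
      then show False using m(1) by (simp add: in_keys_iff)
    qed
    then show "(m, M) \<in> lex_term_order vars"
    proof (elim disjE bexE)
      fix x assume x: "x \<in> ?X r" "m = mon s x"
      then have "x \<noteq> axis k r" using m(2) by (auto simp: M_def)
      then have less: "prefix_less q (axis k r) x" using prefix_less_axis[OF ax] x(1) by auto
      show ?thesis
      proof (rule less_by_Uvar[OF axC(1)])
        fix y assume y: "prefix_less q y (axis k r)"
        then have "y \<noteq> axis k r" "y \<noteq> x" using prefix_less_irrefl prefix_less_asym[OF y] less by auto
        then show "lkp m (Uvar y) = lkp M (Uvar y)"
          by (simp add: x(2) M_def mon_def lookup_add lookup_single when_def)
      qed (use \<open>x \<noteq> axis k r\<close> in \<open>simp_all add: x(2) M_def mon_def lookup_add lookup_single when_def\<close>)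
    next
      fix x assume x: "x \<in> ?X (co s k)" "m = mon t x"
      show ?thesis
      proof (rule less_by_Pvar[OF s])
        fix y assume y: "prefix_less q y s"
        then have "y \<noteq> s" "y \<noteq> t" using prefix_less_irrefl prefix_less_asym[OF y] st by auto
        then show "lkp m (Pvar y) = lkp M (Pvar y)"
          by (simp add: x(2) M_def mon_def lookup_add lookup_single when_def)
      qed (use neq in \<open>simp_all add: x(2) M_def mon_def lookup_add lookup_single when_def\<close>)
    qed
  qed
  then show "lead_monomial (lex_term_order vars) (u_minor k s r)
      = Poly_Mapping.single (Pvar s) 1 + Poly_Mapping.single (Uvar (axis k r)) 1"
    by (simp only: M_def mon_def)
qed

lemma G_subset: "G \<subseteq> param_ideal"
  using G_minor p_minor_in_param_ideal u_minor_in_param_ideal by fast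

lemma finite_G: "finite G"
proof (rule finite_subset)
  show "G \<subseteq> (\<lambda>(k, s, s'). p_minor k s s') ` ({..<q} \<times> C \<times> C) \<union>
      (\<lambda>(k, s, r). u_minor k s r) ` (SIGMA k:{..<q}. C \<times> {..<D k})"
  proof
    fix g assume "g \<in> G"
    from G_minor[OF this] show "g \<in> (\<lambda>(k, s, s'). p_minor k s s') ` ({..<q} \<times> C \<times> C) \<union>
      (\<lambda>(k, s, r). u_minor k s r) ` (SIGMA k:{..<q}. C \<times> {..<D k})"
      by (force simp: image_iff)
  qed
qed (use finite_C in auto)

lemma not_lead_imp_standard:
  assumes "\<And>g n. g \<in> G \<Longrightarrow> g \<noteq> 0 \<Longrightarrow> m \<noteq> n + lead_monomial (lex_term_order vars) g"
  shows "standard m"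
  unfolding standard_def chain_weight_def
proof (intro conjI ballI allI impI)
  fix s s' k assume *: "s \<in> C" "s' \<in> C" "k < q" "0 < lkp m (Pvar s)" "0 < lkp m (Pvar s')" "rest_less k s s'"
  show "co s' k \<le> co s k"
  proof (rule ccontr)
    assume "\<not> co s' k \<le> co s k"
    then have less: "co s k < co s' k" by simp
    then have "Pvar s \<noteq> Pvar s'" by auto
    from divisible_by_two_vars[OF this *(4,5)] show False
      using assms[OF p_minor_G[OF *(3,1,2) less *(6)]] lead_p_minor[OF *(3,1,2) less *(6)] by auto
  qed
next
  fix s k r assume *: "s \<in> C" "(k, r) \<in> axes" "0 < lkp m (Pvar s)" "0 < lkp m (Uvar (axis k r))"
  have k: "k < q" "r < D k" using *(2) by (auto simp: axes_def)
  show "r \<le> co s k"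
  proof (rule ccontr)
    assume "\<not> r \<le> co s k"
    then have less: "co s k < r" by simp
    have "Pvar s \<noteq> Uvar (axis k r)" by simp
    from divisible_by_two_vars[OF this *(3,4)] show False
      using assms[OF u_minor_G[OF k(1) *(1) less k(2)]] lead_u_minor[OF k(1) *(1) less k(2)] by auto
  qed
qed

theorem groebner_minors:
  "Idl\<^bsub>pu_ring C\<^esub> G = param_ideal"
  "groebner_basis (pu_vars C) (lex_term_order vars) G param_ideal"
proof -
  have J: "ideal param_ideal (mpoly_ring (set vars))"
    unfolding set_vars param_ideal_def by (rule ideal_vanishing_polys)
  have std: "f = 0" if "f \<in> param_ideal"
    "\<And>m g n. m \<in> supp f \<Longrightarrow> g \<in> G \<Longrightarrow> g \<noteq> 0 \<Longrightarrow> m \<noteq> n + lead_monomial (lex_term_order vars) g" for f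
    by (rule param_ideal_standard_zero[OF that(1)]) (rule not_lead_imp_standard, rule that(2))
  show "Idl\<^bsub>pu_ring C\<^esub> G = param_ideal"
    "groebner_basis (pu_vars C) (lex_term_order vars) G param_ideal"
    using groebner_basis_by_standard_monomials[OF J finite_G G_subset std] unfolding set_vars by auto
qed

end

section \<open>The tangent spaces of the model\<close>

lemma sum_fun_apply: "(\<Sum>i\<in>I. F i) x = (\<Sum>i\<in>I. F i x)"
  by (induction I rule: infinite_finite_induct) auto

lemma pderiv_sum: "pderiv (\<Sum>i\<in>I. F i) = (\<Sum>i\<in>I. pderiv (F i))"
  by (induction I rule: infinite_finite_induct) (auto simp: pderiv_add)

lemma pderiv_line_power: "poly (pderiv ([:a, b:] ^ n)) 0 = of_nat n * a ^ (n - 1) * (b :: complex)"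
  by (simp add: pderiv_power pderiv_pCons)

text \<open>The chain rule along a line. It replaces the formal partial derivatives in the
  definition of the tangent space by a univariate derivative at 0.\<close>

lemma pderiv_eval_curve_line:
  assumes "finite C" "f \<in> carrier (mpoly_ring C)"
  shows "poly (pderiv (eval_curve (\<lambda>i. [:p i, v i:]) f)) 0
    = (\<Sum>i\<in>C. eval_mpoly p (partial_deriv i f) * v i)"
proof -
  let ?c = "\<lambda>i. [:p i, v i:]"
  have mono: "poly (pderiv (eval_monom ?c m)) 0
    = (\<Sum>i\<in>C. of_nat (lkp m i) * eval_monom p (m - Poly_Mapping.single i 1) * v i)"
    if "m \<in> supp f" for m
  proof -
    have m: "supp m \<subseteq> C" using supp_carrier[OF assms(2) that] .
    have "poly (pderiv (eval_monom ?c m)) 0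
      = (\<Sum>i\<in>C. (\<Prod>j\<in>C - {i}. p j ^ lkp m j) * (of_nat (lkp m i) * p i ^ (lkp m i - 1) * v i))"
      unfolding eval_monom_superset[OF assms(1) m] pderiv_prod poly_sum poly_mult pderiv_line_power
      by (simp add: poly_prod)
    also have "\<dots> = (\<Sum>i\<in>C. of_nat (lkp m i) * eval_monom p (m - Poly_Mapping.single i 1) * v i)"
    proof (rule sum.cong[OF refl])
      fix i assume i: "i \<in> C"
      have s: "supp (m - Poly_Mapping.single i 1) \<subseteq> C"
        using m by (auto simp: in_keys_iff lookup_minus)
      have "eval_monom p (m - Poly_Mapping.single i 1)
        = p i ^ (lkp m i - 1) * (\<Prod>j\<in>C - {i}. p j ^ lkp (m - Poly_Mapping.single i 1) j)"
        unfolding eval_monom_superset[OF assms(1) s]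
        by (subst prod.remove[OF assms(1) i]) (simp add: lookup_minus)
      also have "(\<Prod>j\<in>C - {i}. p j ^ lkp (m - Poly_Mapping.single i 1) j) = (\<Prod>j\<in>C - {i}. p j ^ lkp m j)"
        by (rule prod.cong) (auto simp: lookup_minus lookup_single when_def)
      finally show "(\<Prod>j\<in>C - {i}. p j ^ lkp m j) * (of_nat (lkp m i) * p i ^ (lkp m i - 1) * v i)
        = of_nat (lkp m i) * eval_monom p (m - Poly_Mapping.single i 1) * v i" by simp
    qed
    finally show ?thesis .
  qed
  have "poly (pderiv (eval_curve ?c f)) 0 = (\<Sum>m\<in>supp f. lkp f m * poly (pderiv (eval_monom ?c m)) 0)"
    by (simp add: eval_curve_def pderiv_sum pderiv_smult poly_sum)
  also have "\<dots> = (\<Sum>m\<in>supp f. \<Sum>i\<in>C. lkp f m * (of_nat (lkp m i) * eval_monom p (m - Poly_Mapping.single i 1) * v i))"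
    by (simp add: mono sum_distrib_left)
  also have "\<dots> = (\<Sum>i\<in>C. \<Sum>m\<in>supp f. lkp f m * (of_nat (lkp m i) * eval_monom p (m - Poly_Mapping.single i 1) * v i))"
    by (rule sum.swap)
  also have "\<dots> = (\<Sum>i\<in>C. eval_mpoly p (partial_deriv i f) * v i)"
    by (simp add: partial_deriv_def sum_distrib_left sum_distrib_right mult_ac)
  finally show ?thesis .
qed

text \<open>Evaluation at the test point \<open>y j\<close> isolates the coefficient of
  \<open>e j\<close>.\<close>

lemma cfun_independent_diagonal:
  fixes e :: "'j \<Rightarrow> 'i \<Rightarrow> complex"
  assumes "finite I" and diag: "\<And>i. i \<in> I \<Longrightarrow> e i (y i) \<noteq> 0"
    and off: "\<And>i j. i \<in> I \<Longrightarrow> j \<in> I \<Longrightarrow> i \<noteq> j \<Longrightarrow> e i (y j) = 0"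
  shows "cfun.independent (e ` I)" "inj_on e I"
proof -
  show inj: "inj_on e I"
    by (rule inj_onI) (metis diag off)
  show "cfun.independent (e ` I)"
  proof (rule cfun.independent_if_scalars_zero)
    fix f x assume sum0: "(\<Sum>x\<in>e ` I. (\<lambda>i. f x * x i)) = 0" and "x \<in> e ` I"
    then obtain j where j: "j \<in> I" "x = e j" by auto
    have "0 = (\<Sum>x\<in>e ` I. (\<lambda>i. f x * x i)) (y j)" unfolding sum0 by simp
    also have "\<dots> = (\<Sum>i\<in>I. f (e i) * e i (y j))"
      by (simp add: sum_fun_apply sum.reindex[OF inj])
    also have "\<dots> = f (e j) * e j (y j)"
      by (subst sum.remove[OF assms(1) j(1)]) (use off j in auto)
    finally show "f x = 0" using diag[OF j(1)] j(2) by simp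
  qed (use assms(1) in simp)
qed

text \<open>The space of all functions may be infinite-dimensional. The common finite support puts
  \<open>V\<close> into the span of finitely many unit vectors, so a basis of \<open>V\<close> is
  finite and bounds \<open>B\<close>.\<close>

lemma cfun_card_le_dim:
  fixes B V :: "('i \<Rightarrow> complex) set"
  assumes "finite C" and V: "\<And>v i. v \<in> V \<Longrightarrow> i \<notin> C \<Longrightarrow> v i = 0"
    and B: "cfun.independent B" "B \<subseteq> V"
  shows "card B \<le> cfun.dim V"
proof -
  define unit where "unit = (\<lambda>j i :: 'i. if i = j then 1 else 0 :: complex)"
  have "V \<subseteq> cfun.span (unit ` C)"
  proof
    fix v assume v: "v \<in> V"
    have "v = (\<Sum>j\<in>C. (\<lambda>i. v j * unit j i))"
    proof
      fix i
      have "(\<Sum>j\<in>C. v j * unit j i) = (\<Sum>j\<in>C. if i = j then v j else 0)"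
        by (rule sum.cong) (auto simp: unit_def)
      then show "v i = (\<Sum>j\<in>C. (\<lambda>i. v j * unit j i)) i"
        using V[OF v, of i] assms(1) by (cases "i \<in> C") (auto simp: sum_fun_apply)
    qed
    also have "\<dots> \<in> cfun.span (unit ` C)"
      by (intro cfun.span_sum cfun.span_scale cfun.span_base) auto
    finally show "v \<in> cfun.span (unit ` C)" .
  qed
  moreover obtain A where A: "A \<subseteq> V" "cfun.independent A" "V \<subseteq> cfun.span A" "card A = cfun.dim V"
    by (rule cfun.basis_exists)
  ultimately have "finite A"
    using cfun.independent_span_bound[of "unit ` C" A] assms(1) by auto
  then show ?thesis
    using cfun.independent_span_bound[of A B] A B by auto
qed

context table
begin

definition model :: "('c \<Rightarrow> complex) set" where
  "model = {p \<in> proj_points C. \<exists>a :: nat \<Rightarrow> nat \<Rightarrow> complex. \<forall>s\<in>C. p s = (\<Prod>k<q. a k (co s k))}"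

lemma sum_cells_prod:
  fixes g :: "nat \<Rightarrow> nat \<Rightarrow> 'a::comm_semiring_1"
  shows "(\<Sum>s\<in>C. \<Prod>k<q. g k (co s k)) = (\<Prod>k<q. \<Sum>r<D k. g k r)"
proof -
  have "bij_betw (\<lambda>s. restrict (co s) {..<q}) C (PiE {..<q} (\<lambda>k. {..<D k}))"
  proof (rule bij_betwI')
    fix s s' assume s: "s \<in> C" "s' \<in> C"
    show "restrict (co s) {..<q} = restrict (co s') {..<q} \<longleftrightarrow> s = s'"
    proof
      assume eq: "restrict (co s) {..<q} = restrict (co s') {..<q}"
      show "s = s'"
      proof (rule co_inj[OF s])
        fix k assume "k < q"
        then show "co s k = co s' k" using fun_cong[OF eq, of k] by simp
      qed
    qed simp
  next
    fix s assume "s \<in> C"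
    then show "restrict (co s) {..<q} \<in> PiE {..<q} (\<lambda>k. {..<D k})" using co_less by auto
  next
    fix t assume t: "t \<in> PiE {..<q} (\<lambda>k. {..<D k})"
    have *: "t k < D k" if "k < q" for k using t that by auto
    show "\<exists>s\<in>C. t = restrict (co s) {..<q}"
    proof (rule bexI[of _ "cell t"])
      show "t = restrict (co (cell t)) {..<q}"
        using t cell(2)[OF *] by (auto simp: fun_eq_iff PiE_def extensional_def)
    qed (rule cell(1)[OF *])
  qed
  from sum.reindex_bij_betw[OF this, of "\<lambda>t. \<Prod>k<q. g k (t k)"]
  have "(\<Sum>s\<in>C. \<Prod>k<q. g k (co s k)) = (\<Sum>t\<in>PiE {..<q} (\<lambda>k. {..<D k}). \<Prod>k<q. g k (t k))"
    by simp
  also have "\<dots> = (\<Prod>k<q. \<Sum>r<D k. g k r)"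
    by (rule prod_sum_PiE[symmetric]) auto
  finally show ?thesis .
qed

lemma sum_slice_prod:
  fixes g :: "nat \<Rightarrow> nat \<Rightarrow> 'a::comm_semiring_1"
  assumes "k < q" "r < D k"
  shows "(\<Sum>s | s \<in> C \<and> co s k = r. \<Prod>l<q. g l (co s l)) = g k r * (\<Prod>l\<in>{..<q} - {k}. \<Sum>j<D l. g l j)"
proof -
  \<comment> \<open>Cutting the \<open>k\<close>-th factor off outside \<open>r\<close> turns the
    sum over a slice into a sum over all cells, where the distributive law applies.\<close>
  define g' where "g' = g(k := \<lambda>j. if j = r then g k r else 0)"
  have split: "(\<Prod>l<q. g' l (co s l)) = (if co s k = r then \<Prod>l<q. g l (co s l) else 0)" for s
  proof -
    have "(\<Prod>l\<in>{..<q} - {k}. g' l (co s l)) = (\<Prod>l\<in>{..<q} - {k}. g l (co s l))"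
      by (rule prod.cong) (auto simp: g'_def)
    then show ?thesis by (simp add: prod_cell[OF assms(1)]) (simp add: g'_def)
  qed
  have "(\<Sum>s | s \<in> C \<and> co s k = r. \<Prod>l<q. g l (co s l)) = (\<Sum>s\<in>C. \<Prod>l<q. g' l (co s l))"
    unfolding split by (simp add: sum.If_cases[OF finite_C] Int_def)
  also have "\<dots> = (\<Sum>j<D k. g' k j) * (\<Prod>l\<in>{..<q} - {k}. \<Sum>j<D l. g' l j)"
    unfolding sum_cells_prod by (rule prod.remove) (use assms in auto)
  also have "(\<Sum>j<D k. g' k j) = g k r" using assms(2) by (simp add: g'_def)
  also have "(\<Prod>l\<in>{..<q} - {k}. \<Sum>j<D l. g' l j) = (\<Prod>l\<in>{..<q} - {k}. \<Sum>j<D l. g l j)"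
    by (rule prod.cong) (auto simp: g'_def)
  finally show ?thesis .
qed

abbreviation tangent :: "('c \<Rightarrow> complex) \<Rightarrow> ('c \<Rightarrow> complex) set" where
  "tangent \<equiv> cone_tangent_space C model"

text \<open>The velocity of a rank one table when its \<open>k\<close>-th factor moves in the
  direction \<open>b\<close> and the other factors stay fixed.\<close>

definition direction :: "(nat \<Rightarrow> nat \<Rightarrow> complex) \<Rightarrow> nat \<Rightarrow> (nat \<Rightarrow> complex) \<Rightarrow> 'c \<Rightarrow> complex" where
  "direction a k b s = (if s \<in> C then b (co s k) * (\<Prod>l\<in>{..<q} - {k}. a l (co s l)) else 0)"

lemma direction_in_tangent:
  assumes p: "p \<in> model" and a: "\<And>s. s \<in> C \<Longrightarrow> p s = (\<Prod>k<q. a k (co s k))" and k: "k < q"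
  shows "direction a k b \<in> tangent p"
proof -
  let ?w = "direction a k b"
  have w0: "?w i = 0" if "i \<notin> C" for i using that by (simp add: direction_def)
  have "(\<Sum>i\<in>C. eval_mpoly p (partial_deriv i f) * ?w i) = 0" if f: "f \<in> vanishing_forms C model" for f
  proof -
    have fc: "f \<in> carrier (mpoly_ring C)" using f by (simp add: vanishing_forms_def)
    define F where "F = eval_curve (\<lambda>i. [:p i, ?w i:]) f"
    obtain r where r: "p r \<noteq> 0" using p by (auto simp: model_def proj_points_def fun_eq_iff)
    \<comment> \<open>The line through \<open>p\<close> stays in the model except where it meets the
      zero vector, which is not a projective point. The linear factor, nonzero because
      \<open>p r \<noteq> 0\<close>, absorbs such a parameter.\<close>
    have "poly (F * [:p r, ?w r:]) z = 0" for z
    proof (cases "p r + z * ?w r = 0")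
      case False
      define p' where "p' = (\<lambda>i. p i + z * ?w i)"
      define a' where "a' = a(k := \<lambda>j. a k j + z * b j)"
      have "p' s = (\<Prod>l<q. a' l (co s l))" if "s \<in> C" for s
      proof -
        have "(\<Prod>l\<in>{..<q} - {k}. a' l (co s l)) = (\<Prod>l\<in>{..<q} - {k}. a l (co s l))"
          by (rule prod.cong) (auto simp: a'_def)
        moreover have "a' k (co s k) = a k (co s k) + z * b (co s k)" by (simp add: a'_def)
        ultimately show ?thesis
          using that prod_cell[OF k, of a' s] prod_cell[OF k, of a s]
          by (simp add: p'_def a direction_def algebra_simps)
      qed
      moreover have "p' \<in> proj_points C"
        using False w0 p by (auto simp: proj_points_def model_def p'_def fun_eq_iff)
      ultimately have "p' \<in> model" unfolding model_def by blast
      then have "eval_mpoly p' f = 0" using f by (simp add: vanishing_forms_def)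
      then show ?thesis by (simp add: F_def poly_eval_curve p'_def mult.commute)
    next
      case True
      then have "poly [:p r, ?w r:] z = 0" by simp
      then show ?thesis by (simp only: poly_mult mult_zero_right)
    qed
    then have "F * [:p r, ?w r:] = 0" using poly_all_0_iff_0 by blast
    moreover have "[:p r, ?w r:] \<noteq> 0" using r by simp
    ultimately have "F = 0" by (simp only: mult_eq_0_iff) simp
    then show ?thesis using pderiv_eval_curve_line[OF finite_C fc, of p ?w] by (simp add: F_def)
  qed
  then show ?thesis using w0 by (simp add: cone_tangent_space_def)
qed

lemma tangent_outside: "v \<in> tangent p \<Longrightarrow> i \<notin> C \<Longrightarrow> v i = 0"
  by (simp add: cone_tangent_space_def)

lemma model_minor:
  assumes p: "p \<in> model" and k: "k < q" and s: "s \<in> C" "s' \<in> C"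
  shows "p s * p s' = p (upd s k (co s' k)) * p (upd s' k (co s k))"
proof -
  obtain a where a: "\<And>s. s \<in> C \<Longrightarrow> p s = (\<Prod>k<q. a k (co s k))"
    using p unfolding model_def by blast
  have r: "co s k < D k" "co s' k < D k" using s k co_less by auto
  show ?thesis
    by (simp add: a s upd(1)[OF s(1) r(2)] upd(1)[OF s(2) r(1)] prod_upd[OF k s(1) r(2)]
        prod_upd[OF k s(2) r(1)] prod_cell[OF k])
qed

lemma tangent_minor:
  assumes v: "v \<in> tangent p" and k: "k < q" and s: "s \<in> C" "s' \<in> C"
  defines "t \<equiv> upd s k (co s' k)" and "t' \<equiv> upd s' k (co s k)"
  shows "v s * p s' + p s * v s' = v t * p t' + p t * v t'"
proof -
  have r: "co s k < D k" "co s' k < D k" using s k co_less by auto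
  have t: "t \<in> C" "t' \<in> C"
    unfolding t_def t'_def by (rule upd(1)[OF s(1) r(2)], rule upd(1)[OF s(2) r(1)])
  define f where "f = Var s * Var s' - Var t * Var t'"
  have fc: "f \<in> carrier (mpoly_ring C)"
    unfolding f_def by (intro mpoly_carrier_closed s t)
  have "homogeneous C f"
  proof -
    have "(\<Sum>i\<in>C. lkp m i) = 2" if "m \<in> supp f" for m
    proof -
      have "m = Poly_Mapping.single s 1 + Poly_Mapping.single s' 1 \<or> m = Poly_Mapping.single t 1 + Poly_Mapping.single t' 1"
        using that by (auto simp: f_def Var_mult in_keys_iff lookup_minus lookup_single when_def split: if_splits)
      then show ?thesis
        using s t finite_C by (auto simp: lookup_add lookup_single when_def sum.distrib)
    qed
    then show ?thesis unfolding homogeneous_def by blast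
  qed
  moreover have "eval_mpoly x f = 0" if "x \<in> model" for x
    using model_minor[OF that k s] by (simp add: f_def t_def t'_def)
  ultimately have "f \<in> vanishing_forms C model" using fc by (simp add: vanishing_forms_def)
  then have "(\<Sum>i\<in>C. eval_mpoly p (partial_deriv i f) * v i) = 0"
    using v by (simp add: cone_tangent_space_def)
  moreover have "eval_curve (\<lambda>i. [:p i, v i:]) f = [:p s, v s:] * [:p s', v s':] - [:p t, v t:] * [:p t', v t':]"
    by (rule eval_curve_eqI) (simp add: f_def algebra_simps)
  ultimately show ?thesis
    using pderiv_eval_curve_line[OF finite_C fc, of p v]
    by (simp add: pderiv_diff pderiv_mult pderiv_pCons algebra_simps)
qed

text \<open>Where no coordinate of \<open>p\<close> vanishes, the differentials of the minors say that \<open>v / p\<close> is an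
  additive function of the coordinates of the cell.\<close>

lemma tangent_torus:
  assumes p: "p \<in> model" and nz: "\<And>s. s \<in> C \<Longrightarrow> p s \<noteq> 0" and v: "v \<in> tangent p" and r: "r \<in> C"
  shows "\<exists>c d. (\<forall>k<q. d k (co r k) = 0) \<and> (\<forall>s\<in>C. v s = p s * (c + (\<Sum>k<q. d k (co s k))))"
proof -
  define w where "w = (\<lambda>s. v s / p s)"
  define d where "d = (\<lambda>k j. w (upd r k j) - w r)"
  \<comment> \<open>Dividing the linearized minor by \<open>p s * p r = p t * p t'\<close> makes it
    the additive relation \<open>w s + w r = w t + w t'\<close>.\<close>
  have w_add: "w s - w (upd s k (co r k)) = d k (co s k)" if k: "k < q" and s: "s \<in> C" for k s
  proof -
    define t where "t = upd s k (co r k)"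
    define t' where "t' = upd r k (co s k)"
    have b: "co s k < D k" "co r k < D k" using s r k co_less by auto
    have t: "t \<in> C" "t' \<in> C"
      unfolding t_def t'_def by (rule upd(1)[OF s b(2)], rule upd(1)[OF r b(1)])
    have pp: "p s * p r = p t * p t'" using model_minor[OF p k s r] by (simp add: t_def t'_def)
    have "v s * p r + p s * v r = v t * p t' + p t * v t'"
      using tangent_minor[OF v k s r] by (simp add: t_def t'_def)
    then have "(v s * p r + p s * v r) / (p s * p r) = (v t * p t' + p t * v t') / (p t * p t')"
      by (simp only: pp)
    then have "w s + w r = w t + w t'"
      using nz[OF s] nz[OF r] nz[OF t(1)] nz[OF t(2)] by (simp add: w_def add_divide_distrib)
    then show ?thesis by (simp add: d_def t_def t'_def algebra_simps)
  qed
  have "w s = w r + (\<Sum>k<q. d k (co s k))" if s: "s \<in> C" for s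
  proof -
    \<comment> \<open>A path from \<open>s\<close> to \<open>r\<close> that replaces one coordinate
      at a time; the differences of \<open>w\<close> along it telescope.\<close>
    define z where "z = (\<lambda>j. cell (\<lambda>k. if k < j then co r k else co s k))"
    have zb: "(if k < j then co r k else co s k) < D k" if "k < q" for k j
      using co_less[OF r that] co_less[OF s that] by simp
    have z: "z j \<in> C" "k < q \<Longrightarrow> co (z j) k = (if k < j then co r k else co s k)" for j k
      unfolding z_def by (rule cell(1)[OF zb], assumption, rule cell(2)[OF zb])
    have "j \<le> q \<Longrightarrow> w s = w (z j) + (\<Sum>k<j. d k (co s k))" for j
    proof (induction j)
      case 0
      have "z 0 = s" by (rule co_inj[OF z(1) s]) (simp add: z(2))
      then show ?case by simp
    next
      case (Suc j)
      then have j: "j < q" by simp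
      have "upd (z j) j (co r j) = z (Suc j)"
      proof (rule co_inj[OF upd(1) z(1)])
        fix k assume k: "k < q"
        show "co (upd (z j) j (co r j)) k = co (z (Suc j)) k"
          unfolding upd(2)[OF z(1) co_less[OF r j] k] z(2)[OF k] by auto
      qed (use z(1) co_less[OF r j] in auto)
      moreover have "co (z j) j = co s j" using z(2)[OF j, of j] by simp
      ultimately have "w (z j) = w (z (Suc j)) + d j (co s j)"
        using w_add[OF j z(1), of j] by (simp add: algebra_simps)
      then show ?case using Suc by simp
    qed
    from this[of q] have "w s = w (z q) + (\<Sum>k<q. d k (co s k))" by simp
    moreover have "z q = r" by (rule co_inj[OF z(1) r]) (simp add: z(2))
    ultimately show ?thesis by simp
  qed
  then have "v s = p s * (w r + (\<Sum>k<q. d k (co s k)))" if "s \<in> C" for s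
    using that nz[OF that] by (metis nonzero_mult_div_cancel_left times_divide_eq_right w_def)
  moreover have "d k (co r k) = 0" if "k < q" for k
  proof -
    have "upd r k (co r k) = r"
    proof (rule co_inj[OF upd(1) r])
      fix l assume "l < q"
      then show "co (upd r k (co r k)) l = co r l" using upd(2)[OF r co_less[OF r that]] by simp
    qed (use r co_less[OF r that] in auto)
    then show ?thesis by (simp add: d_def)
  qed
  ultimately show ?thesis by blast
qed

text \<open>The analogue of \<open>axes\<close> for an arbitrary base cell. At a point with
  vanishing coordinates the base must be a cell where \<open>p\<close> does not vanish, which the
  origin need not be.\<close>

definition off_axes :: "'c \<Rightarrow> (nat \<times> nat) set" where
  "off_axes r = (SIGMA k:{..<q}. {..<D k} - {co r k})"

lemma finite_off_axes: "finite (off_axes r)" by (simp add: off_axes_def)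

lemma card_off_axes: "r \<in> C \<Longrightarrow> card (off_axes r) = (\<Sum>k<q. D k - 1)"
  unfolding off_axes_def using co_less by (simp add: card_SigmaI card_Diff_singleton)

text \<open>By \<open>tangent_torus\<close>, the tangent space is spanned by \<open>p\<close> and
  its restrictions to the slices that avoid the origin.\<close>

lemma dim_tangent_torus_le:
  assumes p: "p \<in> model" and nz: "\<And>s. s \<in> C \<Longrightarrow> p s \<noteq> 0"
  shows "cfun.dim (tangent p) \<le> Suc (\<Sum>k<q. D k - 1)"
proof -
  let ?r = origin
  define e where "e = (\<lambda>(k, j) s. if s \<in> C \<and> co s k = j then p s else 0)"
  have p0: "p i = 0" if "i \<notin> C" for i using p that by (simp add: model_def proj_points_def)
  have "tangent p \<subseteq> cfun.span (insert p (e ` off_axes ?r))"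
  proof
    fix v assume v: "v \<in> tangent p"
    from tangent_torus[OF p nz v origin(1)] obtain c d where
      d: "\<And>k. k < q \<Longrightarrow> d k (co ?r k) = 0" and vd: "\<And>s. s \<in> C \<Longrightarrow> v s = p s * (c + (\<Sum>k<q. d k (co s k)))"
      by blast
    have "v = (\<lambda>i. c * p i) + (\<Sum>x\<in>off_axes ?r. (\<lambda>i. d (fst x) (snd x) * e x i))"
    proof
      fix s
      show "v s = ((\<lambda>i. c * p i) + (\<Sum>x\<in>off_axes ?r. (\<lambda>i. d (fst x) (snd x) * e x i))) s"
      proof (cases "s \<in> C")
        case True
        have "(\<Sum>x\<in>off_axes ?r. d (fst x) (snd x) * e x s)
          = (\<Sum>k<q. \<Sum>j\<in>{..<D k} - {co ?r k}. d k j * (if co s k = j then p s else 0))"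
          unfolding off_axes_def using True by (subst sum.Sigma) (auto simp: e_def case_prod_unfold)
        also have "\<dots> = (\<Sum>k<q. d k (co s k) * p s)"
        proof (rule sum.cong[OF refl])
          fix k assume k: "k \<in> {..<q}"
          show "(\<Sum>j\<in>{..<D k} - {co ?r k}. d k j * (if co s k = j then p s else 0)) = d k (co s k) * p s"
            using k d[of k] co_less[OF True, of k] by (auto simp: if_distrib cong: if_cong)
        qed
        finally show ?thesis
          using vd[OF True] by (simp add: sum_fun_apply algebra_simps sum_distrib_left)
      next
        case False
        then show ?thesis
          using p0 tangent_outside[OF v] by (simp add: sum_fun_apply e_def case_prod_unfold)
      qed
    qed
    also have "\<dots> \<in> cfun.span (insert p (e ` off_axes ?r))"
      by (intro cfun.span_add cfun.span_sum cfun.span_scale cfun.span_base) auto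
    finally show "v \<in> cfun.span (insert p (e ` off_axes ?r))" .
  qed
  then have "cfun.dim (tangent p) \<le> card (insert p (e ` off_axes ?r))"
    by (rule cfun.dim_le_card) (simp add: finite_off_axes)
  also have "\<dots> \<le> Suc (card (e ` off_axes ?r))" by (rule card_insert_le_m1) simp_all
  also have "\<dots> \<le> Suc (card (off_axes ?r))" using card_image_le[OF finite_off_axes] by simp
  finally show ?thesis by (simp only: card_off_axes[OF origin(1)])
qed

text \<open>This covers points with vanishing coordinates too, which makes the dimension at torus
  points minimal. With \<open>p r \<noteq> 0\<close>, varying one factor at one value other than
  that of \<open>r\<close> gives directions that are diagonal on the cells \<open>upd r k j\<close>
  and vanish at \<open>r\<close>; hence \<open>p\<close> is independent of them.\<close>

lemma dim_tangent_ge: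
  assumes p: "p \<in> model" and q: "0 < q"
  shows "Suc (\<Sum>k<q. D k - 1) \<le> cfun.dim (tangent p)"
proof -
  obtain a where a: "\<And>s. s \<in> C \<Longrightarrow> p s = (\<Prod>k<q. a k (co s k))"
    using p unfolding model_def by blast
  obtain r where pr: "p r \<noteq> 0" and r: "r \<in> C"
    using p by (auto simp: model_def proj_points_def fun_eq_iff)
  have anz: "a k (co r k) \<noteq> 0" if "k < q" for k
    using pr a[OF r] that by auto
  define e where "e = (\<lambda>(k, j). direction a k (\<lambda>i. if i = j then 1 else 0))"
  define y where "y = (\<lambda>(k, j). upd r k j)"
  have e_r: "e x r = 0" if "x \<in> off_axes r" for x
  proof -
    obtain k j where x: "x = (k, j)" by fastforce
    then have "j \<noteq> co r k" using that by (simp add: off_axes_def)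
    then show ?thesis by (simp add: x e_def direction_def)
  qed
  have diag: "e x (y x) \<noteq> 0" if x_off: "x \<in> off_axes r" for x
  proof -
    obtain k j where x: "x = (k, j)" "k < q" "j < D k" using x_off by (auto simp: off_axes_def)
    note u = upd[OF r x(3)]
    have "(\<Prod>l\<in>{..<q} - {k}. a l (co (upd r k j) l)) = (\<Prod>l\<in>{..<q} - {k}. a l (co r l))"
      by (rule prod.cong) (auto simp: u(2))
    then show ?thesis
      using anz u(1) u(2)[OF x(2)] by (simp add: x(1) e_def y_def direction_def)
  qed
  have off: "e x (y x') = 0" if x_off: "x \<in> off_axes r" "x' \<in> off_axes r" "x \<noteq> x'" for x x'
  proof -
    obtain k j where x: "x = (k, j)" "k < q" "j < D k" "j \<noteq> co r k" using x_off(1) by (auto simp: off_axes_def)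
    obtain k' j' where x': "x' = (k', j')" "k' < q" "j' < D k'" using x_off(2) by (auto simp: off_axes_def)
    have "co (upd r k' j') k \<noteq> j"
      using upd(2)[OF r x'(3) x(2)] x x' x_off(3) by auto
    then show ?thesis by (simp add: x(1) x'(1) e_def y_def direction_def)
  qed
  note ind = cfun_independent_diagonal[of "off_axes r" e y, OF finite_off_axes diag off]
  have "p \<notin> cfun.span (e ` off_axes r)"
  proof
    assume "p \<in> cfun.span (e ` off_axes r)"
    moreover have "cfun.span (e ` off_axes r) \<subseteq> {x. x r = 0}"
      by (rule cfun.span_minimal) (auto simp: e_r cfun.subspace_def)
    ultimately show False using pr by blast
  qed
  then have "cfun.independent (insert p (e ` off_axes r))" "p \<notin> e ` off_axes r"
    using cfun.independent_insertI[OF _ ind(1)] cfun.span_base by blast+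
  moreover have "p \<in> tangent p"
  proof -
    \<comment> \<open>Scaling a single factor moves \<open>p\<close> along itself; this requires at
      least one factor.\<close>
    have "direction a 0 (a 0) = p"
      using a p by (auto simp: direction_def fun_eq_iff prod_cell[OF q] model_def proj_points_def)
    then show ?thesis using direction_in_tangent[OF p a q, of "a 0"] by simp
  qed
  then have "insert p (e ` off_axes r) \<subseteq> tangent p"
    using direction_in_tangent[OF p a] by (auto simp: e_def off_axes_def)
  ultimately have "card (insert p (e ` off_axes r)) \<le> cfun.dim (tangent p)"
    using tangent_outside by (intro cfun_card_le_dim[OF finite_C]) auto
  then show ?thesis
    using \<open>p \<notin> e ` off_axes r\<close> finite_off_axes by (simp add: card_image[OF ind(2)] card_off_axes[OF r])
qed

lemma torus_smooth:
  assumes "p \<in> model" "\<And>s. s \<in> C \<Longrightarrow> p s \<noteq> 0" "0 < q"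
  shows "p \<in> smooth_locus C model"
  using assms dim_tangent_torus_le[OF assms(1,2)] dim_tangent_ge[OF _ assms(3)]
  unfolding smooth_locus_def by (auto intro: order_trans)

end

section \<open>The likelihood ideal\<close>

context table
begin

definition critical_points :: "(('c \<Rightarrow> complex) \<times> ('c \<Rightarrow> complex)) set" where
  "critical_points = {(p, u) \<in> (smooth_locus C model - arrangement_H C) \<times> proj_points C.
     \<forall>v\<in>tangent p. dlog_likelihood C u p v = 0}"

lemma critical_point_param:
  assumes pu: "(p, u) \<in> critical_points"
  shows "\<exists>x\<in>param_points. \<forall>v\<in>pu_vars C. case_pu_var p u v = x v"
proof -
  have p: "p \<in> model" and pH: "p \<notin> arrangement_H C"
    and dlog: "\<And>v. v \<in> tangent p \<Longrightarrow> dlog_likelihood C u p v = 0"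
    using pu by (auto simp: critical_points_def smooth_locus_def)
  have nz: "p s \<noteq> 0" if "s \<in> C" for s
    using p pH that by (auto simp: arrangement_H_def model_def)
  have sum_nz: "sum p C \<noteq> 0"
    using p pH by (auto simp: arrangement_H_def model_def)
  obtain a where a: "\<And>s. s \<in> C \<Longrightarrow> p s = (\<Prod>k<q. a k (co s k))"
    using p unfolding model_def by blast
  define A where "A = (\<lambda>k. \<Sum>j<D k. a k j)"
  have sum_p: "sum p C = (\<Prod>k<q. A k)"
    unfolding A_def sum_cells_prod[symmetric] by (rule sum.cong) (simp_all add: a)
  then have A: "A k \<noteq> 0" if "k < q" for k using sum_nz that by auto
  \<comment> \<open>Each factor is normalized to sum 1. The sums \<open>A k\<close> are nonzero
    because their product is the sum of the coordinates of \<open>p\<close>.\<close>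
  define al where "al = (\<lambda>k j. a k j / A k)"
  have prob: "prob al k r = al k r" if k: "k < q" and r: "r < D k" for k r
  proof -
    have "(\<Sum>j<D k. al k j) = 1"
      using A[OF k] by (simp add: al_def A_def sum_divide_distrib[symmetric])
    moreover have "{..<D k} = insert 0 {1..<D k}" using D_pos[OF k] by auto
    ultimately show ?thesis by (cases "r = 0") (simp_all add: prob_def diff_eq_eq)
  qed
  define x where "x = param (sum p C) (sum u C) al u"
  have "x (Pvar s) = p s" if s: "s \<in> C" for s
  proof -
    have "(\<Prod>k<q. prob al k (co s k)) = (\<Prod>k<q. a k (co s k) / A k)"
      by (rule prod.cong) (use prob co_less[OF s] in \<open>auto simp: al_def\<close>)
    then show ?thesis
      using sum_nz by (simp add: x_def param_def prod_dividef sum_p a[OF s])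
  qed
  moreover have "x (Uvar s) = u s" if "s \<in> C" for s
    unfolding x_def param_def pu_var.case
  proof (rule param_u_unique[OF _ refl that])
    fix k r assume "(k, r) \<in> axes"
    then have k: "k < q" "r < D k" by (auto simp: axes_def)
    define R where "R = (\<Prod>l\<in>{..<q} - {k}. A l)"
    have pR: "sum p C = A k * R" unfolding sum_p R_def by (rule prod.remove) (use k in auto)
    \<comment> \<open>The test vector is \<open>p\<close> restricted to the slice
      \<open>co s k = r\<close>. On it the one-form becomes the marginal equation for outcome
      \<open>r\<close> of group \<open>k\<close>.\<close>
    define w where "w = direction a k (\<lambda>i. if i = r then a k r else 0)"
    have w: "w s = (if co s k = r then p s else 0)" if "s \<in> C" for s
      using that by (simp add: w_def direction_def a prod_cell[OF k(1)])
    have "0 = dlog_likelihood C u p w"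
      using dlog[OF direction_in_tangent[OF p a k(1)]] by (simp add: w_def)
    also have "\<dots> = (\<Sum>s\<in>C. if co s k = r then u s - sum u C / sum p C * p s else 0)"
      unfolding dlog_likelihood_def by (rule sum.cong) (use w nz in \<open>auto simp: field_simps\<close>)
    also have "\<dots> = (\<Sum>s | s \<in> C \<and> co s k = r. u s) - sum u C / sum p C * (\<Sum>s | s \<in> C \<and> co s k = r. p s)"
      by (simp add: sum.If_cases[OF finite_C] Int_def sum_subtractf sum_distrib_left)
    also have "(\<Sum>s | s \<in> C \<and> co s k = r. p s) = a k r * R"
      using sum_slice_prod[OF k, of a] by (simp add: a R_def A_def)
    finally show "(\<Sum>s | s \<in> C \<and> co s k = r. u s) = sum u C * al k r"
      using A[OF k(1)] sum_nz unfolding al_def pR by (simp add: field_simps)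
  qed
  moreover have "x \<in> param_points" unfolding x_def param_points_def by blast
  ultimately show ?thesis
    by (intro bexI[of _ x]) (auto simp: pu_vars_def)
qed

text \<open>The residual \<open>u - lam / nu * p\<close> has sum zero on every slice, so it is
  orthogonal to all additive functions of the coordinates. By \<open>tangent_torus\<close> these
  functions include all quotients \<open>v / p\<close> of tangent vectors \<open>v\<close>.\<close>

lemma param_critical_point:
  assumes q: "0 < q" and x: "x \<in> param_points"
    and xp: "\<And>s. s \<in> C \<Longrightarrow> x (Pvar s) \<noteq> 0" and xu: "x (Uvar origin) \<noteq> 0"
  shows "((\<lambda>s. if s \<in> C then x (Pvar s) else 0), (\<lambda>s. if s \<in> C then x (Uvar s) else 0)) \<in> critical_points"
    (is "(?p, ?u) \<in> _")
proof -
  obtain nu lam al U where x_eq: "x = param nu lam al U"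
    using x unfolding param_points_def by blast
  have p: "?p s = nu * (\<Prod>k<q. prob al k (co s k))" if "s \<in> C" for s
    using that by (simp add: x_eq param_def)
  have nu: "nu \<noteq> 0" using xp[OF origin(1)] by (auto simp: x_eq param_def)
  have nz: "?p s \<noteq> 0" if "s \<in> C" for s using xp that by simp
  have pP: "?p \<in> proj_points C" and uP: "?u \<in> proj_points C"
    using nz[OF origin(1)] xu origin(1) by (auto simp: proj_points_def fun_eq_iff)
  \<comment> \<open>The scale \<open>nu\<close> is assigned to factor 0, which exists since
    \<open>0 < q\<close>.\<close>
  define a where "a = (\<lambda>k j. (if k = 0 then nu else 1) * prob al k j)"
  have "?p s = (\<Prod>k<q. a k (co s k))" if "s \<in> C" for s
  proof -
    have "(\<Prod>k<q. if k = 0 then nu else 1) = nu" using q by (simp add: prod.If_cases)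
    then show ?thesis unfolding p[OF that] a_def prod.distrib by simp
  qed
  then have pM: "?p \<in> model" using pP unfolding model_def by blast
  have sum_p: "sum ?p C = nu"
  proof -
    have "sum ?p C = (\<Sum>s\<in>C. nu * (\<Prod>k<q. prob al k (co s k)))"
      by (rule sum.cong[OF refl], rule p)
    also have "\<dots> = nu * (\<Prod>k<q. \<Sum>j<D k. prob al k j)"
      by (simp only: sum_cells_prod sum_distrib_left[symmetric])
    finally show ?thesis by (simp add: prob_sum)
  qed
  have sum_u: "sum ?u C = lam"
  proof -
    have "sum ?u C = sum (param_u lam al U) C" by (rule sum.cong) (auto simp: x_eq param_def)
    then show ?thesis by (simp add: param_u_total)
  qed
  have slice: "(\<Sum>s | s \<in> C \<and> co s k = r. ?u s - lam / nu * ?p s) = 0" if k: "k < q" "r < D k" for k r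
  proof -
    have "(\<Sum>s | s \<in> C \<and> co s k = r. ?p s) = nu * (\<Sum>s | s \<in> C \<and> co s k = r. \<Prod>k<q. prob al k (co s k))"
      unfolding sum_distrib_left by (rule sum.cong[OF refl], rule p) simp
    also have "\<dots> = nu * prob al k r"
      unfolding sum_slice_prod[OF k] by (simp add: prob_sum)
    finally have 1: "(\<Sum>s | s \<in> C \<and> co s k = r. ?p s) = nu * prob al k r" .
    have "(\<Sum>s | s \<in> C \<and> co s k = r. ?u s) = (\<Sum>s | s \<in> C \<and> co s k = r. param_u lam al U s)"
      by (rule sum.cong) (auto simp: x_eq param_def)
    then have 2: "(\<Sum>s | s \<in> C \<and> co s k = r. ?u s) = lam * prob al k r"
      using param_u_marginal[OF k, of lam al U] by simp
    show ?thesis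
      unfolding sum_subtractf sum_distrib_left[symmetric] 1 2 using nu by simp
  qed
  have total: "(\<Sum>s\<in>C. ?u s - lam / nu * ?p s) = 0"
    unfolding sum_subtractf sum_distrib_left[symmetric] sum_p sum_u using nu by simp
  have "dlog_likelihood C ?u ?p v = 0" if v: "v \<in> tangent ?p" for v
  proof -
    from tangent_torus[OF pM nz v origin(1)] obtain c d where
      vd: "\<And>s. s \<in> C \<Longrightarrow> v s = ?p s * (c + (\<Sum>k<q. d k (co s k)))" by blast
    have "dlog_likelihood C ?u ?p v = (\<Sum>s\<in>C. (?u s - lam / nu * ?p s) * (c + (\<Sum>k<q. d k (co s k))))"
      unfolding dlog_likelihood_def sum_p sum_u
    proof (rule sum.cong[OF refl])
      fix s assume s: "s \<in> C"
      have "(?u s / ?p s - lam / nu) * ?p s = ?u s - lam / nu * ?p s"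
        using nz[OF s] by (simp add: left_diff_distrib)
      then show "(?u s / ?p s - lam / nu) * v s = (?u s - lam / nu * ?p s) * (c + (\<Sum>k<q. d k (co s k)))"
        unfolding vd[OF s] by (simp only: mult.assoc[symmetric])
    qed
    also have "\<dots> = (\<Sum>s\<in>C. ?u s - lam / nu * ?p s) * c
        + (\<Sum>k<q. \<Sum>s\<in>C. (?u s - lam / nu * ?p s) * d k (co s k))"
      unfolding distrib_left sum.distrib sum_distrib_left sum_distrib_right
      by (subst sum.swap[of _ C]) simp
    also have "(\<Sum>k<q. \<Sum>s\<in>C. (?u s - lam / nu * ?p s) * d k (co s k)) = 0"
    proof (rule sum.neutral, rule ballI)
      fix k assume "k \<in> {..<q}"
      then have k: "k < q" by simp
      have "(\<Sum>s\<in>C. (?u s - lam / nu * ?p s) * d k (co s k))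
        = (\<Sum>r<D k. \<Sum>s | s \<in> C \<and> co s k = r. (?u s - lam / nu * ?p s) * d k (co s k))"
        by (rule sum_slices[OF k, symmetric])
      also have "\<dots> = (\<Sum>r<D k. (\<Sum>s | s \<in> C \<and> co s k = r. ?u s - lam / nu * ?p s) * d k r)"
        unfolding sum_distrib_right by (intro sum.cong) auto
      also have "\<dots> = 0" using slice[OF k] by simp
      finally show "(\<Sum>s\<in>C. (?u s - lam / nu * ?p s) * d k (co s k)) = 0" .
    qed
    finally show ?thesis unfolding total by simp
  qed
  moreover have "?p \<notin> arrangement_H C"
    using nz nu sum_p by (auto simp: arrangement_H_def)
  ultimately show ?thesis
    using torus_smooth[OF pM nz q] uP unfolding critical_points_def by blast
qed

text \<open>Parametrized points are critical once all p coordinates and \<open>u\<close> at the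
  origin are nonzero. The factor \<open>h\<close> vanishes at the remaining ones, so
  \<open>f * h\<close> lies in the ideal, and primality removes \<open>h\<close>.\<close>

lemma vanishing_on_critical_points:
  assumes q: "0 < q" and f: "f \<in> carrier (pu_ring C)"
    and van: "\<And>p u. (p, u) \<in> critical_points \<Longrightarrow> eval_mpoly (case_pu_var p u) f = 0"
  shows "f \<in> param_ideal"
proof -
  interpret J: primeideal param_ideal "pu_ring C" by (rule primeideal_param_ideal)
  define h where "h = (\<Prod>s\<in>C. Var (Pvar s)) * Var (Uvar origin)"
  have h: "h \<in> carrier (pu_ring C)"
    unfolding h_def by (intro mpoly_carrier_closed(3) mpoly_carrier_prod Var_in_pu_ring origin)
  have eval_h: "eval_mpoly x h = (\<Prod>s\<in>C. x (Pvar s)) * x (Uvar origin)" for x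
    by (simp add: h_def)
  have "eval_mpoly x (f * h) = 0" if x: "x \<in> param_points" for x
  proof (cases "(\<forall>s\<in>C. x (Pvar s) \<noteq> 0) \<and> x (Uvar origin) \<noteq> 0")
    case True
    define p where "p = (\<lambda>s. if s \<in> C then x (Pvar s) else 0)"
    define u where "u = (\<lambda>s. if s \<in> C then x (Uvar s) else 0)"
    have "(p, u) \<in> critical_points"
      unfolding p_def u_def by (rule param_critical_point[OF q x]) (use True in auto)
    then have "eval_mpoly (case_pu_var p u) f = 0" by (rule van)
    moreover have "eval_mpoly (case_pu_var p u) f = eval_mpoly x f"
      by (rule eval_mpoly_cong[of f "pu_vars C"]) (use f in \<open>auto simp: carrier_mpoly_ring pu_vars_def p_def u_def\<close>)
    ultimately show ?thesis by simp
  next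
    case False
    then have "(\<Prod>s\<in>C. x (Pvar s)) = 0 \<or> x (Uvar origin) = 0" using finite_C by auto
    then show ?thesis by (auto simp: eval_h)
  qed
  then have "f * h \<in> param_ideal"
    unfolding param_ideal_def vanishing_polys_def using mpoly_carrier_closed(3)[OF f h] by blast
  moreover have "h \<notin> param_ideal"
  proof -
    \<comment> \<open>Uniform factors with equal p and u tables give a parametrized point at which
      \<open>h\<close> is nonzero.\<close>
    define al where "al = (\<lambda>k (j::nat). 1 / of_nat (D k) :: complex)"
    have sum_al: "(\<Sum>j<D k. al k j) = 1" if "k < q" for k
      using D_pos[OF that] by (simp add: al_def)
    have prob: "prob al k r = al k r" if "k < q" for k r
    proof -
      have "(\<Sum>j<D k. al k j) = 1" by (rule sum_al[OF that])
      moreover have "{..<D k} = insert 0 {1..<D k}" using D_pos[OF that] by auto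
      ultimately have "al k 0 + (\<Sum>j=1..<D k. al k j) = 1" by simp
      then have "prob al k 0 = al k 0" by (simp add: prob_def diff_eq_eq)
      then show ?thesis by (cases "r = 0") (simp_all add: prob_def)
    qed
    define u where "u = (\<lambda>s. \<Prod>k<q. al k (co s k))"
    have u_nz: "u s \<noteq> 0" if "s \<in> C" for s
      using D_pos by (simp add: u_def al_def)
    define x where "x = param 1 1 al u"
    have "x (Pvar s) = u s" if "s \<in> C" for s
      using prob by (simp add: x_def param_def u_def)
    moreover have "x (Uvar origin) = u origin"
      unfolding x_def param_def pu_var.case
    proof (rule param_u_unique[OF _ _ origin(1)])
      fix k r assume "(k, r) \<in> axes"
      then have k: "k < q" "r < D k" by (auto simp: axes_def)
      show "(\<Sum>s | s \<in> C \<and> co s k = r. u s) = 1 * al k r"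
        unfolding u_def sum_slice_prod[OF k] by (simp add: sum_al)
    next
      show "sum u C = 1" unfolding u_def sum_cells_prod by (simp add: sum_al)
    qed
    ultimately have "eval_mpoly x h \<noteq> 0"
      using u_nz origin(1) finite_C by (simp add: eval_h)
    moreover have "x \<in> param_points" unfolding x_def param_points_def by blast
    ultimately show ?thesis unfolding param_ideal_def vanishing_polys_def by blast
  qed
  ultimately show ?thesis using J.I_prime[OF f h] unfolding mpoly_ring_simps by blast
qed

text \<open>Taking the closure does not change the vanishing biforms. On the critical points they
  are exactly those of \<open>param_ideal\<close>, by the two directions of the
  parametrization.\<close>

lemma vanishing_biforms_closure:
  assumes "0 < q"
  shows "vanishing_biforms C (zariski_closure C critical_points) = {f \<in> param_ideal. bihomogeneous C f}"
proof -
  have "critical_points \<subseteq> proj_points C \<times> proj_points C"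
    by (auto simp: critical_points_def smooth_locus_def model_def)
  then have sub: "critical_points \<subseteq> zariski_closure C critical_points"
    by (auto simp: zariski_closure_def vanishing_biforms_def)
  show ?thesis
  proof (intro equalityI subsetI)
    fix f assume "f \<in> vanishing_biforms C (zariski_closure C critical_points)"
    then have f: "f \<in> carrier (pu_ring C)" "bihomogeneous C f"
      "\<And>p u. (p, u) \<in> critical_points \<Longrightarrow> eval_mpoly (case_pu_var p u) f = 0"
      using sub by (auto simp: vanishing_biforms_def)
    then show "f \<in> {f \<in> param_ideal. bihomogeneous C f}"
      using vanishing_on_critical_points[OF assms f(1)] by blast
  next
    fix f assume "f \<in> {f \<in> param_ideal. bihomogeneous C f}"
    then have f: "f \<in> param_ideal" "bihomogeneous C f" by auto
    then have fc: "f \<in> carrier (pu_ring C)" by (simp add: param_ideal_def vanishing_polys_def)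
    have "eval_mpoly (case_pu_var p u) f = 0" if pu: "(p, u) \<in> critical_points" for p u
    proof -
      obtain x where x: "x \<in> param_points" "\<And>v. v \<in> pu_vars C \<Longrightarrow> case_pu_var p u v = x v"
        using critical_point_param[OF pu] by blast
      have "eval_mpoly (case_pu_var p u) f = eval_mpoly x f"
        by (rule eval_mpoly_cong[of f "pu_vars C"]) (use fc x(2) in \<open>auto simp: carrier_mpoly_ring\<close>)
      then show ?thesis using f(1) x(1) by (simp add: param_ideal_def vanishing_polys_def)
    qed
    then have "f \<in> vanishing_biforms C critical_points"
      using fc f(2) by (auto simp: vanishing_biforms_def)
    then show "f \<in> vanishing_biforms C (zariski_closure C critical_points)"
      by (auto simp: vanishing_biforms_def zariski_closure_def)
  qed
qed

lemma bihomogeneous_p_minor: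
  assumes "k < q" "s \<in> C" "s' \<in> C"
  shows "bihomogeneous C (p_minor k s s')"
proof -
  have r: "co s k < D k" "co s' k < D k" using assms co_less by auto
  note t = upd(1)[OF assms(2) r(2)] upd(1)[OF assms(3) r(1)]
  have "(\<Sum>i\<in>C. lkp m (Pvar i)) = 2 \<and> (\<Sum>i\<in>C. lkp m (Uvar i)) = 0" if "m \<in> supp (p_minor k s s')" for m
  proof -
    have "m = Poly_Mapping.single (Pvar s) 1 + Poly_Mapping.single (Pvar s') 1 \<or>
      m = Poly_Mapping.single (Pvar (upd s k (co s' k))) 1 + Poly_Mapping.single (Pvar (upd s' k (co s k))) 1"
      using that by (auto simp: p_minor_def Var_mult in_keys_iff lookup_minus lookup_single when_def split: if_splits)
    then show ?thesis
      using assms(2,3) t finite_C by (auto simp: lookup_add lookup_single when_def sum.distrib)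
  qed
  then show ?thesis unfolding bihomogeneous_def by blast
qed

lemma bihomogeneous_u_minor:
  assumes "k < q" "s \<in> C" "r < D k"
  shows "bihomogeneous C (u_minor k s r)"
proof -
  have "(\<Sum>i\<in>C. lkp m (Pvar i)) = 1 \<and> (\<Sum>i\<in>C. lkp m (Uvar i)) = 1" if m: "m \<in> supp (u_minor k s r)" for m
  proof -
    have "\<exists>t\<in>C. \<exists>x\<in>C. m = Poly_Mapping.single (Pvar t) 1 + Poly_Mapping.single (Uvar x) 1"
    proof (rule ccontr)
      assume not: "\<not> ?thesis"
      have "lkp (Var (Pvar t) * u_marginal k j) m = 0" if t: "t \<in> C" for t j
        unfolding u_marginal_def sum_distrib_left Var_mult lookup_sum
        by (rule sum.neutral) (use not t in \<open>auto simp: lookup_single when_def\<close>)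
      then have "lkp (u_minor k s r) m = 0"
        using assms(2) upd(1)[OF assms(2,3)] by (simp add: u_minor_def lookup_minus)
      then show False using m by (simp add: in_keys_iff)
    qed
    then show ?thesis using finite_C by (auto simp: lookup_add lookup_single when_def sum.distrib)
  qed
  then show ?thesis unfolding bihomogeneous_def by blast
qed

end

text \<open>The likelihood ideal is generated by biforms only. They generate all of
  \<open>param_ideal\<close> because the minors generate it and are bihomogeneous.\<close>

theorem (in ordered_table) likelihood_ideal_eq:
  assumes "0 < q"
  shows "likelihood_ideal C model = param_ideal"
proof -
  let ?B = "{f \<in> param_ideal. bihomogeneous C f}"
  have J: "ideal param_ideal (pu_ring C)"
    unfolding param_ideal_def by (rule ideal_vanishing_polys)
  have "likelihood_ideal C model = Idl\<^bsub>pu_ring C\<^esub> ?B"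
    unfolding likelihood_ideal_def vanishing_ideal_def likelihood_correspondence_def
      critical_points_def[symmetric] vanishing_biforms_closure[OF assms] ..
  moreover have "Idl\<^bsub>pu_ring C\<^esub> ?B \<subseteq> param_ideal"
    by (rule Idl_mpoly_minimal[OF J]) auto
  moreover have "param_ideal \<subseteq> Idl\<^bsub>pu_ring C\<^esub> ?B"
  proof -
    have "G \<subseteq> ?B"
      using G_subset G_minor bihomogeneous_p_minor bihomogeneous_u_minor by fast
    moreover have "?B \<subseteq> carrier (pu_ring C)" using ideal_mpolyD(1)[OF J] by auto
    ultimately show ?thesis
      unfolding groebner_minors(1)[symmetric] using Idl_mpoly by (intro Idl_mpoly_minimal) blast+
  qed
  ultimately show ?thesis by blast
qed

section \<open>Lists of states\<close>

lemma cells_iff: "s \<in> cells ds \<longleftrightarrow> list_all2 (<) s ds"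
  by (simp add: states_def product_lists_set list_all2_map2)

lemma cells_iff_nth: "s \<in> cells ds \<longleftrightarrow> length s = length ds \<and> (\<forall>i<length ds. s ! i < ds ! i)"
  by (auto simp: cells_iff list_all2_conv_all_nth)

lemma distinct_states: "distinct (states ds)"
  unfolding states_def by (rule distinct_product_lists) auto

lemma length_states: "length (states ds) = prod_list ds"
  by (simp add: states_def length_product_lists o_def prod_list.eq_foldr)

lemma lexord_less_than_asym: "(x, y) \<in> lexord less_than \<Longrightarrow> (y, x) \<notin> lexord less_than"
  for x y :: "nat list"
  by (rule lexord_asymmetric) (auto intro: asymI)

lemma lexord_less_than_nth:
  fixes x y :: "nat list"
  assumes "length x = length y"
  shows "(x, y) \<in> lexord less_than \<longleftrightarrow> (\<exists>i<length y. x ! i < y ! i \<and> (\<forall>j<i. x ! j = y ! j))"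
proof -
  have "take i x = take i y \<longleftrightarrow> (\<forall>j<i. x ! j = y ! j)" if "i < length y" for i
    using that assms by (subst list_eq_iff_nth_eq) auto
  then show ?thesis using assms by (auto simp: lexord_take_index_conv)
qed

lemma sorted_states: "sorted_wrt (\<lambda>x y. (x, y) \<in> lexord less_than) (states ds)"
proof (induction ds)
  case (Cons d ds)
  have "sorted_wrt (\<lambda>x y. (x, y) \<in> lexord less_than) (concat (map (\<lambda>x. map ((#) x) (states ds)) xs))"
    if "sorted_wrt (<) xs" for xs
    using that
  proof (induction xs)
    case (Cons x xs)
    have "sorted_wrt (\<lambda>x y. (x, y) \<in> lexord less_than) (map ((#) x) (states ds))"
      using \<open>sorted_wrt _ (states ds)\<close> by (simp add: sorted_wrt_map)
    then show ?case using Cons by (auto simp: sorted_wrt_append)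
  qed simp
  from this[of "[0..<d]"] show ?case by (simp add: states_def)
qed (simp add: states_def)

lemma states_index_less:
  assumes "c < length (states ds)" "c' < length (states ds)"
    and "(states ds ! c, states ds ! c') \<in> lexord less_than"
  shows "c < c'"
proof (rule ccontr)
  assume "\<not> c < c'"
  then consider "c = c'" | "c' < c" by linarith
  then have "(states ds ! c', states ds ! c) \<in> lexord less_than"
  proof cases
    case 2
    then show ?thesis using sorted_wrt_nth_less[OF sorted_states] assms(1) by blast
  qed (use assms(3) in simp)
  then show False using lexord_less_than_asym assms(3) by blast
qed

lemma position:
  assumes "x \<in> set xs"
  shows "position xs x < length xs" "xs ! position xs x = x"
proof -
  show less: "position xs x < length xs"
    unfolding position_def using assms by (metis (mono_tags, lifting) length_takeWhile_le le_neq_implies_less takeWhile_eq_all_conv takeWhile_eq_take take_all_iff)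
  show "xs ! position xs x = x"
    using nth_length_takeWhile[of "\<lambda>y. y \<noteq> x" xs] less unfolding position_def by simp
qed

lemma position_nth: "distinct xs \<Longrightarrow> i < length xs \<Longrightarrow> position xs (xs ! i) = i"
  using position[of "xs ! i" xs] nth_eq_iff_index_eq nth_mem by metis

lemma list_all2_nths: "list_all2 P xs ys \<Longrightarrow> list_all2 P (nths xs A) (nths ys A)"
  by (induction xs ys arbitrary: A rule: list_all2_induct) (auto simp: nths_Cons)

lemma nths_eq_nth:
  "length xs = length ys \<Longrightarrow> nths xs A = nths ys A \<Longrightarrow> i \<in> A \<Longrightarrow> i < length xs \<Longrightarrow> xs ! i = ys ! i"
proof (induction xs ys arbitrary: A i rule: list_induct2)
  case (Cons x xs y ys)
  have tl: "nths xs {j. Suc j \<in> A} = nths ys {j. Suc j \<in> A}" and hd: "0 \<in> A \<Longrightarrow> x = y"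
    using Cons.prems(1) by (auto simp: nths_Cons split: if_splits)
  show ?case
  proof (cases i)
    case 0
    then show ?thesis using hd Cons.prems by simp
  next
    case (Suc j)
    then show ?thesis using Cons.IH[OF tl, of j] Cons.prems by simp
  qed
qed simp

lemma prod_list_nths: "prod_list (nths xs A) = (\<Prod>i\<in>{..<length xs} \<inter> A. xs ! i :: nat)"
proof (induction xs rule: rev_induct)
  case (snoc x xs)
  have "(\<Prod>i\<in>{..<length (xs @ [x])} \<inter> A. (xs @ [x]) ! i)
    = (\<Prod>i\<in>{..<length xs} \<inter> A. (xs @ [x]) ! i) * (if length xs \<in> A then x else 1)"
  proof (cases "length xs \<in> A")
    case True
    then have "{..<length (xs @ [x])} \<inter> A = insert (length xs) ({..<length xs} \<inter> A)" by auto
    then show ?thesis using True by simp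
  next
    case False
    then have "{..<length (xs @ [x])} \<inter> A = {..<length xs} \<inter> A" by (auto simp: less_Suc_eq)
    then show ?thesis using False by simp
  qed
  also have "(\<Prod>i\<in>{..<length xs} \<inter> A. (xs @ [x]) ! i) = (\<Prod>i\<in>{..<length xs} \<inter> A. xs ! i)"
    by (rule prod.cong) (auto simp: nth_append)
  finally show ?case by (simp add: nths_append snoc)
qed simp

lemma nths_remove: "nths xs (- {k}) = take k xs @ drop (Suc k) xs"
proof (induction xs arbitrary: k)
  case (Cons x xs)
  show ?case
  proof (cases k)
    case 0
    have "{j. Suc j \<in> - {0}} = (UNIV :: nat set)" by auto
    then show ?thesis by (simp add: nths_Cons 0 nths_all)
  next
    case (Suc j)
    have "{i. Suc i \<in> - {Suc j}} = - {j}" by auto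
    then show ?thesis by (simp add: nths_Cons Suc Cons)
  qed
qed simp

lemma minors2I:
  "r < r' \<Longrightarrow> r' < dim_row N \<Longrightarrow> c < c' \<Longrightarrow> c' < dim_col N \<Longrightarrow>
    N $$ (r, c) * N $$ (r', c') - N $$ (r, c') * N $$ (r', c) \<in> minors2 N"
  unfolding minors2_def by blast

section \<open>Joint independence models as tables\<close>

locale joint_independence =
  fixes ds :: "nat list" and Ss :: "nat set list"
  assumes ds_nonempty: "length ds \<ge> 1" and ds_pos: "\<forall>d\<in>set ds. d \<ge> 1"
    and partition: "partition_on {..<length ds} (set Ss)" and distinct_Ss: "distinct Ss"
begin

section \<open>Regrouping as a bijection of cells\<close>

abbreviation group_count :: nat where "group_count \<equiv> length Ss"

abbreviation sizes :: "nat list" where "sizes \<equiv> group_sizes ds Ss"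

abbreviation coord :: "nat list \<Rightarrow> nat \<Rightarrow> nat" where "coord s k \<equiv> regroup ds Ss s ! k"

lemma length_sizes: "length sizes = group_count" by (simp add: group_sizes_def)

lemma length_regroup: "length (regroup ds Ss s) = group_count" by (simp add: regroup_def)

lemma coord: "k < group_count \<Longrightarrow> coord s k = position (states (nths ds (Ss ! k))) (nths s (Ss ! k))"
  by (simp add: regroup_def)

lemma size: "k < group_count \<Longrightarrow> sizes ! k = length (states (nths ds (Ss ! k)))"
  by (simp add: group_sizes_def length_states)

lemma nths_cell: "s \<in> cells ds \<Longrightarrow> nths s A \<in> cells (nths ds A)"
  by (simp add: cells_iff list_all2_nths)

lemma coord_less: "s \<in> cells ds \<Longrightarrow> k < group_count \<Longrightarrow> coord s k < sizes ! k"
  using position(1)[OF nths_cell] by (simp add: coord size)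

lemma state_coord:
  "s \<in> cells ds \<Longrightarrow> k < group_count \<Longrightarrow> states (nths ds (Ss ! k)) ! coord s k = nths s (Ss ! k)"
  using position(2)[OF nths_cell] by (simp add: coord)

lemma coord_eq_iff:
  assumes "s \<in> cells ds" "k < group_count" "r < sizes ! k"
  shows "coord s k = r \<longleftrightarrow> nths s (Ss ! k) = states (nths ds (Ss ! k)) ! r"
  using assms state_coord[OF assms(1,2)] by (auto simp: coord size position_nth distinct_states)

lemma coord_inj:
  assumes s: "s \<in> cells ds" "s' \<in> cells ds" and eq: "\<And>k. k < group_count \<Longrightarrow> coord s k = coord s' k"
  shows "s = s'"
proof (rule nth_equalityI)
  have len: "length s = length ds" "length s' = length ds" using s by (auto simp: cells_iff_nth)
  then show "length s = length s'" by simp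
  fix i assume i: "i < length s"
  then have "i \<in> \<Union> (set Ss)" using partition_onD1[OF partition] len by auto
  then obtain k where k: "k < group_count" "i \<in> Ss ! k" by (auto simp: in_set_conv_nth)
  have "nths s (Ss ! k) = nths s' (Ss ! k)"
    using state_coord[OF s(1) k(1)] state_coord[OF s(2) k(1)] eq[OF k(1)] by simp
  then show "s ! i = s' ! i" using nths_eq_nth k(2) i len by metis
qed

lemma regroup_in_cells: "s \<in> cells ds \<Longrightarrow> regroup ds Ss s \<in> cells sizes"
  using coord_less by (simp add: cells_iff_nth length_regroup length_sizes)

lemma inj_regroup: "inj_on (regroup ds Ss) (cells ds)"
  by (rule inj_onI) (rule coord_inj, auto)

lemma prod_sizes: "prod_list sizes = prod_list ds"
proof -
  have part: "(\<Union>k<group_count. Ss ! k) = {..<length ds}"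
    unfolding partition_onD1[OF partition] set_conv_nth by blast
  have disj: "Ss ! k \<inter> Ss ! l = {}" if "k < group_count" "l < group_count" "k \<noteq> l" for k l
  proof -
    have "Ss ! k \<noteq> Ss ! l" using that distinct_Ss nth_eq_iff_index_eq by blast
    then show ?thesis
      using that disjointD[OF partition_onD2[OF partition], of "Ss ! k" "Ss ! l"] by simp
  qed
  have sub: "Ss ! k \<subseteq> {..<length ds}" if "k < group_count" for k using part that by blast
  have "prod_list sizes = (\<Prod>k<group_count. sizes ! k)"
    by (simp add: prod.list_conv_set_nth length_sizes atLeast0LessThan)
  also have "\<dots> = (\<Prod>k<group_count. \<Prod>i\<in>Ss ! k. ds ! i)"
    by (rule prod.cong) (use sub in \<open>auto simp: group_sizes_def prod_list_nths Int_absorb1\<close>)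
  also have "\<dots> = (\<Prod>i\<in>(\<Union>k<group_count. Ss ! k). ds ! i)"
  proof (rule prod.UNION_disjoint[symmetric])
    have "finite (Ss ! k)" if "k < group_count" for k
      by (rule finite_subset[OF sub[OF that]]) simp
    then show "\<forall>k\<in>{..<group_count}. finite (Ss ! k)" by simp
  qed (use disj in auto)
  also have "\<dots> = prod_list ds"
    unfolding part by (simp add: prod.list_conv_set_nth atLeast0LessThan)
  finally show ?thesis .
qed

text \<open>Injectivity holds because the blocks cover all positions. Surjectivity is a count: the
  blocks are disjoint, so both tables have the same number of cells.\<close>

lemma bij_regroup: "bij_betw (regroup ds Ss) (cells ds) (cells sizes)"
proof -
  have "card (cells xs) = prod_list xs" for xs
    using distinct_card[OF distinct_states] by (simp add: length_states)
  then have "regroup ds Ss ` cells ds = cells sizes"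
    using regroup_in_cells inj_regroup prod_sizes
    by (intro card_subset_eq) (auto simp: card_image)
  then show ?thesis using inj_regroup by (simp add: bij_betw_def)
qed

lemma ungroup:
  assumes "t \<in> cells sizes"
  shows "ungroup ds Ss t \<in> cells ds" "regroup ds Ss (ungroup ds Ss t) = t"
  using bij_regroup assms unfolding ungroup_def bij_betw_def
  by (auto simp: the_inv_into_into f_the_inv_into_f)

lemma ungroup_regroup: "s \<in> cells ds \<Longrightarrow> ungroup ds Ss (regroup ds Ss s) = s"
  unfolding ungroup_def by (rule the_inv_into_f_f[OF inj_regroup])

sublocale table "cells ds" group_count "\<lambda>k. sizes ! k" coord
proof
  fix t assume t: "\<And>k. k < group_count \<Longrightarrow> t k < sizes ! k"
  then have "map t [0..<group_count] \<in> cells sizes" by (simp add: cells_iff_nth length_sizes)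
  note t' = ungroup[OF this]
  show "\<exists>s\<in>cells ds. \<forall>k<group_count. coord s k = t k"
    by (rule bexI[OF _ t'(1)]) (simp add: t'(2))
next
  fix k assume k: "k < group_count"
  have "0 \<notin> set (nths ds (Ss ! k))" using ds_pos in_set_nthsD by fastforce
  then have "prod_list (nths ds (Ss ! k)) \<noteq> 0" by (simp only: prod_list_zero_iff not_False_eq_True)
  then show "0 < sizes ! k" using k by (simp add: group_sizes_def)
qed (use coord_less coord_inj in auto)

lemma group_count_pos: "0 < group_count"
proof -
  have "0 \<in> {..<length ds}" using ds_nonempty by (cases ds) auto
  then have "0 \<in> \<Union> (set Ss)" unfolding partition_onD1[OF partition] .
  then show ?thesis by (cases Ss) auto
qed

lemma model_eq: "joint_independence_model ds Ss = model"
proof -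
  have "(\<exists>a :: nat \<Rightarrow> nat list \<Rightarrow> complex. \<forall>s\<in>cells ds. p s = (\<Prod>k<group_count. a k (nths s (Ss ! k)))) \<longleftrightarrow>
    (\<exists>a. \<forall>s\<in>cells ds. p s = (\<Prod>k<group_count. a k (coord s k)))" for p
  proof
    assume "\<exists>a :: nat \<Rightarrow> nat list \<Rightarrow> complex. \<forall>s\<in>cells ds. p s = (\<Prod>k<group_count. a k (nths s (Ss ! k)))"
    then obtain a :: "nat \<Rightarrow> nat list \<Rightarrow> complex"
      where a: "\<forall>s\<in>cells ds. p s = (\<Prod>k<group_count. a k (nths s (Ss ! k)))" by blast
    show "\<exists>a. \<forall>s\<in>cells ds. p s = (\<Prod>k<group_count. a k (coord s k))"
      by (rule exI[of _ "\<lambda>k r. a k (states (nths ds (Ss ! k)) ! r)"]) (simp add: a state_coord)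
  next
    assume "\<exists>a. \<forall>s\<in>cells ds. p s = (\<Prod>k<group_count. a k (coord s k))"
    then obtain a where a: "\<forall>s\<in>cells ds. p s = (\<Prod>k<group_count. a k (coord s k))" by blast
    show "\<exists>a :: nat \<Rightarrow> nat list \<Rightarrow> complex. \<forall>s\<in>cells ds. p s = (\<Prod>k<group_count. a k (nths s (Ss ! k)))"
      by (rule exI[of _ "\<lambda>k x. a k (position (states (nths ds (Ss ! k))) x)"]) (simp add: a coord)
  qed
  then show ?thesis unfolding joint_independence_model_def model_def by simp
qed

section \<open>Entries and minors of the flattenings\<close>

definition rest_states :: "nat \<Rightarrow> nat list list" where
  "rest_states k = states (nths sizes (- {k}))"

definition entry_cell :: "nat \<Rightarrow> nat \<Rightarrow> nat \<Rightarrow> nat list" where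
  "entry_cell k r c = ungroup ds Ss (take k (rest_states k ! c) @ r # drop k (rest_states k ! c))"

lemma entry_cell:
  assumes k: "k < group_count" and r: "r < sizes ! k" and c: "c < length (rest_states k)"
  shows "entry_cell k r c \<in> cells ds"
    and "regroup ds Ss (entry_cell k r c) = take k (rest_states k ! c) @ r # drop k (rest_states k ! c)"
proof -
  define w where "w = rest_states k ! c"
  have "w \<in> cells (take k sizes @ drop (Suc k) sizes)"
    using nth_mem[OF c] unfolding w_def rest_states_def nths_remove by simp
  then have lw: "length w = group_count - 1"
    and w: "\<And>i. i < group_count - 1 \<Longrightarrow> w ! i < (take k sizes @ drop (Suc k) sizes) ! i"
    using k by (auto simp: cells_iff_nth length_sizes)
  have "take k w @ r # drop k w \<in> cells sizes"
    unfolding cells_iff_nth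
  proof (intro conjI allI impI)
    show "length (take k w @ r # drop k w) = length sizes" using lw k by (simp add: length_sizes)
    fix i assume i: "i < length sizes"
    consider "i < k" | "i = k" | "k < i" by linarith
    then show "(take k w @ r # drop k w) ! i < sizes ! i"
    proof cases
      case 1
      then show ?thesis using w[of i] lw k by (simp add: nth_append length_sizes)
    next
      case 2
      then show ?thesis using r lw k by (simp add: nth_append)
    next
      case 3
      then obtain j where j: "i = Suc j" by (cases i) auto
      then show ?thesis using 3 w[of j] lw k i by (simp add: nth_append length_sizes nth_Cons')
    qed
  qed
  from ungroup[OF this] show "entry_cell k r c \<in> cells ds"
    "regroup ds Ss (entry_cell k r c) = take k (rest_states k ! c) @ r # drop k (rest_states k ! c)"
    unfolding entry_cell_def w_def by auto
qed

lemma length_rest_state: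
  assumes "k < group_count" "c < length (rest_states k)"
  shows "length (rest_states k ! c) = group_count - 1"
proof -
  have "rest_states k ! c \<in> cells (take k sizes @ drop (Suc k) sizes)"
    using nth_mem[OF assms(2)] unfolding rest_states_def nths_remove by simp
  then show ?thesis using assms(1) by (auto simp: cells_iff_nth length_sizes)
qed

lemma coord_entry_cell:
  assumes k: "k < group_count" and r: "r < sizes ! k" and c: "c < length (rest_states k)"
    and l: "l < group_count"
  shows "coord (entry_cell k r c) l = (if l < k then rest_states k ! c ! l else if l = k then r else rest_states k ! c ! (l - 1))"
proof -
  have "length (rest_states k ! c) = group_count - 1" by (rule length_rest_state[OF k c])
  then show ?thesis
    unfolding entry_cell(2)[OF k r c] using k l by (auto simp: nth_append nth_Cons')
qed

lemma upd_entry_cell: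
  assumes k: "k < group_count" and r: "r < sizes ! k" "r' < sizes ! k" and c: "c < length (rest_states k)"
  shows "upd (entry_cell k r c) k r' = entry_cell k r' c"
proof (rule coord_inj[OF upd(1) entry_cell(1)])
  note e = entry_cell(1)[OF k r(1) c]
  fix l assume l: "l < group_count"
  show "coord (upd (entry_cell k r c) k r') l = coord (entry_cell k r' c) l"
    unfolding upd(2)[OF e r(2) l] coord_entry_cell[OF k r(1) c l] coord_entry_cell[OF k r(2) c l] by auto
qed (use assms entry_cell(1) in auto)

lemma entry_cell_exists:
  assumes k: "k < group_count" and s: "s \<in> cells ds"
  shows "\<exists>c<length (rest_states k). s = entry_cell k (coord s k) c \<and>
    rest_states k ! c = take k (regroup ds Ss s) @ drop (Suc k) (regroup ds Ss s)"
proof -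
  let ?t = "regroup ds Ss s"
  have "?t \<in> cells sizes" by (rule regroup_in_cells[OF s])
  then have "nths ?t (- {k}) \<in> set (rest_states k)"
    unfolding rest_states_def by (simp add: cells_iff list_all2_nths)
  then obtain c where c: "c < length (rest_states k)" "rest_states k ! c = take k ?t @ drop (Suc k) ?t"
    unfolding nths_remove by (auto simp: in_set_conv_nth)
  have "entry_cell k (coord s k) c = ungroup ds Ss ?t"
    unfolding entry_cell_def c(2) using k by (simp add: length_regroup id_take_nth_drop[symmetric])
  then show ?thesis using c ungroup_regroup[OF s] by auto
qed

text \<open>The columns of a flattening are listed in this lexicographic order, so
  \<open>rest_less\<close> turns into an inequality of column numbers.\<close>

lemma rest_less_lexord:
  assumes k: "k < group_count" and rest: "rest_less k s s'"
  shows "(take k (regroup ds Ss s) @ drop (Suc k) (regroup ds Ss s),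
    take k (regroup ds Ss s') @ drop (Suc k) (regroup ds Ss s')) \<in> lexord less_than"
proof -
  obtain l where l: "l < group_count" "l \<noteq> k" "coord s l < coord s' l"
    "\<And>j. j < l \<Longrightarrow> j \<noteq> k \<Longrightarrow> coord s j = coord s' j"
    using rest unfolding rest_less_def by blast
  \<comment> \<open>Deleting coordinate \<open>k\<close> moves all later positions down by
    one.\<close>
  define i where "i = (if l < k then l else l - 1)"
  have nth: "(take k (regroup ds Ss s) @ drop (Suc k) (regroup ds Ss s)) ! j = coord s (if j < k then j else Suc j)"
    if "j < group_count - 1" for j s
    using that k by (auto simp: nth_append length_regroup)
  show ?thesis
  proof (subst lexord_less_than_nth)
    show "\<exists>i<length (take k (regroup ds Ss s') @ drop (Suc k) (regroup ds Ss s')).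
      (take k (regroup ds Ss s) @ drop (Suc k) (regroup ds Ss s)) ! i
        < (take k (regroup ds Ss s') @ drop (Suc k) (regroup ds Ss s')) ! i \<and>
      (\<forall>j<i. (take k (regroup ds Ss s) @ drop (Suc k) (regroup ds Ss s)) ! j
        = (take k (regroup ds Ss s') @ drop (Suc k) (regroup ds Ss s')) ! j)"
    proof (intro exI[of _ i] conjI allI impI)
      have i: "i < group_count - 1" "(if i < k then i else Suc i) = l"
        using l(1,2) k by (auto simp: i_def)
      then show "i < length (take k (regroup ds Ss s') @ drop (Suc k) (regroup ds Ss s'))"
        using k by (simp add: length_regroup)
      show "(take k (regroup ds Ss s) @ drop (Suc k) (regroup ds Ss s)) ! i
        < (take k (regroup ds Ss s') @ drop (Suc k) (regroup ds Ss s')) ! i"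
        unfolding nth[OF i(1)] i(2) by (rule l(3))
      fix j assume j: "j < i"
      then have "j < group_count - 1" using i(1) by simp
      moreover have "coord s (if j < k then j else Suc j) = coord s' (if j < k then j else Suc j)"
        by (rule l(4)) (use j l(2) in \<open>auto simp: i_def split: if_splits\<close>)
      ultimately show "(take k (regroup ds Ss s) @ drop (Suc k) (regroup ds Ss s)) ! j
        = (take k (regroup ds Ss s') @ drop (Suc k) (regroup ds Ss s')) ! j"
        by (simp only: nth)
    qed
  qed (simp add: length_regroup)
qed

lemma dim_likelihood_matrix:
  "dim_row (likelihood_matrix ds Ss k) = sizes ! k"
  "dim_col (likelihood_matrix ds Ss k) = Suc (length (rest_states k))"
  by (simp_all add: likelihood_matrix_def flattening_def rest_states_def Let_def)

lemma likelihood_matrix_p: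
  assumes "r < sizes ! k" "c < length (rest_states k)"
  shows "likelihood_matrix ds Ss k $$ (r, c) = Var (Pvar (entry_cell k r c))"
  using assms unfolding likelihood_matrix_def
  by (subst mat_of_cols_index)
    (auto simp: flattening_def rest_states_def Let_def entry_cell_def nth_append)

lemma likelihood_matrix_u:
  assumes "k < group_count" "r < sizes ! k"
  shows "likelihood_matrix ds Ss k $$ (r, length (rest_states k)) = u_marginal k r"
proof -
  have "likelihood_matrix ds Ss k $$ (r, length (rest_states k)) = marginal_column ds Ss k $ r"
    using assms(2) unfolding likelihood_matrix_def
    by (subst mat_of_cols_index) (auto simp: flattening_def rest_states_def Let_def nth_append)
  also have "\<dots> = u_marginal k r"
  proof -
    have "{s. s \<in> cells ds \<and> nths s (Ss ! k) = states (nths ds (Ss ! k)) ! r} = {s. s \<in> cells ds \<and> coord s k = r}"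
      using coord_eq_iff[OF _ assms] by blast
    then show ?thesis using assms(2) by (simp add: marginal_column_def u_marginal_def)
  qed
  finally show ?thesis .
qed

lemma minor_p:
  assumes k: "k < group_count" and r: "r < sizes ! k" "r' < sizes ! k"
    and c: "c < length (rest_states k)" "c' < length (rest_states k)"
  defines "N \<equiv> likelihood_matrix ds Ss k"
  shows "N $$ (r, c) * N $$ (r', c') - N $$ (r, c') * N $$ (r', c)
    = p_minor k (entry_cell k r c) (entry_cell k r' c')"
  using coord_entry_cell[OF k r(1) c(1) k] coord_entry_cell[OF k r(2) c(2) k]
  by (simp add: N_def likelihood_matrix_p r c p_minor_def upd_entry_cell k mult.commute)

lemma minor_u:
  assumes k: "k < group_count" and r: "r < sizes ! k" "r' < sizes ! k" and c: "c < length (rest_states k)"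
  defines "N \<equiv> likelihood_matrix ds Ss k" and "L \<equiv> length (rest_states k)"
  shows "N $$ (r, c) * N $$ (r', L) - N $$ (r, L) * N $$ (r', c) = u_minor k (entry_cell k r c) r'"
  using coord_entry_cell[OF k r(1) c k]
  by (simp add: N_def L_def likelihood_matrix_p likelihood_matrix_u r c u_minor_def upd_entry_cell k mult.commute)

text \<open>A minor is a u minor exactly when its second column is the appended one. Conversely, two
  cells increasing in row and in the remaining coordinates lie in increasing columns, so their p
  minor occurs with the right sign.\<close>

sublocale ordered_table "cells ds" group_count "\<lambda>k. sizes ! k" coord
  "map (ungroup ds Ss) (states sizes)" "minor_generators ds Ss"
proof
  show "set (map (ungroup ds Ss) (states sizes)) = cells ds"
    using ungroup(1) ungroup_regroup regroup_in_cells by (auto simp: image_iff) metis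
  show "sorted_wrt (prefix_less group_count) (map (ungroup ds Ss) (states sizes))"
    unfolding sorted_wrt_map
  proof (rule sorted_wrt_mono_rel[OF _ sorted_states])
    fix x y assume xy: "x \<in> cells sizes" "y \<in> cells sizes" "(x, y) \<in> lexord less_than"
    then have "length x = length y" "length y = group_count" by (auto simp: cells_iff_nth length_sizes)
    then show "prefix_less group_count (ungroup ds Ss x) (ungroup ds Ss y)"
      using xy by (auto simp: prefix_less_def ungroup lexord_less_than_nth)
  qed
next
  fix g assume "g \<in> minor_generators ds Ss"
  then obtain k r r' c c' where k: "k < group_count" and r: "r < r'" "r' < sizes ! k"
    and c: "c < c'" "c' < Suc (length (rest_states k))"
    and g: "g = likelihood_matrix ds Ss k $$ (r, c) * likelihood_matrix ds Ss k $$ (r', c')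
      - likelihood_matrix ds Ss k $$ (r, c') * likelihood_matrix ds Ss k $$ (r', c)"
    unfolding minor_generators_def minors2_def dim_likelihood_matrix by blast
  have r': "r < sizes ! k" using r by simp
  have c1: "c < length (rest_states k)" using c by simp
  show "(\<exists>k<group_count. \<exists>s\<in>cells ds. \<exists>s'\<in>cells ds. g = p_minor k s s') \<or>
      (\<exists>k<group_count. \<exists>s\<in>cells ds. \<exists>r<sizes ! k. g = u_minor k s r)"
  proof (cases "c' < length (rest_states k)")
    case True
    then have "g = p_minor k (entry_cell k r c) (entry_cell k r' c')"
      unfolding g by (rule minor_p[OF k r' r(2) c1])
    then show ?thesis using k entry_cell(1)[OF k r' c1] entry_cell(1)[OF k r(2) True] by blast
  next
    case False
    then have "c' = length (rest_states k)" using c by simp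
    then have "g = u_minor k (entry_cell k r c) r'"
      unfolding g by (simp only: minor_u[OF k r' r(2) c1])
    then show ?thesis using k r entry_cell(1)[OF k r' c1] by blast
  qed
next
  fix k s s' assume k: "k < group_count" and s: "s \<in> cells ds" "s' \<in> cells ds"
    and less: "coord s k < coord s' k" and rest: "rest_less k s s'"
  obtain c where c: "c < length (rest_states k)" "s = entry_cell k (coord s k) c"
    "rest_states k ! c = take k (regroup ds Ss s) @ drop (Suc k) (regroup ds Ss s)"
    using entry_cell_exists[OF k s(1)] by blast
  obtain c' where c': "c' < length (rest_states k)" "s' = entry_cell k (coord s' k) c'"
    "rest_states k ! c' = take k (regroup ds Ss s') @ drop (Suc k) (regroup ds Ss s')"
    using entry_cell_exists[OF k s(2)] by blast
  have cc: "c < c'"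
    using rest_less_lexord[OF k rest] c(1,3) c'(1,3) states_index_less
    unfolding rest_states_def by metis
  note r = coord_less[OF s(1) k] coord_less[OF s(2) k]
  have "p_minor k s s' \<in> minors2 (likelihood_matrix ds Ss k)"
    unfolding minor_p[OF k r c(1) c'(1), folded c(2) c'(2), symmetric]
    by (rule minors2I) (use less r cc c'(1) in \<open>simp_all add: dim_likelihood_matrix\<close>)
  then show "p_minor k s s' \<in> minor_generators ds Ss"
    using k unfolding minor_generators_def by blast
next
  fix k s r assume k: "k < group_count" and s: "s \<in> cells ds" and less: "coord s k < r" and r: "r < sizes ! k"
  obtain c where c: "c < length (rest_states k)" "s = entry_cell k (coord s k) c"
    using entry_cell_exists[OF k s] by blast
  note r' = coord_less[OF s k]
  have "u_minor k s r \<in> minors2 (likelihood_matrix ds Ss k)"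
    unfolding minor_u[OF k r' r c(1), folded c(2), symmetric]
    by (rule minors2I) (use less r c(1) in \<open>simp_all add: dim_likelihood_matrix\<close>)
  then show "u_minor k s r \<in> minor_generators ds Ss"
    using k unfolding minor_generators_def by blast
qed

lemma vars_eq: "ordered_pu_vars ds Ss = vars"
  by (simp add: ordered_pu_vars_def vars_def Let_def)

lemma sum_of_minor_ideals_eq: "sum_of_minor_ideals ds Ss = param_ideal"
proof -
  have "minor_generators ds Ss \<subseteq> carrier (pu_ring (cells ds))"
    using G_subset unfolding param_ideal_def vanishing_polys_def by blast
  then have "minors2 (likelihood_matrix ds Ss k) \<subseteq> carrier (pu_ring (cells ds))" if "k < group_count" for k
    using that unfolding minor_generators_def by blast
  from Idl_UN_eq_sums[of group_count "\<lambda>k. minors2 (likelihood_matrix ds Ss k)", OF this]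
  have "sum_of_minor_ideals ds Ss = Idl\<^bsub>pu_ring (cells ds)\<^esub> (minor_generators ds Ss)"
    unfolding sum_of_minor_ideals_def I2_def minor_generators_def by simp
  then show ?thesis using groebner_minors(1) by simp
qed

end

theorem corollary3p5:
  fixes ds :: "nat list" and Ss :: "nat set list"
  assumes "length ds \<ge> 1"
    and "\<forall>d\<in>set ds. d \<ge> 1"
    and "partition_on {..<length ds} (set Ss)" and "distinct Ss"
  shows "primeideal (sum_of_minor_ideals ds Ss) (pu_ring (cells ds))
    \<and> sum_of_minor_ideals ds Ss
        = likelihood_ideal (cells ds) (joint_independence_model ds Ss)
    \<and> groebner_basis (pu_vars (cells ds)) (lex_term_order (ordered_pu_vars ds Ss))
        (minor_generators ds Ss) (sum_of_minor_ideals ds Ss)"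
proof -
  interpret joint_independence ds Ss by unfold_locales (use assms in auto)
  show ?thesis
    unfolding sum_of_minor_ideals_eq model_eq vars_eq likelihood_ideal_eq[OF group_count_pos]
    using primeideal_param_ideal groebner_minors(2) by blast
qed

end
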